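(* Suppose that $d<(2\wedge \beta^{-1})\alpha$ and that Assumption 1 holds. Then for every $\lambda>0$ there exists a unique random-field mild solution $u$ to the white-noise equation (W), and there exist positive constants $c_1,c_2$, not depending on $t$ or $\lambda$, such that $$\sup_{x\in\mathbb R^d}\mathbb E|u_t(x)|^2\le c_1\exp\!\Big(c_2\lambda^{\frac{2\alpha}{\alpha-d\beta}}\,t\Big)\quad\text{for all } t>0.$$
   Context: Fix $\nu>0$, $\alpha\in(0,2]$, $\beta\in(0,1)$, $d\ge 1$. Let $p(t,x)$ ($t>0$, $x\in\mathbb R^d$) be the transition density of the isotropic $\alpha$-stable process, i.e. $\int_{\mathbb R^d}e^{i\xi\cdot x}p(t,x)\,dx=e^{-t\nu|\xi|^\alpha}$. Let $E_\beta(z)=\sum_{k\ge0}z^k/\Gamma(1+\beta k)$ be the Mittag-Leffler function. The time-fractional heat kernel is $G_t(x)=\int_0^\infty p(s,x)f_{E_t}(s)\,ds$, where $f_{E_t}$ is the density of $E_t=\inf\{r>0:D_r>t\}$ and $D$ is a $\beta$-stable subordinator with $\mathbb E e^{-sD_1}=e^{-s^\beta}$; equivalently $\hat G_t(\xi)=\int e^{i\xi\cdot x}G_t(x)dx=E_\beta(-\nu|\xi|^\alpha t^\beta)$. For a function $u_0$ write $(\mathcal G u_0)_t(x)=\int_{\mathbb R^d}G_t(x-y)u_0(y)\,dy$. Let $W$ be a space-time white noise on $[0,\infty)\times\mathbb R^d$ and $\lambda>0$. Equation (W) is the mild (Walsh) formulation of $\partial_t^\beta u=-\nu(-\Delta)^{\alpha/2}u+I_t^{1-\beta}[\lambda\sigma(u)\dot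 W]$ ($\partial^\beta_t$ the Caputo derivative, $I^{1-\beta}_t$ the Riemann–Liouville fractional integral): a random-field mild solution is a jointly measurable, predictable random field $\{u_t(x)\}$ with $\sup_{x}\sup_{t\le T}\mathbb E|u_t(x)|^2<\infty$ for every $T>0$ and such that for all $t\ge0$, $x\in\mathbb R^d$, in $L^2(\Omega)$, $$u_t(x)=(\mathcal G u_0)_t(x)+\lambda\int_0^t\!\!\int_{\mathbb R^d}G_{t-s}(x-y)\sigma(u_s(y))\,W(dy\,ds).$$ Assumption 1: $u_0:\mathbb R^d\to\mathbb R$ is non-random, measurable, bounded and non-negative; $\sigma:\mathbb R\to\mathbb R$ is globally Lipschitz and satisfies $|\sigma(x)|\le L_\sigma|x|$ for all $x$, for some $L_\sigma>0$. *)

theory Defs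
  imports "HOL-Probability.Probability"
begin

definition mittag_leffler :: "real \<Rightarrow> real \<Rightarrow> real" where
  "mittag_leffler \<beta> z = (\<Sum>k. z ^ k / Gamma (1 + \<beta> * real k))"

text \<open>G t is, for every t > 0, an integrable function on R^d whose Fourier transform
  is E_beta(-nu |xi|^alpha t^beta); it is jointly measurable in (t,x).
  This determines G t up to Lebesgue null sets, which is all that matters below.\<close>

definition frac_heat_kernel ::
  "real \<Rightarrow> real \<Rightarrow> real \<Rightarrow> (real \<Rightarrow> real^'d \<Rightarrow> real) \<Rightarrow> bool" where
  "frac_heat_kernel \<nu> \<alpha> \<beta> G \<longleftrightarrow>
     (\<lambda>(t, x). G t x) \<in> borel_measurable (restrict_space lborel ({0<..} \<times> UNIV)) \<and>
     (\<forall>t>0. integrable lborel (G t) \<and>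
        (\<forall>\<xi>. (\<integral>x. cis (\<xi> \<bullet> x) * complex_of_real (G t x) \<partial>lborel)
              = complex_of_real (mittag_leffler \<beta> (- \<nu> * norm \<xi> powr \<alpha> * t powr \<beta>))))"

definition heat_conv ::
  "(real \<Rightarrow> real^'d \<Rightarrow> real) \<Rightarrow> (real^'d \<Rightarrow> real) \<Rightarrow> real \<Rightarrow> real^'d \<Rightarrow> real" where
  "heat_conv G u0 t x = (if t = 0 then u0 x else (\<integral>y. G t (x - y) * u0 y \<partial>lborel))"

definition wn_set :: "(real \<times> (real^'d)) set \<Rightarrow> bool" where
  "wn_set A \<longleftrightarrow> A \<in> sets lborel \<and> A \<subseteq> {0..} \<times> UNIV \<and> emeasure lborel A < \<infinity>"

text \<open>Characteristic function of the centred Gaussian family with covariance |A \<inter> B|.\<close>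
definition wn_cf :: "((real \<times> (real^'d)) set \<times> real) list \<Rightarrow> real" where
  "wn_cf L = exp (- (1/2) * (\<Sum>p\<leftarrow>L. \<Sum>q\<leftarrow>L. snd p * snd q * measure lborel (fst p \<inter> fst q)))"

definition white_noise ::
  "'w measure \<Rightarrow> (real \<Rightarrow> 'w measure) \<Rightarrow> ((real \<times> (real^'d)) set \<Rightarrow> 'w \<Rightarrow> real) \<Rightarrow> bool" where
  "white_noise M F W \<longleftrightarrow>
     prob_space M \<and>
     (\<forall>t. subalgebra M (F t)) \<and>
     (\<forall>s t. s \<le> t \<longrightarrow> sets (F s) \<subseteq> sets (F t)) \<and>
     (\<forall>A. wn_set A \<longrightarrow> W A \<in> borel_measurable M) \<and>
     (\<forall>L. (\<forall>p\<in>set L. wn_set (fst p)) \<longrightarrow>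
          (\<integral>\<omega>. cis (\<Sum>p\<leftarrow>L. snd p * W (fst p) \<omega>) \<partial>M) = complex_of_real (wn_cf L)) \<and>
     (\<forall>t\<ge>0. \<forall>A. wn_set A \<and> A \<subseteq> {0..t} \<times> UNIV \<longrightarrow> W A \<in> borel_measurable (F t)) \<and>
     (\<forall>t\<ge>0. \<forall>L E. (\<forall>p\<in>set L. wn_set (fst p) \<and> fst p \<subseteq> {t<..} \<times> UNIV) \<and> E \<in> sets (F t) \<longrightarrow>
          (\<integral>\<omega>. complex_of_real (indicator E \<omega>) * cis (\<Sum>p\<leftarrow>L. snd p * W (fst p) \<omega>) \<partial>M)
            = complex_of_real (measure M E * wn_cf L))"

definition predictable ::
  "'w measure \<Rightarrow> (real \<Rightarrow> 'w measure) \<Rightarrow> ((real \<times> (real^'d)) \<times> 'w) measure" where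
  "predictable M F = sigma (({0..} \<times> UNIV) \<times> space M)
     ({({a<..b} \<times> A) \<times> E | a b A E. 0 \<le> a \<and> a < b \<and> A \<in> sets (lborel :: (real^'d) measure)
                                     \<and> E \<in> sets (F a)} \<union>
      {({0} \<times> A) \<times> E | A E. A \<in> sets (lborel :: (real^'d) measure) \<and> E \<in> sets (F 0)})"

definition simple_ok ::
  "(real \<Rightarrow> 'w measure) \<Rightarrow> (('w \<Rightarrow> real) \<times> real \<times> real \<times> (real^'d) set) list \<Rightarrow> bool" where
  "simple_ok F L \<longleftrightarrow> (\<forall>(X, a, b, A) \<in> set L. 0 \<le> a \<and> a < b \<and> A \<in> sets lborel \<and>
      emeasure lborel A < \<infinity> \<and> X \<in> borel_measurable (F a) \<and> (\<exists>C. \<forall>\<omega>. \<bar>X \<omega>\<bar> \<le> C))"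

definition simple_eval ::
  "(('w \<Rightarrow> real) \<times> real \<times> real \<times> (real^'d) set) list \<Rightarrow> (real \<times> (real^'d)) \<Rightarrow> 'w \<Rightarrow> real" where
  "simple_eval L z \<omega> = sum_list (map (\<lambda>(X, a, b, A). X \<omega> * indicator ({a<..b} \<times> A) z) L)"

definition simple_int ::
  "((real \<times> (real^'d)) set \<Rightarrow> 'w \<Rightarrow> real) \<Rightarrow> (('w \<Rightarrow> real) \<times> real \<times> real \<times> (real^'d) set) list
     \<Rightarrow> 'w \<Rightarrow> real" where
  "simple_int W L \<omega> = sum_list (map (\<lambda>(X, a, b, A). X \<omega> * W ({a<..b} \<times> A) \<omega>) L)"

definition walsh_integral ::
  "'w measure \<Rightarrow> (real \<Rightarrow> 'w measure) \<Rightarrow> ((real \<times> (real^'d)) set \<Rightarrow> 'w \<Rightarrow> real)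
     \<Rightarrow> ((real \<times> (real^'d)) \<Rightarrow> 'w \<Rightarrow> real) \<Rightarrow> ('w \<Rightarrow> real) \<Rightarrow> bool" where
  "walsh_integral M F W f I \<longleftrightarrow>
     (\<lambda>(z, \<omega>). f z \<omega>) \<in> borel_measurable (predictable M F) \<and>
     (\<integral>\<^sup>+\<omega>. (\<integral>\<^sup>+z. ennreal ((f z \<omega>)\<^sup>2) * indicator ({0..} \<times> UNIV) z \<partial>lborel) \<partial>M) < \<infinity> \<and>
     I \<in> borel_measurable M \<and>
     (\<exists>S. (\<forall>n. simple_ok F (S n)) \<and>
        (\<lambda>n. \<integral>\<^sup>+\<omega>. (\<integral>\<^sup>+z. ennreal ((f z \<omega> - simple_eval (S n) z \<omega>)\<^sup>2)
                                * indicator ({0..} \<times> UNIV) z \<partial>lborel) \<partial>M) \<longlonglongrightarrow> 0 \<and>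
        (\<lambda>n. \<integral>\<^sup>+\<omega>. ennreal ((I \<omega> - simple_int W (S n) \<omega>)\<^sup>2) \<partial>M) \<longlonglongrightarrow> 0)"

definition mild_solution ::
  "'w measure \<Rightarrow> (real \<Rightarrow> 'w measure) \<Rightarrow> ((real \<times> (real^'d)) set \<Rightarrow> 'w \<Rightarrow> real)
    \<Rightarrow> (real \<Rightarrow> real^'d \<Rightarrow> real) \<Rightarrow> (real \<Rightarrow> real) \<Rightarrow> real \<Rightarrow> (real^'d \<Rightarrow> real)
    \<Rightarrow> (real \<Rightarrow> real^'d \<Rightarrow> 'w \<Rightarrow> real) \<Rightarrow> bool" where
  "mild_solution M F W G \<sigma> lam u0 u \<longleftrightarrow>
     (\<lambda>((t, x), \<omega>). u t x \<omega>) \<in> borel_measurable (restrict_space lborel ({0..} \<times> UNIV) \<Otimes>\<^sub>M M) \<and>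
     (\<lambda>((t, x), \<omega>). u t x \<omega>) \<in> borel_measurable (predictable M F) \<and>
     (\<forall>T. \<exists>C. \<forall>t\<in>{0..T}. \<forall>x. (\<integral>\<^sup>+\<omega>. ennreal ((u t x \<omega>)\<^sup>2) \<partial>M) \<le> ennreal C) \<and>
     (\<forall>t\<ge>0. \<forall>x. \<exists>I.
        walsh_integral M F W (\<lambda>(s, y) \<omega>. if s < t then G (t - s) (x - y) * \<sigma> (u s y \<omega>) else 0) I \<and>
        (AE \<omega> in M. u t x \<omega> = heat_conv G u0 t x + lam * I \<omega>))"

end

theory Submission
  imports Defs "HOL-Real_Asymp.Real_Asymp"
begin

text \<open>The two analytic inputs are the scaling laws \<open>\<parallel>G\<^sub>t\<parallel>\<^sub>1 = \<parallel>G\<^sub>1\<parallel>\<^sub>1\<close> and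
  \<open>\<parallel>G\<^sub>t\<parallel>\<^sub>2\<^sup>2 \<le> C t powr (-\<gamma>)\<close> with \<open>\<gamma> = d\<beta>/\<alpha> < 1\<close>. Both come from the Plancherel inequality
  \<open>\<parallel>g\<parallel>\<^sub>2 \<le> C \<parallel>F g\<parallel>\<^sub>2\<close> (\<open>F g\<close> the Fourier transform of an integrable \<open>g\<close>), together with the decay
  \<open>0 \<le> E\<^sub>\<beta>(-z) \<le> 1 / (1 + z / \<Gamma>(1 + \<beta>))\<close>, which is square integrable in \<open>\<xi>\<close> as \<open>d < 2\<alpha>\<close>. The
  decay is first shown for the Gruenwald--Letnikov discretisation of the fractional
  relaxation equation, where positivity and monotonicity are statements about power series
  coefficients, and it passes to the limit.

  On the stochastic side, Gaussian increments independent of the past give the Ito isometry for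
  simple processes, and a Dynkin argument shows these are dense. The stochastic convolution is
  \<open>L\<^sup>2\<close>-continuous in space-time because translations are continuous in \<open>L\<^sup>2\<close>; sampling it at grid points
  strictly in the past and passing to an almost sure limit yields a predictable version.

  With the norm \<open>sup exp (-\<theta> t) E |u\<^sub>t(x)|\<^sup>2\<close> the Picard map has Lipschitz constant
  \<open>C \<lambda>\<^sup>2 \<integral> s powr (-\<gamma>) exp (-\<theta> s) ds = C' \<lambda>\<^sup>2 \<theta> powr (\<gamma> - 1)\<close>. It is a contraction once
  \<open>\<theta> = c \<lambda> powr (2 / (1 - \<gamma>)) = c \<lambda> powr (2\<alpha> / (\<alpha> - d\<beta>))\<close>, which gives existence, uniqueness and the
  growth bound at the same time.\<close>

section \<open>The Mittag-Leffler function on the negative half-line\<close>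

unbundle no vec_syntax
unbundle fps_syntax

text \<open>The kernel is given only through its Fourier transform, so its positivity is not at
  hand: only norms and translations of \<open>G\<close> enter, and \<open>kernel_L1\<close> stands
  where a probability density would give 1. Complete monotonicity of \<open>mittag_leffler\<close>
  is replaced by a sign pattern: \<open>(1 - X) powr \<beta>\<close> has constant coefficient 1 and
  no other positive one, so dividing by this series plus \<mu> preserves nonnegative coefficients.
  The obstacle on the stochastic side is null sets. An integral is fixed only up to one for each
  \<open>(t, x)\<close>, while the next Picard step needs a jointly predictable field and the
  filtration is not assumed complete. Hence limits are taken by the everywhere defined
  \<open>seq_limit\<close>, and the Picard map is a relation, \<open>mild_step\<close>. The exact
  isometry is proved for simple processes; general integrals are bounded with a factor 4, which
  together with the contraction ratio 1/4 gives the 16 in \<open>growth_const\<close>. The estimate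
  at time t uses earlier times only, hence applies to every locally bounded field, and the growth
  bound holds for every mild solution, not just the constructed one.\<close>

definition neg_binomial_fps :: "real \<Rightarrow> real fps" where
  "neg_binomial_fps c = Abs_fps (\<lambda>n. pochhammer c n / fact n)"

text \<open>The series is the expansion of \<open>(1 - X) powr (- c)\<close>, so this is the
  exponent law; on coefficients it is the Vandermonde identity for rising factorials.\<close>

lemma neg_binomial_fps_mult:
  "neg_binomial_fps c * neg_binomial_fps d = neg_binomial_fps (c + d)"
proof (rule fps_ext)
  fix n
  have "(neg_binomial_fps c * neg_binomial_fps d) $ n
      = (\<Sum>k\<le>n. (pochhammer c k / fact k) * (pochhammer d (n - k) / fact (n - k)))"
    by (simp add: fps_mult_nth neg_binomial_fps_def atMost_atLeast0)
  also have "\<dots> = (\<Sum>k\<le>n. of_nat (n choose k) * pochhammer c k * pochhammer d (n - k)) / fact n"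
    unfolding sum_divide_distrib
    by (intro sum.cong refl) (simp add: binomial_fact field_simps)
  also have "\<dots> = neg_binomial_fps (c + d) $ n"
    by (simp add: neg_binomial_fps_def pochhammer_binomial_sum)
  finally show "(neg_binomial_fps c * neg_binomial_fps d) $ n = neg_binomial_fps (c + d) $ n" .
qed

lemma neg_binomial_fps_0: "neg_binomial_fps 0 = 1"
  by (rule fps_ext) (simp add: neg_binomial_fps_def pochhammer_0_left)

lemma neg_binomial_fps_1_nth: "neg_binomial_fps 1 $ n = 1"
  by (simp add: neg_binomial_fps_def pochhammer_fact[symmetric])

lemma neg_binomial_fps_nth_0: "neg_binomial_fps c $ 0 = 1"
  by (simp add: neg_binomial_fps_def)

lemma neg_binomial_fps_minus_1: "neg_binomial_fps (-1) = 1 - fps_X"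
proof -
  have "(1 - fps_X) * neg_binomial_fps 1 = (1 :: real fps)"
    by (rule fps_ext) (simp add: algebra_simps neg_binomial_fps_1_nth)
  moreover have "neg_binomial_fps 1 * neg_binomial_fps (-1) = 1"
    by (simp add: neg_binomial_fps_mult neg_binomial_fps_0)
  ultimately show ?thesis
    using mult.assoc[of "1 - fps_X" "neg_binomial_fps 1" "neg_binomial_fps (-1)"] by simp
qed

lemma neg_binomial_fps_nonneg: "c \<ge> 0 \<Longrightarrow> neg_binomial_fps c $ n \<ge> 0"
  by (simp add: neg_binomial_fps_def pochhammer_prod prod_nonneg)

text \<open>Of the factors of the rising factorial only the first one, \<open>- c\<close>, is
  negative when \<open>0 < c < 1\<close>.\<close>

lemma neg_binomial_fps_nonpos:
  assumes "0 < c" "c < 1" "n > 0"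
  shows "neg_binomial_fps (- c) $ n \<le> 0"
proof -
  obtain m where m: "n = Suc m" using assms(3) gr0_implies_Suc by blast
  have "pochhammer (1 - c) m \<ge> 0"
    using assms by (simp add: pochhammer_prod prod_nonneg)
  hence "pochhammer (- c) n \<le> 0"
    using assms by (simp add: m pochhammer_rec mult_nonneg_nonpos mult_nonneg_nonneg add.commute)
  thus ?thesis by (simp add: neg_binomial_fps_def divide_le_0_iff)
qed

lemma neg_binomial_fps_Suc:
  "neg_binomial_fps (1 + a) $ Suc n = neg_binomial_fps (1 + a) $ n * (1 + a / real (Suc n))"
  by (simp add: neg_binomial_fps_def pochhammer_rec' field_simps)

lemma neg_binomial_fps_le_power:
  assumes "a \<ge> 0"
  shows "neg_binomial_fps (1 + a) $ n \<le> (1 + a) ^ n"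
proof (induction n)
  case (Suc n)
  have "1 + a / real (Suc n) \<le> 1 + a"
    using assms by (simp add: field_simps)
  with Suc show ?case
    unfolding neg_binomial_fps_Suc power_Suc2 using assms
    by (intro mult_mono) (auto intro: neg_binomial_fps_nonneg)
qed (simp add: neg_binomial_fps_nth_0)

text \<open>For fixed \<open>n\<close> the coefficient grows at most polynomially in
  \<open>k\<close>, by the crude bound \<open>(1 + a) ^ n\<close>, so the geometric factor wins in
  the ratio test.\<close>

lemma summable_neg_binomial:
  assumes "0 < \<beta>" "0 \<le> \<mu>" "\<mu> < 1"
  shows "summable (\<lambda>k. \<mu> ^ k * neg_binomial_fps (1 + \<beta> * real k) $ n)"
proof (rule summable_comparison_test)
  define r where "r k = (1 + \<beta> * real (Suc k)) / (1 + \<beta> * real k)" for k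
  have "r \<longlonglongrightarrow> 1"
    unfolding r_def using assms(1) by real_asymp
  hence "(\<lambda>k. r k ^ n * \<mu>) \<longlonglongrightarrow> 1 ^ n * \<mu>"
    by (intro tendsto_intros)
  hence "\<forall>\<^sub>F k in sequentially. r k ^ n * \<mu> < (1 + \<mu>) / 2"
    using assms by (intro order_tendstoD(2)) auto
  then obtain N where N: "\<And>k. k \<ge> N \<Longrightarrow> r k ^ n * \<mu> < (1 + \<mu>) / 2"
    by (auto simp: eventually_at_top_linorder)
  show "summable (\<lambda>k. (1 + \<beta> * real k) ^ n * \<mu> ^ k)"
  proof (rule summable_ratio_test[of "(1 + \<mu>) / 2" N])
    fix k assume "k \<ge> N"
    have pos: "1 + \<beta> * real k > 0" using assms by (simp add: add_pos_nonneg)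
    hence "(1 + \<beta> * real (Suc k)) ^ n * \<mu> ^ Suc k
        = (r k ^ n * \<mu>) * ((1 + \<beta> * real k) ^ n * \<mu> ^ k)"
      by (simp add: r_def power_divide)
    also have "\<dots> \<le> (1 + \<mu>) / 2 * ((1 + \<beta> * real k) ^ n * \<mu> ^ k)"
      using N[OF \<open>k \<ge> N\<close>] pos assms by (intro mult_right_mono) auto
    finally show "norm ((1 + \<beta> * real (Suc k)) ^ n * \<mu> ^ Suc k)
        \<le> (1 + \<mu>) / 2 * norm ((1 + \<beta> * real k) ^ n * \<mu> ^ k)"
      using assms by (simp add: abs_mult power_abs)
  qed (use assms in auto)
  show "\<exists>N. \<forall>k\<ge>N. norm (\<mu> ^ k * neg_binomial_fps (1 + \<beta> * real k) $ n)
        \<le> (1 + \<beta> * real k) ^ n * \<mu> ^ k"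
    using assms by (auto simp: abs_mult neg_binomial_fps_nonneg mult.commute intro!: exI[of _ 0]
        mult_mono neg_binomial_fps_le_power)
qed

text \<open>Coefficients of \<open>(1 - X) powr (\<beta> - 1) / ((1 - X) powr \<beta> + \<mu>)\<close>, the Gruenwald--Letnikov
  discretisation of the relaxation function.\<close>
definition discrete_relaxation :: "real \<Rightarrow> real \<Rightarrow> nat \<Rightarrow> real" where
  "discrete_relaxation \<beta> \<mu> n = (\<Sum>k. (-\<mu>) ^ k * neg_binomial_fps (1 + \<beta> * real k) $ n)"

section \<open>Positivity, monotonicity and decay of the discrete relaxation\<close>

context
  fixes \<beta> \<mu> :: real
  assumes \<beta>: "0 < \<beta>" "\<beta> < 1" and \<mu>: "0 \<le> \<mu>" "\<mu> < 1"
begin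

lemma discrete_relaxation_sums:
  "(\<lambda>k. (-\<mu>) ^ k * neg_binomial_fps (1 + \<beta> * real k) $ n) sums discrete_relaxation \<beta> \<mu> n"
proof -
  have "summable (\<lambda>k. norm ((-\<mu>) ^ k * neg_binomial_fps (1 + \<beta> * real k) $ n))"
    using summable_neg_binomial[OF \<beta>(1) \<mu>, of n] \<beta> \<mu>
    by (simp add: abs_mult power_abs neg_binomial_fps_nonneg)
  thus ?thesis unfolding discrete_relaxation_def
    by (rule summable_sums[OF summable_norm_cancel])
qed

text \<open>Convolution with the coefficients of \<open>neg_binomial_fps \<beta>\<close> is the
  discrete fractional integral, so this is the integral form of the relaxation equation with initial
  value 1. Multiplying the defining series by \<open>neg_binomial_fps \<beta>\<close> shifts
  \<open>k\<close> to \<open>Suc k\<close>; only the summand for \<open>k = 0\<close>, which is 1,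
  is left over.\<close>

lemma discrete_relaxation_volterra:
  "Abs_fps (discrete_relaxation \<beta> \<mu>)
     + fps_const \<mu> * neg_binomial_fps \<beta> * Abs_fps (discrete_relaxation \<beta> \<mu>)
     = neg_binomial_fps 1"
proof (rule fps_ext)
  fix n
  let ?g = "discrete_relaxation \<beta> \<mu>"
  let ?B = neg_binomial_fps
  have "(\<lambda>k. \<Sum>i\<le>n. ?B \<beta> $ (n - i) * ((-\<mu>) ^ k * ?B (1 + \<beta> * real k) $ i)) sums
        (\<Sum>i\<le>n. ?B \<beta> $ (n - i) * ?g i)"
    by (intro sums_sum sums_mult discrete_relaxation_sums)
  moreover have "(\<Sum>i\<le>n. ?B \<beta> $ (n - i) * ((-\<mu>) ^ k * ?B (1 + \<beta> * real k) $ i))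
      = (-\<mu>) ^ k * ?B (1 + \<beta> * real (Suc k)) $ n" for k
  proof -
    have "?B (1 + \<beta> * real (Suc k)) = ?B (1 + \<beta> * real k) * ?B \<beta>"
      by (simp add: neg_binomial_fps_mult algebra_simps)
    hence "?B (1 + \<beta> * real (Suc k)) $ n = (\<Sum>i\<le>n. ?B (1 + \<beta> * real k) $ i * ?B \<beta> $ (n - i))"
      by (simp add: fps_mult_nth atMost_atLeast0)
    thus ?thesis by (simp add: sum_distrib_left mult_ac)
  qed
  ultimately have 1: "(\<lambda>k. (-\<mu>) ^ k * ?B (1 + \<beta> * real (Suc k)) $ n) sums
      (\<Sum>i\<le>n. ?B \<beta> $ (n - i) * ?g i)" by simp
  have 2: "(\<lambda>k. (-\<mu>) ^ Suc k * ?B (1 + \<beta> * real (Suc k)) $ n) sums (?g n - 1)"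
    using discrete_relaxation_sums[of n]
      sums_Suc_iff[of "\<lambda>k. (-\<mu>) ^ k * ?B (1 + \<beta> * real k) $ n" "?g n - 1"]
    by (simp add: neg_binomial_fps_1_nth)
  have "-\<mu> * (\<Sum>i\<le>n. ?B \<beta> $ (n - i) * ?g i) = ?g n - 1"
    using sums_unique2[OF sums_mult[OF 1, of "-\<mu>"]] 2 by (simp add: mult.assoc)
  moreover have "(?B \<beta> * Abs_fps ?g) $ n = (\<Sum>i\<le>n. ?B \<beta> $ (n - i) * ?g i)"
    unfolding mult.commute[of "?B \<beta>"] fps_mult_nth atMost_atLeast0
    by (rule sum.cong) (simp_all only: mult.commute fps_nth_Abs_fps)
  ultimately show "(Abs_fps ?g + fps_const \<mu> * ?B \<beta> * Abs_fps ?g) $ n = ?B 1 $ n"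
    by (simp add: neg_binomial_fps_1_nth mult.assoc)
qed

text \<open>Solving for the n-th coefficient of the quotient gives \<open>h $ n\<close> minus a sum
  over smaller indices. In that sum the coefficients of \<open>(1 - X) powr \<beta>\<close> are
  nonpositive and the earlier coefficients of \<open>f\<close> nonnegative, so it only helps; the
  diagonal factor is \<open>1 + \<mu>\<close>.\<close>

lemma fps_quotient_nonneg:
  fixes f h :: "real fps"
  assumes eq: "f * (neg_binomial_fps (-\<beta>) + fps_const \<mu>) = h" and h: "\<And>n. h $ n \<ge> 0"
  shows "f $ n \<ge> 0"
proof (induction n rule: less_induct)
  case (less n)
  let ?B = "neg_binomial_fps (-\<beta>)"
  have "h $ n = (\<Sum>i\<le>n. f $ i * ?B $ (n - i)) + f $ n * \<mu>"
    by (simp add: eq[symmetric] distrib_left fps_mult_nth[of f "neg_binomial_fps (-\<beta>)"]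
        atMost_atLeast0)
  also have "(\<Sum>i\<le>n. f $ i * ?B $ (n - i)) = f $ n + (\<Sum>i<n. f $ i * ?B $ (n - i))"
    by (subst lessThan_Suc_atMost[symmetric], subst sum.lessThan_Suc) (simp add: neg_binomial_fps_nth_0)
  finally have "f $ n * (1 + \<mu>) = h $ n - (\<Sum>i<n. f $ i * ?B $ (n - i))"
    by (simp add: algebra_simps)
  moreover have "(\<Sum>i<n. f $ i * ?B $ (n - i)) \<le> 0"
    using less \<beta> by (intro sum_nonpos mult_nonneg_nonpos neg_binomial_fps_nonpos) auto
  ultimately have "f $ n * (1 + \<mu>) \<ge> 0" using h[of n] by simp
  thus ?case using \<mu> by (simp add: zero_le_mult_iff)
qed

lemma discrete_relaxation_fps:
  "Abs_fps (discrete_relaxation \<beta> \<mu>) * (neg_binomial_fps (-\<beta>) + fps_const \<mu>)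
     = neg_binomial_fps (1 - \<beta>)"
proof -
  let ?g = "Abs_fps (discrete_relaxation \<beta> \<mu>)"
  have "neg_binomial_fps (-\<beta>) * neg_binomial_fps \<beta> = 1"
    by (simp add: neg_binomial_fps_mult neg_binomial_fps_0)
  hence "?g * (neg_binomial_fps (-\<beta>) + fps_const \<mu>)
      = neg_binomial_fps (-\<beta>) * (?g + fps_const \<mu> * neg_binomial_fps \<beta> * ?g)"
    by (simp add: distrib_left distrib_right mult.commute[of ?g] flip: mult.assoc)
  thus ?thesis by (simp add: discrete_relaxation_volterra neg_binomial_fps_mult)
qed

lemma discrete_relaxation_nonneg: "discrete_relaxation \<beta> \<mu> n \<ge> 0"
  using fps_quotient_nonneg[OF discrete_relaxation_fps, of n] \<beta>
  by (simp add: neg_binomial_fps_nonneg)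

text \<open>\<open>P\<close> is the generating function of the decrements, from index 1 on. It
  equals \<open>\<mu> / ((1 - X) powr \<beta> + \<mu>)\<close>, so the quotient lemma applies with a
  constant numerator.\<close>

lemma discrete_relaxation_antimono: "decseq (discrete_relaxation \<beta> \<mu>)"
proof (rule decseq_SucI)
  fix n
  let ?g = "Abs_fps (discrete_relaxation \<beta> \<mu>)"
  define P where "P = 1 - (1 - fps_X) * ?g"
  have "(1 - fps_X) * ?g * (neg_binomial_fps (-\<beta>) + fps_const \<mu>) = neg_binomial_fps (-\<beta>)"
    unfolding neg_binomial_fps_minus_1[symmetric] mult.assoc discrete_relaxation_fps
    by (simp add: neg_binomial_fps_mult)
  hence "P * (neg_binomial_fps (-\<beta>) + fps_const \<mu>) = fps_const \<mu>"
    unfolding P_def left_diff_distrib by simp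
  from fps_quotient_nonneg[OF this, of "Suc n"] \<mu>
  have "P $ Suc n \<ge> 0" by auto
  thus "discrete_relaxation \<beta> \<mu> (Suc n) \<le> discrete_relaxation \<beta> \<mu> n"
    by (simp add: P_def left_diff_distrib)
qed

text \<open>By monotonicity the convolution in the Volterra equation is at least the last value
  times the total weight of the kernel. That weight is a partial sum of coefficients, and partial
  sums amount to one more factor \<open>1 / (1 - X)\<close>, whence the exponent
  \<open>1 + \<beta>\<close>.\<close>

lemma discrete_relaxation_decay:
  "discrete_relaxation \<beta> \<mu> n * (1 + \<mu> * neg_binomial_fps (1 + \<beta>) $ n) \<le> 1"
proof -
  let ?g = "discrete_relaxation \<beta> \<mu>"
  let ?B = neg_binomial_fps
  have "1 = ?g n + \<mu> * (?B \<beta> * Abs_fps ?g) $ n"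
    using arg_cong[OF discrete_relaxation_volterra, of "\<lambda>f. f $ n"]
    by (simp add: neg_binomial_fps_1_nth mult.assoc)
  also have "(?B \<beta> * Abs_fps ?g) $ n = (\<Sum>i\<le>n. ?B \<beta> $ i * ?g (n - i))"
    by (simp add: fps_mult_nth atMost_atLeast0)
  finally have 1: "1 = ?g n + \<mu> * (\<Sum>i\<le>n. ?B \<beta> $ i * ?g (n - i))" .
  have "?B (1 + \<beta>) $ n = (\<Sum>i\<le>n. ?B \<beta> $ i)"
    using arg_cong[OF neg_binomial_fps_mult[of \<beta> 1], of "\<lambda>f. f $ n"]
    by (simp add: fps_mult_nth atMost_atLeast0 neg_binomial_fps_1_nth add.commute)
  hence "?B (1 + \<beta>) $ n * ?g n = (\<Sum>i\<le>n. ?B \<beta> $ i * ?g n)"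
    by (simp add: sum_distrib_right)
  also have "\<dots> \<le> (\<Sum>i\<le>n. ?B \<beta> $ i * ?g (n - i))"
    using \<beta> by (intro sum_mono mult_left_mono decseqD[OF discrete_relaxation_antimono]
        neg_binomial_fps_nonneg) auto
  finally have "\<mu> * (?B (1 + \<beta>) $ n * ?g n) \<le> \<mu> * (\<Sum>i\<le>n. ?B \<beta> $ i * ?g (n - i))"
    using \<mu> by (intro mult_left_mono) auto
  thus ?thesis using 1 by (simp add: algebra_simps)
qed

end

text \<open>Supplies the domination that is uniform in the number of steps: a normalised coefficient
  at one step number bounds those at all later ones. One step amounts to
  \<open>1 + a / (n + 1) \<le> ((n + 1) / n) powr a\<close>, which follows from
  \<open>1 + x \<le> exp x\<close> and \<open>ln x \<le> x - 1\<close>.\<close>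

lemma neg_binomial_fps_powr_antimono:
  assumes "a \<ge> 0" "0 < m" "m \<le> n"
  shows "neg_binomial_fps (1 + a) $ n / real n powr a \<le> neg_binomial_fps (1 + a) $ m / real m powr a"
  using assms(3)
proof (induction n rule: dec_induct)
  case (step n)
  have n: "n > 0" using step assms by simp
  have "1 + a / real (Suc n) \<le> exp (a / real (Suc n))"
    by (rule exp_ge_add_one_self)
  also have "1 / real (Suc n) \<le> ln (real (Suc n) / real n)"
  proof -
    have "ln (real n / real (Suc n)) \<le> real n / real (Suc n) - 1"
      using n by (intro ln_le_minus_one) auto
    thus ?thesis using n by (simp add: ln_div field_simps)
  qed
  hence "exp (a / real (Suc n)) \<le> exp (a * ln (real (Suc n) / real n))"
    using assms(1) mult_left_mono[of "1 / real (Suc n)" _ a] by simp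
  also have "\<dots> = real (Suc n) powr a / real n powr a"
    using n by (simp add: powr_def ln_div right_diff_distrib exp_diff)
  finally have *: "1 + a / real (Suc n) \<le> real (Suc n) powr a / real n powr a" .
  have "neg_binomial_fps (1 + a) $ Suc n / real (Suc n) powr a
      = neg_binomial_fps (1 + a) $ n / real (Suc n) powr a * (1 + a / real (Suc n))"
    by (simp add: neg_binomial_fps_Suc)
  also have "\<dots> \<le> neg_binomial_fps (1 + a) $ n / real (Suc n) powr a
      * (real (Suc n) powr a / real n powr a)"
    using assms * by (intro mult_left_mono divide_nonneg_nonneg neg_binomial_fps_nonneg) auto
  also have "\<dots> = neg_binomial_fps (1 + a) $ n / real n powr a"
    using n by simp
  finally show ?case using step by linarith
qed simp

text \<open>Gauss's limit formula for the Gamma function: the normalised coefficient is the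
  reciprocal of \<open>Gamma_series (1 + a) n\<close> up to a factor tending to 1.\<close>

lemma neg_binomial_fps_asymptotics:
  assumes "a \<ge> 0"
  shows "(\<lambda>n. neg_binomial_fps (1 + a) $ n / real n powr a) \<longlonglongrightarrow> 1 / Gamma (1 + a)"
proof -
  have "(\<lambda>n. (real n / (1 + a + real n)) / Gamma_series (1 + a) n) \<longlonglongrightarrow> 1 / Gamma (1 + a)"
  proof (intro tendsto_divide Gamma_series_LIMSEQ)
    show "(\<lambda>n. real n / (1 + a + real n)) \<longlonglongrightarrow> 1" by real_asymp
    show "Gamma (1 + a) \<noteq> 0" using assms Gamma_real_pos[of "1 + a"] by linarith
  qed
  moreover have "eventually (\<lambda>n. (real n / (1 + a + real n)) / Gamma_series (1 + a) n
      = neg_binomial_fps (1 + a) $ n / real n powr a) at_top"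
    using eventually_gt_at_top[of 0]
  proof eventually_elim
    case (elim n)
    define p where "p = pochhammer (1 + a) n"
    define s where "s = 1 + a + real n"
    have "exp ((1 + a) * ln (real n)) = real n * real n powr a"
      using elim by (simp add: powr_def distrib_right exp_add)
    hence "Gamma_series (1 + a) n = fact n * (real n * real n powr a) / (p * s)"
      by (simp add: Gamma_series_def p_def s_def pochhammer_Suc)
    moreover have "s > 0" using assms by (simp add: s_def)
    ultimately show ?case using elim
      by (simp add: neg_binomial_fps_def flip: p_def s_def)
  qed
  ultimately show ?thesis by (rule Lim_transform_eventually)
qed

text \<open>The interval up to time \<open>t\<close> is cut into \<open>n\<close> steps of length
  \<open>t / n\<close>. The power of \<open>t / n\<close> in each summand cancels the growth of its
  coefficient, so the summands converge to those of the Mittag-Leffler series, and Tannery's theorem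
  exchanges limit and sum.\<close>

lemma discrete_relaxation_tendsto:
  assumes \<beta>: "0 < \<beta>" "\<beta> < 1" and t: "t > 0"
  shows "(\<lambda>n. discrete_relaxation \<beta> ((t / real n) powr \<beta>) n) \<longlonglongrightarrow> mittag_leffler \<beta> (- (t powr \<beta>))"
proof -
  let ?B = neg_binomial_fps
  \<comment> \<open>With \<open>N > t\<close> the ratio \<open>h\<close> is below 1, so the series
    of absolute values at step number \<open>N\<close> converges; it dominates all later
    ones.\<close>
  obtain N :: nat where N: "real N > t" "N > 0"
    by (metis reals_Archimedean2 t less_trans of_nat_0_less_iff)
  define h where "h = (t / real N) powr \<beta>"
  have h: "0 \<le> h" "h < 1"
    using N t \<beta> powr_less_mono2[of \<beta> "t / real N" 1] by (auto simp: h_def)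
  have term_eq: "((t / real n) powr \<beta>) ^ k * x = t powr (\<beta> * real k) * (x / real n powr (\<beta> * real k))"
    if "n > 0" for n k :: nat and x
    using t that by (simp add: powr_divide power_divide powr_power mult.commute)
  have "(\<lambda>n. \<Sum>k. (- ((t / real n) powr \<beta>)) ^ k * ?B (1 + \<beta> * real k) $ n) \<longlonglongrightarrow>
      (\<Sum>k. (- (t powr \<beta>)) ^ k / Gamma (1 + \<beta> * real k))"
  proof (rule tannerys_theorem[THEN conjunct2, THEN conjunct2])
    show "((\<lambda>n. (- ((t / real n) powr \<beta>)) ^ k * ?B (1 + \<beta> * real k) $ n) \<longlongrightarrow>
        (- (t powr \<beta>)) ^ k / Gamma (1 + \<beta> * real k)) sequentially" for k
    proof -
      have "(\<lambda>n. (-1)^k * (t powr (\<beta> * real k) * (?B (1 + \<beta> * real k) $ n / real n powr (\<beta> * real k))))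
          \<longlonglongrightarrow> (-1)^k * (t powr (\<beta> * real k) * (1 / Gamma (1 + \<beta> * real k)))"
        using \<beta> by (intro tendsto_intros neg_binomial_fps_asymptotics) auto
      hence "(\<lambda>n. (-1)^k * (t powr (\<beta> * real k) * (?B (1 + \<beta> * real k) $ n / real n powr (\<beta> * real k))))
          \<longlonglongrightarrow> (- (t powr \<beta>)) ^ k / Gamma (1 + \<beta> * real k)"
        using t by (simp add: power_minus[of "_ powr _"] powr_power mult.commute)
      thus ?thesis
      proof (rule Lim_transform_eventually)
        show "\<forall>\<^sub>F n in sequentially. (-1)^k * (t powr (\<beta> * real k) *
              (?B (1 + \<beta> * real k) $ n / real n powr (\<beta> * real k)))
            = (- ((t / real n) powr \<beta>)) ^ k * ?B (1 + \<beta> * real k) $ n"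
          using eventually_gt_at_top[of 0]
        proof eventually_elim
          case (elim n)
          show ?case unfolding term_eq[OF elim, symmetric]
            by (subst (2) power_minus) (simp only: mult.assoc)
        qed
      qed
    qed
    show "\<forall>\<^sub>F (k,n) in at_top \<times>\<^sub>F sequentially.
        norm ((- ((t / real n) powr \<beta>)) ^ k * ?B (1 + \<beta> * real k) $ n)
        \<le> h ^ k * ?B (1 + \<beta> * real k) $ N"
    proof -
      have "norm ((- ((t / real n) powr \<beta>)) ^ k * ?B (1 + \<beta> * real k) $ n)
        \<le> h ^ k * ?B (1 + \<beta> * real k) $ N" if "n \<ge> N" for n k
      proof -
        have "norm ((- ((t / real n) powr \<beta>)) ^ k * ?B (1 + \<beta> * real k) $ n)
            = t powr (\<beta> * real k) * (?B (1 + \<beta> * real k) $ n / real n powr (\<beta> * real k))"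
          using \<beta> N that by (subst term_eq[symmetric]) (simp_all add: abs_mult power_abs neg_binomial_fps_nonneg)
        also have "\<dots> \<le> t powr (\<beta> * real k) * (?B (1 + \<beta> * real k) $ N / real N powr (\<beta> * real k))"
          using \<beta> N that by (intro mult_left_mono neg_binomial_fps_powr_antimono) auto
        finally show ?thesis unfolding h_def term_eq[OF N(2)] .
      qed
      thus ?thesis
        unfolding eventually_prod_filter
        by (intro exI[of _ "\<lambda>_. True"] exI[of _ "\<lambda>n. n \<ge> N"]) auto
    qed
    show "summable (\<lambda>k. h ^ k * ?B (1 + \<beta> * real k) $ N)"
      by (rule summable_neg_binomial) (use \<beta> h in auto)
  qed auto
  thus ?thesis by (simp add: discrete_relaxation_def mittag_leffler_def)
qed

text \<open>The discrete bounds pass to the limit along \<open>t / n\<close>, where t is chosen with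
  \<open>t powr \<beta> = z\<close>. The constant \<open>Gamma (1 + \<beta>)\<close> comes from the
  asymptotics of the total kernel weight. At \<open>z = 0\<close>, where no positive t exists, the
  series reduces to its constant term 1.\<close>

lemma mittag_leffler_bounds:
  assumes \<beta>: "0 < \<beta>" "\<beta> < 1" and z: "z \<ge> 0"
  shows "0 \<le> mittag_leffler \<beta> (- z)"
    and "mittag_leffler \<beta> (- z) \<le> 1 / (1 + z / Gamma (1 + \<beta>))"
proof -
  have "0 \<le> mittag_leffler \<beta> (- z) \<and> mittag_leffler \<beta> (- z) * (1 + z / Gamma (1 + \<beta>)) \<le> 1"
  proof (cases "z = 0")
    case True
    have "mittag_leffler \<beta> 0 = (\<Sum>k. (1 / Gamma (1 + \<beta> * real k)) * 0 ^ k)"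
      by (simp only: mittag_leffler_def times_divide_eq_left mult_1)
    also have "\<dots> = 1"
      by (subst powser_zero) simp
    finally show ?thesis using True by simp
  next
    case False
    define t where "t = z powr (1 / \<beta>)"
    have t: "t > 0" "t powr \<beta> = z" using False z \<beta> by (auto simp: t_def powr_powr)
    note lim = discrete_relaxation_tendsto[OF \<beta> t(1), unfolded t(2)]
    have ev: "eventually (\<lambda>n. real n > t \<and> n > 0) at_top"
      using eventually_gt_at_top[of "nat \<lceil>t\<rceil>"] by eventually_elim linarith
    have mu: "0 \<le> (t / real n) powr \<beta> \<and> (t / real n) powr \<beta> < 1" if "real n > t \<and> n > 0" for n
      using that t \<beta> powr_less_mono2[of \<beta> "t / real n" 1] by auto
    have "0 \<le> mittag_leffler \<beta> (- z)"
      by (rule tendsto_lowerbound[OF lim], rule eventually_mono[OF ev])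
        (use mu discrete_relaxation_nonneg[OF \<beta>] in auto)
    moreover have "(\<lambda>n. discrete_relaxation \<beta> ((t / real n) powr \<beta>) n
        * (1 + (t / real n) powr \<beta> * neg_binomial_fps (1 + \<beta>) $ n))
        \<longlonglongrightarrow> mittag_leffler \<beta> (- z) * (1 + z / Gamma (1 + \<beta>))"
    proof (intro tendsto_intros lim)
      have "(\<lambda>n. z * (neg_binomial_fps (1 + \<beta>) $ n / real n powr \<beta>)) \<longlonglongrightarrow> z * (1 / Gamma (1 + \<beta>))"
        using \<beta> by (intro tendsto_intros neg_binomial_fps_asymptotics) auto
      thus "(\<lambda>n. (t / real n) powr \<beta> * neg_binomial_fps (1 + \<beta>) $ n) \<longlonglongrightarrow> z / Gamma (1 + \<beta>)"
        using t by (simp add: powr_divide)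
    qed
    hence "mittag_leffler \<beta> (- z) * (1 + z / Gamma (1 + \<beta>)) \<le> 1"
      by (rule tendsto_upperbound, intro eventually_mono[OF ev])
        (use mu discrete_relaxation_decay[OF \<beta>] in auto)
    ultimately show ?thesis by simp
  qed
  moreover have "1 + z / Gamma (1 + \<beta>) > 0"
    using z \<beta> Gamma_real_pos[of "1 + \<beta>"] by (simp add: add_pos_nonneg)
  ultimately show "0 \<le> mittag_leffler \<beta> (- z)" "mittag_leffler \<beta> (- z) \<le> 1 / (1 + z / Gamma (1 + \<beta>))"
    by (simp_all only: pos_le_divide_eq)
qed

unbundle no fps_syntax
unbundle vec_syntax

section \<open>Continuity of translations\<close>

lemma tendsto_0_ennrealI:
  fixes f :: "'a \<Rightarrow> ennreal"
  assumes "\<And>r::real. r > 0 \<Longrightarrow> \<forall>\<^sub>F n in F. f n \<le> ennreal r"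
  shows "(f \<longlongrightarrow> 0) F"
proof (rule order_tendstoI)
  fix a :: ennreal assume "0 < a"
  then obtain b where b: "0 < b" "b < a" using dense by blast
  then obtain r where r: "b = ennreal r" "r > 0" by (cases b) auto
  show "\<forall>\<^sub>F n in F. f n < a"
    using assms[OF r(2)] by eventually_elim (use b r in auto)
qed auto

section \<open>Affine substitutions and translations in L1 and L2\<close>

lemma nn_integral_lborel_affine:
  fixes t :: "'a::euclidean_space"
  assumes [measurable]: "f \<in> borel_measurable borel" and c: "c \<noteq> 0"
  shows "(\<integral>\<^sup>+x. f x \<partial>lborel) = ennreal (\<bar>c\<bar> ^ DIM('a)) * (\<integral>\<^sup>+x. f (t + c *\<^sub>R x) \<partial>lborel)"
  by (subst lborel_affine[OF c, of t])
    (simp add: nn_integral_density nn_integral_distr nn_integral_cmult)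

lemma integrable_lborel_affine:
  fixes t :: "'a::euclidean_space" and f :: "'a \<Rightarrow> 'b::{banach, second_countable_topology}"
  assumes f: "integrable lborel f" and c: "c \<noteq> 0"
  shows "integrable lborel (\<lambda>x. f (t + c *\<^sub>R x))"
proof -
  have [measurable]: "f \<in> borel_measurable borel" using f by auto
  have pos: "\<not> \<bar>c\<bar> ^ DIM('a) \<le> 0" using c by (simp add: not_le)
  have "(\<integral>\<^sup>+x. norm (f x) \<partial>lborel) < \<infinity>" using f by (simp add: integrable_iff_bounded)
  thus ?thesis
    using c pos unfolding integrable_iff_bounded
    by (subst (asm) nn_integral_lborel_affine[OF _ c, of _ t])
      (auto simp: ennreal_mult_less_top ennreal_eq_0_iff)
qed

lemma integral_lborel_affine:
  fixes t :: "'a::euclidean_space" and f :: "'a \<Rightarrow> 'b::{banach, second_countable_topology}"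
  assumes f: "integrable lborel f" and c: "c \<noteq> 0"
  shows "(\<integral>x. f (t + c *\<^sub>R x) \<partial>lborel) = (\<integral>x. f x \<partial>lborel) /\<^sub>R \<bar>c\<bar> ^ DIM('a)"
proof -
  have [measurable]: "f \<in> borel_measurable borel" using f by auto
  have "(\<integral>x. f x \<partial>lborel) = \<bar>c\<bar> ^ DIM('a) *\<^sub>R (\<integral>x. f (t + c *\<^sub>R x) \<partial>lborel)"
    using integrable_lborel_affine[OF f c, of t]
    by (subst lborel_affine[OF c, of t]) (simp add: integral_density integral_distr)
  thus ?thesis using c by simp
qed

lemmas integrable_lborel_translate = integrable_lborel_affine[where c = 1, simplified]
lemmas integral_lborel_translate = integral_lborel_affine[where c = 1, simplified]

lemma integral_translation_diff_le:
  fixes f g :: "'a::euclidean_space \<Rightarrow> real"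
  assumes f: "integrable lborel f" and g: "integrable lborel g"
  shows "(\<integral>x. \<bar>f (h + x) - f x\<bar> \<partial>lborel)
     \<le> (\<integral>x. \<bar>g (h + x) - g x\<bar> \<partial>lborel) + 2 * (\<integral>x. \<bar>f x - g x\<bar> \<partial>lborel)"
proof -
  note fh = integrable_lborel_translate[OF f, of h] and gh = integrable_lborel_translate[OF g, of h]
  have "(\<integral>x. \<bar>f (h + x) - f x\<bar> \<partial>lborel)
      \<le> (\<integral>x. \<bar>g (h + x) - g x\<bar> + (\<bar>f (h + x) - g (h + x)\<bar> + \<bar>f x - g x\<bar>) \<partial>lborel)"
    using f g fh gh by (intro integral_mono) auto
  also have "\<dots> = (\<integral>x. \<bar>g (h + x) - g x\<bar> \<partial>lborel)
      + ((\<integral>x. \<bar>f (h + x) - g (h + x)\<bar> \<partial>lborel) + (\<integral>x. \<bar>f x - g x\<bar> \<partial>lborel))"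
    using f g fh gh by simp
  also have "(\<integral>x. \<bar>f (h + x) - g (h + x)\<bar> \<partial>lborel) = (\<integral>x. \<bar>f x - g x\<bar> \<partial>lborel)"
    using f g by (intro integral_lborel_translate[of "\<lambda>x. \<bar>f x - g x\<bar>"]) auto
  finally show ?thesis by simp
qed

text \<open>The translation error of \<open>f\<close> exceeds that of an L1-close \<open>g\<close>
  by at most twice their distance, uniformly in the shift, so it suffices to treat arbitrarily close
  approximants.\<close>

lemma translation_continuous_L1_approx:
  fixes f :: "'a::euclidean_space \<Rightarrow> real" and h :: "nat \<Rightarrow> 'a"
  assumes f: "integrable lborel f"
    and approx: "\<And>e. e > 0 \<Longrightarrow> \<exists>g. integrable lborel g \<and> (\<integral>x. \<bar>f x - g x\<bar> \<partial>lborel) \<le> e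
        \<and> (\<lambda>n. \<integral>x. \<bar>g (h n + x) - g x\<bar> \<partial>lborel) \<longlonglongrightarrow> 0"
  shows "(\<lambda>n. \<integral>x. \<bar>f (h n + x) - f x\<bar> \<partial>lborel) \<longlonglongrightarrow> 0"
proof (rule LIMSEQ_I)
  fix r :: real assume r: "r > 0"
  then obtain g where g: "integrable lborel g" "(\<integral>x. \<bar>f x - g x\<bar> \<partial>lborel) \<le> r / 4"
    "(\<lambda>n. \<integral>x. \<bar>g (h n + x) - g x\<bar> \<partial>lborel) \<longlonglongrightarrow> 0"
    using approx[of "r / 4"] by auto
  from LIMSEQ_D[OF g(3), of "r / 2"] r obtain N where
    N: "\<And>n. n \<ge> N \<Longrightarrow> norm ((\<integral>x. \<bar>g (h n + x) - g x\<bar> \<partial>lborel) - 0) < r / 2" by auto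
  show "\<exists>N. \<forall>n\<ge>N. norm ((\<integral>x. \<bar>f (h n + x) - f x\<bar> \<partial>lborel) - 0) < r"
  proof (intro exI allI impI)
    fix n assume "n \<ge> N"
    have "(\<integral>x. \<bar>f (h n + x) - f x\<bar> \<partial>lborel) < r"
      using integral_translation_diff_le[OF f g(1), of "h n"] g(2) N[OF \<open>n \<ge> N\<close>]
      by (simp add: integral_nonneg_AE)
    thus "norm ((\<integral>x. \<bar>f (h n + x) - f x\<bar> \<partial>lborel) - 0) < r"
      by (simp add: integral_nonneg_AE)
  qed
qed

text \<open>A point of an open set stays in it under small shifts, so the one-sided difference tends
  to 0 pointwise and is dominated by the fixed indicator. The other side has no such dominating
  function, but it has the same integral, because a translate has the same measure.\<close>

lemma translation_continuous_L1_open: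
  fixes U :: "'a::euclidean_space set" and h :: "nat \<Rightarrow> 'a"
  assumes U: "open U" "emeasure lborel U < \<infinity>" and h: "h \<longlonglongrightarrow> 0"
  shows "(\<lambda>n. \<integral>x. \<bar>indicator U (h n + x) - indicator U x :: real\<bar> \<partial>lborel) \<longlonglongrightarrow> 0"
proof -
  let ?i = "indicator U :: 'a \<Rightarrow> real"
  have [measurable]: "U \<in> sets borel" using U by auto
  have i: "integrable lborel ?i" using U by (auto intro!: integrable_real_indicator)
  have split: "\<bar>?i y - ?i x\<bar> = 2 * (?i x * (1 - ?i y)) + (?i y - ?i x)" for x y
    by (auto simp: indicator_def)
  have prod_int: "integrable lborel (\<lambda>x. ?i x * (1 - ?i (h n + x)))" for n
    by (rule Bochner_Integration.integrable_bound[OF i]) (auto simp: indicator_def)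
  have "(\<integral>x. \<bar>?i (h n + x) - ?i x\<bar> \<partial>lborel) = 2 * (\<integral>x. ?i x * (1 - ?i (h n + x)) \<partial>lborel)" for n
    unfolding split using prod_int[of n] i integrable_lborel_translate[OF i, of "h n"]
      integral_lborel_translate[OF i, of "h n"] by simp
  moreover have "(\<lambda>n. 2 * (\<integral>x. ?i x * (1 - ?i (h n + x)) \<partial>lborel)) \<longlonglongrightarrow> 2 * (\<integral>(x::'a). 0 \<partial>lborel)"
  proof (intro tendsto_mult tendsto_const integral_dominated_convergence[where w = ?i])
    show "AE x in lborel. (\<lambda>n. ?i x * (1 - ?i (h n + x))) \<longlonglongrightarrow> 0"
    proof (rule AE_I2)
      fix x :: 'a
      show "(\<lambda>n. ?i x * (1 - ?i (h n + x))) \<longlonglongrightarrow> 0"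
      proof (cases "x \<in> U")
        case True
        have "(\<lambda>n. h n + x) \<longlonglongrightarrow> 0 + x" by (intro tendsto_intros h)
        hence "eventually (\<lambda>n. h n + x \<in> U) sequentially"
          using topological_tendstoD[OF _ U(1)] True by auto
        hence "eventually (\<lambda>n. ?i x * (1 - ?i (h n + x)) = 0) sequentially"
          by eventually_elim simp
        thus ?thesis by (rule tendsto_eventually)
      qed simp
    qed
  qed (auto simp: indicator_def i)
  ultimately show ?thesis by simp
qed

text \<open>Outer regularity reduces measurable sets of finite measure to open ones; the remaining
  steps of the induction for integrable functions are linear or approximations in L1.\<close>

lemma translation_continuous_L1:
  fixes f :: "'a::euclidean_space \<Rightarrow> real" and h :: "nat \<Rightarrow> 'a"
  assumes f: "integrable lborel f" and h: "h \<longlonglongrightarrow> 0"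
  shows "(\<lambda>n. \<integral>x. \<bar>f (h n + x) - f x\<bar> \<partial>lborel) \<longlonglongrightarrow> 0"
  using f
proof (induction rule: integrable_induct)
  case (base A c)
  have "(\<lambda>n. \<integral>x. \<bar>indicator A (h n + x) - indicator A x :: real\<bar> \<partial>lborel) \<longlonglongrightarrow> 0"
  proof (rule translation_continuous_L1_approx)
    fix e :: real assume e: "e > 0"
    have A: "A \<in> sets borel" using base by simp
    obtain U where U: "open U" "A \<subseteq> U" "emeasure lborel (U - A) < e"
      using outer_regular_lborel[OF A e] by auto
    have Ub: "U \<in> sets borel" using U by auto
    have "emeasure lborel U \<le> emeasure lborel (U - A) + emeasure lborel A"
      using U A Ub by (intro order.trans[OF _ emeasure_subadditive] emeasure_mono) auto
    also have "\<dots> < \<infinity>"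
      using U(3) base by (auto simp: less_top[symmetric] dest: order.strict_trans[OF _ ennreal_less_top])
    finally have fin: "emeasure lborel U < \<infinity>" .
    have "(\<integral>x. \<bar>indicator A x - indicator U x :: real\<bar> \<partial>lborel) = (\<integral>x. indicator (U - A) x \<partial>lborel)"
      using U(2) by (intro Bochner_Integration.integral_cong refl) (auto simp: indicator_def)
    also have "\<dots> = measure lborel (U - A)" by simp
    also have "\<dots> \<le> e"
      using U(3) e by (auto simp: measure_def intro!: enn2real_leI)
    finally show "\<exists>g. integrable lborel g \<and> (\<integral>x. \<bar>indicator A x - g x\<bar> \<partial>lborel) \<le> e
        \<and> (\<lambda>n. \<integral>x. \<bar>g (h n + x) - g x\<bar> \<partial>lborel) \<longlonglongrightarrow> 0"
      using fin Ub translation_continuous_L1_open[OF U(1) fin h]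
      by (intro exI[of _ "indicator U"]) (auto intro!: integrable_real_indicator)
  qed (use base in \<open>auto intro!: integrable_real_indicator\<close>)
  hence "(\<lambda>n. \<bar>c\<bar> * (\<integral>x. \<bar>indicator A (h n + x) - indicator A x :: real\<bar> \<partial>lborel)) \<longlonglongrightarrow> \<bar>c\<bar> * 0"
    by (intro tendsto_intros)
  moreover have "\<bar>c\<bar> * (\<integral>x. \<bar>indicator A (h n + x) - indicator A x :: real\<bar> \<partial>lborel)
      = (\<integral>x. \<bar>indicator A (h n + x) *\<^sub>R c - indicator A x *\<^sub>R c\<bar> \<partial>lborel)" for n
    by (subst integral_mult_right_zero[symmetric])
      (simp add: abs_mult[symmetric] algebra_simps del: integral_mult_right_zero)
  ultimately show ?case by simp
next
  case (add f g)
  show ?case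
  proof (rule tendsto_sandwich[OF _ _ tendsto_const[of 0]])
    show "(\<lambda>n. (\<integral>x. \<bar>f (h n + x) - f x\<bar> \<partial>lborel) + (\<integral>x. \<bar>g (h n + x) - g x\<bar> \<partial>lborel)) \<longlonglongrightarrow> 0"
      using tendsto_add[OF add(3,4)] by simp
    show "\<forall>\<^sub>F n in sequentially. (\<integral>x. \<bar>f (h n + x) + g (h n + x) - (f x + g x)\<bar> \<partial>lborel)
        \<le> (\<integral>x. \<bar>f (h n + x) - f x\<bar> \<partial>lborel) + (\<integral>x. \<bar>g (h n + x) - g x\<bar> \<partial>lborel)"
    proof (intro always_eventually allI)
      fix n
      note i = add(1,2) integrable_lborel_translate[OF add(1), of "h n"]
        integrable_lborel_translate[OF add(2), of "h n"]
      show "(\<integral>x. \<bar>f (h n + x) + g (h n + x) - (f x + g x)\<bar> \<partial>lborel)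
        \<le> (\<integral>x. \<bar>f (h n + x) - f x\<bar> \<partial>lborel) + (\<integral>x. \<bar>g (h n + x) - g x\<bar> \<partial>lborel)"
        using i integral_mono[of lborel "\<lambda>x. \<bar>f (h n + x) + g (h n + x) - (f x + g x)\<bar>"
            "\<lambda>x. \<bar>f (h n + x) - f x\<bar> + \<bar>g (h n + x) - g x\<bar>"] by simp
    qed
  qed (auto intro!: always_eventually integral_nonneg_AE)
next
  case (lim f s)
  show ?case
  proof (rule translation_continuous_L1_approx[OF lim(4)])
    fix e :: real assume e: "e > 0"
    have "(\<lambda>i. \<integral>x. \<bar>f x - s i x\<bar> \<partial>lborel) \<longlonglongrightarrow> (\<integral>(x::'a). 0 \<partial>lborel)"
    proof (rule integral_dominated_convergence[where w = "\<lambda>x. 3 * \<bar>f x\<bar>"])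
      show "AE x in lborel. (\<lambda>i. \<bar>f x - s i x\<bar>) \<longlonglongrightarrow> 0"
      proof (rule AE_I2)
        fix x :: 'a
        have "(\<lambda>i. \<bar>f x - s i x\<bar>) \<longlonglongrightarrow> \<bar>f x - f x\<bar>"
          using lim(2)[of x] by (intro tendsto_intros) auto
        thus "(\<lambda>i. \<bar>f x - s i x\<bar>) \<longlonglongrightarrow> 0" by simp
      qed
      show "AE x in lborel. norm \<bar>f x - s i x\<bar> \<le> 3 * \<bar>f x\<bar>" for i
      proof (rule AE_I2)
        fix x :: 'a
        show "norm \<bar>f x - s i x\<bar> \<le> 3 * \<bar>f x\<bar>" using lim(3)[of x i] by simp
      qed
    qed (use lim in auto)
    hence "\<forall>\<^sub>F i in sequentially. (\<integral>x. \<bar>f x - s i x\<bar> \<partial>lborel) < e"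
      using e by (intro order_tendstoD(2)) auto
    then obtain i where "(\<integral>x. \<bar>f x - s i x\<bar> \<partial>lborel) < e"
      using eventually_happens' sequentially_bot by blast
    thus "\<exists>g. integrable lborel g \<and> (\<integral>x. \<bar>f x - g x\<bar> \<partial>lborel) \<le> e
        \<and> (\<lambda>n. \<integral>x. \<bar>g (h n + x) - g x\<bar> \<partial>lborel) \<longlonglongrightarrow> 0"
      using lim by (intro exI[of _ "s i"]) auto
  qed
qed

text \<open>Truncation at height \<open>m\<close> reduces this to L1: differences of the truncated
  function are at most \<open>2 m\<close>, so their squares are at most \<open>2 m\<close> times the
  L1 integrand. The remainder is small in L2 uniformly in the shift.\<close>

lemma translation_continuous_L2:
  fixes f :: "'a::euclidean_space \<Rightarrow> real" and h :: "nat \<Rightarrow> 'a"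
  assumes f: "integrable lborel f" and f2: "integrable lborel (\<lambda>x. (f x)\<^sup>2)" and h: "h \<longlonglongrightarrow> 0"
  shows "(\<lambda>n. \<integral>\<^sup>+x. ennreal ((f (h n + x) - f x)\<^sup>2) \<partial>lborel) \<longlonglongrightarrow> 0"
proof -
  define F where "F m x = max (- real m) (min (real m) (f x))" for m x
  have [measurable]: "f \<in> borel_measurable borel" using f by auto
  have [measurable]: "F m \<in> borel_measurable borel" for m unfolding F_def by measurable
  have F_bound: "\<bar>F m x\<bar> \<le> real m" "\<bar>F m x\<bar> \<le> \<bar>f x\<bar>" for m x by (auto simp: F_def)
  have F_lip: "\<bar>F m x - F m y\<bar> \<le> \<bar>f x - f y\<bar>" for m x y by (auto simp: F_def)
  have F_diff: "\<bar>f x - F m x\<bar> \<le> \<bar>f x\<bar>" for m x by (auto simp: F_def)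
  define D where "D m = (\<integral>x. (f x - F m x)\<^sup>2 \<partial>lborel)" for m
  have D_int: "integrable lborel (\<lambda>x. (f x - F m x)\<^sup>2)" for m
    by (rule Bochner_Integration.integrable_bound[OF f2]) (auto simp: F_diff abs_le_square_iff[symmetric])
  have D: "D \<longlonglongrightarrow> 0"
  proof -
    have "D \<longlonglongrightarrow> (\<integral>(x::'a). 0 \<partial>lborel)" unfolding D_def
    proof (rule integral_dominated_convergence[where w = "\<lambda>x. (f x)\<^sup>2"])
      show "AE x in lborel. (\<lambda>i. (f x - F i x)\<^sup>2) \<longlonglongrightarrow> 0"
      proof (rule AE_I2)
        fix x
        obtain N :: nat where "\<bar>f x\<bar> \<le> real N" using real_arch_simple by blast
        hence "\<forall>\<^sub>F i in sequentially. (f x - F i x)\<^sup>2 = 0"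
          by (intro eventually_sequentiallyI[of N]) (auto simp: F_def)
        thus "(\<lambda>i. (f x - F i x)\<^sup>2) \<longlonglongrightarrow> 0" by (rule tendsto_eventually)
      qed
    qed (use f2 in \<open>auto simp: F_diff abs_le_square_iff[symmetric]\<close>)
    thus ?thesis by simp
  qed
  have le: "(\<integral>\<^sup>+x. ennreal ((f (h n + x) - f x)\<^sup>2) \<partial>lborel)
      \<le> ennreal (6 * real m * (\<integral>x. \<bar>f (h n + x) - f x\<bar> \<partial>lborel) + 6 * D m)" for n m
  proof -
    note fh = integrable_lborel_translate[OF f, of "h n"]
      and Dh = integrable_lborel_translate[OF D_int, of "h n" m]
    have "(f (h n + x) - f x)\<^sup>2 \<le> 6 * real m * \<bar>f (h n + x) - f x\<bar>
        + 3 * (f (h n + x) - F m (h n + x))\<^sup>2 + 3 * (f x - F m x)\<^sup>2" for x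
    proof -
      have three: "(a + b + c)\<^sup>2 \<le> 3 * a\<^sup>2 + 3 * b\<^sup>2 + 3 * c\<^sup>2" for a b c :: real
        using zero_le_power2[of "a - b"] zero_le_power2[of "a - c"] zero_le_power2[of "b - c"]
        by (simp add: power2_eq_square algebra_simps)
      have "(F m (h n + x) - F m x)\<^sup>2 = \<bar>F m (h n + x) - F m x\<bar> * \<bar>F m (h n + x) - F m x\<bar>"
        by (simp add: power2_eq_square)
      also have "\<dots> \<le> (2 * real m) * \<bar>f (h n + x) - f x\<bar>"
        using F_bound(1)[of m "h n + x"] F_bound(1)[of m x] F_lip by (intro mult_mono) auto
      finally have "(F m (h n + x) - F m x)\<^sup>2 \<le> 2 * real m * \<bar>f (h n + x) - f x\<bar>" .
      with three[of "F m (h n + x) - F m x" "f (h n + x) - F m (h n + x)" "F m x - f x"]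
      show ?thesis by (simp add: power2_commute[of "F m x"] algebra_simps)
    qed
    hence "(\<integral>\<^sup>+x. ennreal ((f (h n + x) - f x)\<^sup>2) \<partial>lborel)
        \<le> (\<integral>\<^sup>+x. ennreal (6 * real m * \<bar>f (h n + x) - f x\<bar>
        + 3 * (f (h n + x) - F m (h n + x))\<^sup>2 + 3 * (f x - F m x)\<^sup>2) \<partial>lborel)"
      by (intro nn_integral_mono ennreal_leI)
    also have "\<dots> = ennreal (\<integral>x. 6 * real m * \<bar>f (h n + x) - f x\<bar>
        + 3 * (f (h n + x) - F m (h n + x))\<^sup>2 + 3 * (f x - F m x)\<^sup>2 \<partial>lborel)"
      using f fh D_int Dh by (intro nn_integral_eq_integral) auto
    also have "(\<integral>x. 6 * real m * \<bar>f (h n + x) - f x\<bar>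
        + 3 * (f (h n + x) - F m (h n + x))\<^sup>2 + 3 * (f x - F m x)\<^sup>2 \<partial>lborel)
        = 6 * real m * (\<integral>x. \<bar>f (h n + x) - f x\<bar> \<partial>lborel)
          + 3 * (\<integral>x. (f (h n + x) - F m (h n + x))\<^sup>2 \<partial>lborel) + 3 * D m"
      using f fh D_int[of m] Dh by (simp add: D_def)
    also have "(\<integral>x. (f (h n + x) - F m (h n + x))\<^sup>2 \<partial>lborel) = D m"
      unfolding D_def by (rule integral_lborel_translate[OF D_int])
    finally show ?thesis by (simp add: algebra_simps)
  qed
  show ?thesis
  proof (rule tendsto_0_ennrealI)
    fix r :: real assume r: "r > 0"
    have "\<forall>\<^sub>F m in sequentially. D m < r / 12"
      using r D by (intro order_tendstoD(2)) auto
    then obtain m where m: "D m < r / 12"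
      using eventually_happens' sequentially_bot by blast
    have "(\<lambda>n. 6 * real m * (\<integral>x. \<bar>f (h n + x) - f x\<bar> \<partial>lborel) + 6 * D m) \<longlonglongrightarrow> 6 * real m * 0 + 6 * D m"
      by (intro tendsto_intros translation_continuous_L1 f h)
    hence "\<forall>\<^sub>F n in sequentially. 6 * real m * (\<integral>x. \<bar>f (h n + x) - f x\<bar> \<partial>lborel) + 6 * D m < r"
      using m r by (auto dest: order_tendstoD(2)[of _ _ _ r])
    thus "\<forall>\<^sub>F n in sequentially. (\<integral>\<^sup>+x. ennreal ((f (h n + x) - f x)\<^sup>2) \<partial>lborel) \<le> ennreal r"
    proof eventually_elim
      case (elim n)
      show ?case
        using elim by (intro order.trans[OF le[of n m]] ennreal_leI) auto
    qed
  qed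
qed

definition gauss :: "'a::euclidean_space \<Rightarrow> real" where
  "gauss x = exp (- (norm x)\<^sup>2 / 2)"

section \<open>The Plancherel inequality\<close>

lemma borel_measurable_fst_snd [measurable]:
  "fst \<in> (borel :: ('a::second_countable_topology \<times> 'b::second_countable_topology) measure) \<rightarrow>\<^sub>M borel"
  "snd \<in> (borel :: ('a::second_countable_topology \<times> 'b::second_countable_topology) measure) \<rightarrow>\<^sub>M borel"
  unfolding borel_prod[symmetric] by measurable

lemma gauss_measurable [measurable]: "gauss \<in> borel_measurable borel"
  unfolding gauss_def by measurable

lemma gauss_pos: "gauss x > 0" by (simp add: gauss_def)
lemma gauss_le_1: "gauss x \<le> 1" by (simp add: gauss_def)

lemma norm_power2_eq_sum_Basis: "(norm (x::'a::euclidean_space))\<^sup>2 = (\<Sum>b\<in>Basis. (x \<bullet> b)\<^sup>2)"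
  unfolding power2_norm_eq_inner by (subst euclidean_inner) (simp add: power2_eq_square)

lemma fourier_gauss_real:
  shows "integrable lborel (\<lambda>x::real. cis (t * x) * of_real (exp (- x\<^sup>2 / 2)))"
    and "(\<integral>x. cis (t * x) * of_real (exp (- x\<^sup>2 / 2)) \<partial>lborel)
      = complex_of_real (sqrt (2 * pi) * exp (- t\<^sup>2 / 2))"
proof -
  have eq: "cis (t * x) * of_real (exp (- x\<^sup>2 / 2))
      = of_real (sqrt (2 * pi)) * (std_normal_density x *\<^sub>R iexp (t * x))" for x
    by (simp add: std_normal_density_def scaleR_conv_of_real cis_conv_exp)
  have int: "integrable lborel (\<lambda>x. std_normal_density x *\<^sub>R iexp (t * x))"
    by (rule Bochner_Integration.integrable_bound[OF integrable_std_normal_moment[of 0]])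
       (auto simp: )
  show "integrable lborel (\<lambda>x::real. cis (t * x) * of_real (exp (- x\<^sup>2 / 2)))"
    unfolding eq by (intro integrable_mult_right int)
  have "(\<integral>x. std_normal_density x *\<^sub>R iexp (t * x) \<partial>lborel) = char std_normal_distribution t"
    unfolding char_def by (subst integral_density) auto
  thus "(\<integral>x. cis (t * x) * of_real (exp (- x\<^sup>2 / 2)) \<partial>lborel)
      = complex_of_real (sqrt (2 * pi) * exp (- t\<^sup>2 / 2))"
    unfolding eq integral_mult_right_zero by (simp add: char_std_normal_distribution)
qed

lemma cis_sum: "finite A \<Longrightarrow> cis (\<Sum>b\<in>A. f b) = (\<Prod>b\<in>A. cis (f b))"
  by (induction A rule: finite_induct) (simp_all add: cis_mult[symmetric])

text \<open>Its square is the constant \<open>(2 pi) ^ d\<close> of Plancherel's formula.\<close>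

definition gauss_mass :: "'a::euclidean_space itself \<Rightarrow> real" where
  "gauss_mass _ = sqrt (2 * pi) ^ DIM('a)"

lemma gauss_mass_pos: "gauss_mass TYPE('a::euclidean_space) > 0"
  by (simp add: gauss_mass_def)

lemma fourier_gauss:
  fixes \<xi> :: "'a::euclidean_space"
  shows "integrable lborel (\<lambda>x. cis (\<xi> \<bullet> x) * of_real (gauss x))" (is ?I)
    and "(\<integral>x. cis (\<xi> \<bullet> x) * of_real (gauss x) \<partial>lborel)
      = complex_of_real (gauss_mass TYPE('a) * gauss \<xi>)" (is ?E)
proof -
  let ?S = "\<lambda>f. \<Sum>b\<in>Basis. f b *\<^sub>R b :: 'a"
  let ?M = "\<Pi>\<^sub>M b\<in>Basis. (lborel :: real measure)"
  interpret product_sigma_finite "\<lambda>_::'a. lborel :: real measure" by standard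
  have coord: "(\<Sum>b\<in>Basis. f b *\<^sub>R b) \<bullet> c = f c" if "c \<in> Basis" for f and c :: 'a
    using that by (simp add: inner_sum_left inner_Basis if_distrib sum.delta cong: if_cong)
  have eq: "cis (\<xi> \<bullet> x) * of_real (gauss x)
      = (\<Prod>b\<in>Basis. cis ((\<xi> \<bullet> b) * (x \<bullet> b)) * of_real (exp (- (x \<bullet> b)\<^sup>2 / 2)))" for x :: 'a
  proof -
    have "gauss x = (\<Prod>b\<in>Basis. exp (- (x \<bullet> b)\<^sup>2 / 2))"
      by (simp add: gauss_def norm_power2_eq_sum_Basis exp_sum[symmetric] sum_negf sum_divide_distrib)
    thus ?thesis
      by (simp add: euclidean_inner[of \<xi> x] cis_sum prod.distrib)
  qed
  have eqM: "cis (\<xi> \<bullet> ?S f) * of_real (gauss (?S f))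
      = (\<Prod>b\<in>Basis. cis ((\<xi> \<bullet> b) * f b) * of_real (exp (- (f b)\<^sup>2 / 2)))" for f
    unfolding eq by (intro prod.cong refl) (simp only: coord)
  have [measurable]: "?S \<in> ?M \<rightarrow>\<^sub>M borel" by measurable
  have [measurable]: "(\<lambda>x::'a. cis (\<xi> \<bullet> x) * of_real (gauss x)) \<in> borel_measurable borel"
    unfolding cis_conv_exp by measurable
  have intM: "integrable ?M (\<lambda>f. cis (\<xi> \<bullet> ?S f) * of_real (gauss (?S f)))"
    unfolding eqM by (intro product_integrable_prod fourier_gauss_real) auto
  show ?I
    by (subst lborel_eq, subst integrable_distr_eq) (auto intro: intM)
  have "(\<integral>x. cis (\<xi> \<bullet> x) * of_real (gauss x) \<partial>lborel)
      = (\<integral>f. cis (\<xi> \<bullet> ?S f) * of_real (gauss (?S f)) \<partial>?M)"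
    by (subst lborel_eq, subst integral_distr) auto
  also have "\<dots> = (\<Prod>b\<in>Basis. \<integral>x. cis ((\<xi> \<bullet> b) * x) * of_real (exp (- x\<^sup>2 / 2)) \<partial>lborel)"
    unfolding eqM by (intro product_integral_prod fourier_gauss_real) auto
  also have "\<dots> = (\<Prod>b\<in>(Basis::'a set). complex_of_real (sqrt (2 * pi) * exp (- (\<xi> \<bullet> b)\<^sup>2 / 2)))"
    by (simp only: fourier_gauss_real)
  also have "\<dots> = complex_of_real (gauss_mass TYPE('a) * gauss \<xi>)"
    by (simp add: gauss_mass_def gauss_def norm_power2_eq_sum_Basis prod.distrib
        sum_divide_distrib sum_negf[symmetric] exp_sum flip: of_real_prod)
  finally show ?E .
qed

lemma gauss_integral:
  shows "integrable lborel (gauss :: 'a::euclidean_space \<Rightarrow> real)"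
    and "(\<integral>x. gauss (x::'a) \<partial>lborel) = gauss_mass TYPE('a)"
proof -
  have I: "integrable lborel (\<lambda>x::'a. complex_of_real (gauss x))"
    using fourier_gauss(1)[of 0] by simp
  thus "integrable lborel (gauss :: 'a \<Rightarrow> real)"
    using integrable_Re by force
  have "complex_of_real (\<integral>x. gauss (x::'a) \<partial>lborel) = (\<integral>x. complex_of_real (gauss (x::'a)) \<partial>lborel)"
    by simp
  also have "\<dots> = complex_of_real (gauss_mass TYPE('a))"
    using fourier_gauss(2)[of "0::'a"] by (simp add: gauss_def)
  finally show "(\<integral>x. gauss (x::'a) \<partial>lborel) = gauss_mass TYPE('a)"
    using of_real_eq_iff by blast
qed

text \<open>The centred normal density with standard deviation s in each coordinate; since s is not
  a variance, convolving two copies gives the scale \<open>sqrt 2 * s\<close>.\<close>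

definition gauss_kernel :: "real \<Rightarrow> 'a::euclidean_space \<Rightarrow> real" where
  "gauss_kernel s x = gauss (x /\<^sub>R s) / (s ^ DIM('a) * gauss_mass TYPE('a))"

lemma gauss_kernel_measurable [measurable]: "gauss_kernel s \<in> borel_measurable borel"
  unfolding gauss_kernel_def by measurable

lemma gauss_kernel_nonneg: "s > 0 \<Longrightarrow> gauss_kernel s (x::'a::euclidean_space) \<ge> 0"
  using gauss_pos[of "x /\<^sub>R s"] gauss_mass_pos[where 'a='a] by (simp add: gauss_kernel_def less_imp_le)

lemma gauss_kernel_bounded:
  "s > 0 \<Longrightarrow> gauss_kernel s (x::'a::euclidean_space) \<le> 1 / (s ^ DIM('a) * gauss_mass TYPE('a))"
  using gauss_mass_pos[where 'a='a] gauss_le_1[of "x /\<^sub>R s"]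
  unfolding gauss_kernel_def by (intro divide_right_mono) auto

text \<open>Relates a Gaussian damping of the frequencies to smoothing in space by the kernel of the
  same parameter.\<close>

lemma fourier_gauss_scaled:
  fixes \<xi> :: "'a::euclidean_space"
  assumes s: "s > 0"
  shows "integrable lborel (\<lambda>x. cis (\<xi> \<bullet> x) * of_real (gauss (s *\<^sub>R x)))"
    and "(\<integral>x. cis (\<xi> \<bullet> x) * of_real (gauss (s *\<^sub>R x)) \<partial>lborel)
      = complex_of_real ((gauss_mass TYPE('a))\<^sup>2 * gauss_kernel s \<xi>)"
proof -
  have eq: "cis (\<xi> \<bullet> x) * of_real (gauss (s *\<^sub>R x))
      = (\<lambda>y. cis ((\<xi> /\<^sub>R s) \<bullet> y) * of_real (gauss y)) (0 + s *\<^sub>R x)" for x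
    using s by (simp add: mult.assoc[symmetric])
  show "integrable lborel (\<lambda>x. cis (\<xi> \<bullet> x) * of_real (gauss (s *\<^sub>R x)))"
    unfolding eq using s by (intro integrable_lborel_affine fourier_gauss) auto
  show "(\<integral>x. cis (\<xi> \<bullet> x) * of_real (gauss (s *\<^sub>R x)) \<partial>lborel)
      = complex_of_real ((gauss_mass TYPE('a))\<^sup>2 * gauss_kernel s \<xi>)"
    unfolding eq using s gauss_mass_pos[where 'a='a]
      integral_lborel_affine[OF fourier_gauss(1)[of "\<xi> /\<^sub>R s"], of s 0]
    unfolding fourier_gauss(2)
    by (simp add: gauss_kernel_def power2_eq_square scaleR_conv_of_real divide_simps)
qed

lemma gauss_kernel_integral:
  assumes s: "s > 0"
  shows "integrable lborel (gauss_kernel s :: 'a::euclidean_space \<Rightarrow> real)"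
    and "(\<integral>x. gauss_kernel s (x::'a) \<partial>lborel) = 1"
proof -
  have eq: "gauss_kernel s x = gauss (0 + (1 / s) *\<^sub>R x) / (s ^ DIM('a) * gauss_mass TYPE('a))" for x :: 'a
    by (simp add: gauss_kernel_def divide_inverse)
  have c: "1 / s \<noteq> 0" using s by simp
  note I = integrable_lborel_affine[OF gauss_integral(1) c] integral_lborel_affine[OF gauss_integral(1) c]
  show "integrable lborel (gauss_kernel s :: 'a \<Rightarrow> real)"
    unfolding eq by (intro Bochner_Integration.integrable_divide I)
  show "(\<integral>x. gauss_kernel s (x::'a) \<partial>lborel) = 1"
    unfolding eq using s gauss_mass_pos[where 'a='a]
    unfolding integral_divide_zero I gauss_integral by (simp add: power_divide)
qed

text \<open>The semigroup property, from the parallelogram identity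
  \<open>|z - x|\<^sup>2 + |z - y|\<^sup>2 = 2 |z - (x + y) / 2|\<^sup>2 + |x - y|\<^sup>2 / 2\<close>.\<close>
lemma gauss_kernel_convolution:
  fixes x y :: "'a::euclidean_space"
  assumes s: "s > 0"
  shows "integrable lborel (\<lambda>z. gauss_kernel s (z - x) * gauss_kernel s (z - y))"
    and "(\<integral>z. gauss_kernel s (z - x) * gauss_kernel s (z - y) \<partial>lborel)
      = gauss_kernel (sqrt 2 * s) (x - y)"
proof -
  let ?c = "gauss_mass TYPE('a)" and ?d = "DIM('a)"
  define m where "m = (x + y) /\<^sub>R 2"
  have par: "(norm (z - x))\<^sup>2 + (norm (z - y))\<^sup>2 = 2 * (norm (z - m))\<^sup>2 + (norm (x - y))\<^sup>2 / 2" for z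
    unfolding m_def power2_norm_eq_inner
    by (simp add: inner_diff_left inner_diff_right inner_add_left inner_add_right inner_commute field_simps)
  define C where "C = gauss ((x - y) /\<^sub>R (sqrt 2 * s)) / (s ^ ?d * ?c)\<^sup>2"
  have "gauss ((z - x) /\<^sub>R s) * gauss ((z - y) /\<^sub>R s)
      = gauss (- (sqrt 2 / s) *\<^sub>R m + (sqrt 2 / s) *\<^sub>R z) * gauss ((x - y) /\<^sub>R (sqrt 2 * s))" for z
  proof -
    have "- (sqrt 2 / s) *\<^sub>R m + (sqrt 2 / s) *\<^sub>R z = (sqrt 2 / s) *\<^sub>R (z - m)"
      by (simp add: scaleR_diff_right)
    hence n: "(norm (- (sqrt 2 / s) *\<^sub>R m + (sqrt 2 / s) *\<^sub>R z))\<^sup>2 = 2 * (norm (z - m))\<^sup>2 / s\<^sup>2"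
      by (simp add: power_mult_distrib power_divide)
    have "- (norm ((z - x) /\<^sub>R s))\<^sup>2 / 2 + - (norm ((z - y) /\<^sub>R s))\<^sup>2 / 2
        = - ((norm (z - x))\<^sup>2 + (norm (z - y))\<^sup>2) / (2 * s\<^sup>2)"
      using s by (simp add: power_mult_distrib power_inverse divide_simps)
    also have "\<dots> = - (2 * (norm (z - m))\<^sup>2 / s\<^sup>2) / 2 + - (norm ((x - y) /\<^sub>R (sqrt 2 * s)))\<^sup>2 / 2"
      using s unfolding norm_scaleR power_mult_distrib par by (simp add: power_inverse power_mult_distrib field_simps)
    finally show ?thesis unfolding gauss_def n exp_add[symmetric] by simp
  qed
  hence eq: "gauss_kernel s (z - x) * gauss_kernel s (z - y)
      = gauss (- (sqrt 2 / s) *\<^sub>R m + (sqrt 2 / s) *\<^sub>R z) * C" for z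
    unfolding gauss_kernel_def C_def by (simp add: power2_eq_square)
  have c: "sqrt 2 / s \<noteq> 0" using s by simp
  note I = integrable_lborel_affine[OF gauss_integral(1) c, of "- (sqrt 2 / s) *\<^sub>R m"]
    integral_lborel_affine[OF gauss_integral(1) c, of "- (sqrt 2 / s) *\<^sub>R m"]
  show "integrable lborel (\<lambda>z. gauss_kernel s (z - x) * gauss_kernel s (z - y))"
    unfolding eq by (intro integrable_mult_left I)
  have "(\<integral>z. gauss_kernel s (z - x) * gauss_kernel s (z - y) \<partial>lborel)
      = (\<integral>z. gauss (- (sqrt 2 / s) *\<^sub>R m + (sqrt 2 / s) *\<^sub>R z) \<partial>lborel) * C"
    unfolding eq by simp
  also have "\<dots> = gauss_kernel (sqrt 2 * s) (x - y)"
    unfolding I gauss_integral C_def gauss_kernel_def using s gauss_mass_pos[where 'a='a]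
    by (simp add: power_divide power_mult_distrib power2_eq_square field_simps)
  finally show "(\<integral>z. gauss_kernel s (z - x) * gauss_kernel s (z - y) \<partial>lborel)
      = gauss_kernel (sqrt 2 * s) (x - y)" .
qed

lemma integrable_lborel_pair_mult:
  fixes f :: "'a::euclidean_space \<Rightarrow> real" and g :: "'b::euclidean_space \<Rightarrow> real"
  assumes f: "integrable lborel f" and g: "integrable lborel g"
  shows "integrable lborel (\<lambda>(x, y). f x * g y)"
proof -
  have [measurable]: "f \<in> borel_measurable borel" "g \<in> borel_measurable borel" using f g by auto
  show ?thesis unfolding lborel_prod[symmetric]
    by (rule lborel_pair.Fubini_integrable) (use f g in \<open>auto simp: abs_mult\<close>)
qed

text \<open>The integral bounds the L1 distance between \<open>g\<close> and its mollification at
  scale \<open>1 / Suc n\<close>. It vanishes in the limit by continuity of translations, dominated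
  by twice the norm of \<open>g\<close>.\<close>

lemma integral_gauss_kernel_translation_tendsto:
  fixes g :: "'a::euclidean_space \<Rightarrow> real"
  assumes g: "integrable lborel g"
  shows "(\<lambda>n. \<integral>w. gauss_kernel 1 w * (\<integral>z. \<bar>g (- (w /\<^sub>R real (Suc n)) + z) - g z\<bar> \<partial>lborel) \<partial>lborel)
    \<longlonglongrightarrow> 0"
proof -
  have [measurable]: "g \<in> borel_measurable borel" using g by auto
  let ?D = "\<lambda>h. \<integral>z. \<bar>g (h + z) - g z\<bar> \<partial>lborel"
  have D_le: "?D h \<le> 2 * (\<integral>z. \<bar>g z\<bar> \<partial>lborel)" for h
    using integral_translation_diff_le[OF g integrable_zero, of h] by simp
  have "(\<lambda>n. \<integral>w. gauss_kernel 1 w * ?D (- (w /\<^sub>R real (Suc n))) \<partial>lborel) \<longlonglongrightarrow> (\<integral>(w::'a). 0 \<partial>lborel)"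
  proof (rule integral_dominated_convergence
      [where w = "\<lambda>w. gauss_kernel 1 w * (2 * (\<integral>z. \<bar>g z\<bar> \<partial>lborel))"])
    show "AE w in lborel. (\<lambda>n. gauss_kernel 1 w * ?D (- (w /\<^sub>R real (Suc n)))) \<longlonglongrightarrow> 0"
    proof (rule AE_I2)
      fix w :: 'a
      have "(\<lambda>n. inverse (real (Suc n)) *\<^sub>R w) \<longlonglongrightarrow> 0 *\<^sub>R w"
        by (intro tendsto_intros LIMSEQ_inverse_real_of_nat)
      hence "(\<lambda>n. - (w /\<^sub>R real (Suc n))) \<longlonglongrightarrow> 0"
        using tendsto_minus by fastforce
      hence "(\<lambda>n. gauss_kernel 1 w * ?D (- (w /\<^sub>R real (Suc n)))) \<longlonglongrightarrow> gauss_kernel 1 w * 0"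
        by (intro tendsto_mult tendsto_const translation_continuous_L1 g)
      thus "(\<lambda>n. gauss_kernel 1 w * ?D (- (w /\<^sub>R real (Suc n)))) \<longlonglongrightarrow> 0" by simp
    qed
    show "AE w in lborel. norm (gauss_kernel 1 w * ?D (- (w /\<^sub>R real (Suc n))))
        \<le> gauss_kernel 1 w * (2 * (\<integral>z. \<bar>g z\<bar> \<partial>lborel))" for n
      using D_le[of "- (_ /\<^sub>R real (Suc n))"] gauss_kernel_nonneg[of 1]
      by (intro AE_I2) (auto simp: abs_mult integral_nonneg_AE abs_of_nonneg simp del: of_nat_Suc
          intro!: mult_mono)
  qed (auto intro: gauss_kernel_integral)
  thus ?thesis by simp
qed

section \<open>Mollification and the damped Fourier integral\<close>

context
  fixes g :: "'a::euclidean_space \<Rightarrow> real"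
  assumes g: "integrable lborel g"
begin

lemma g_measurable [measurable]: "g \<in> borel_measurable borel" using g by auto

definition mollify :: "real \<Rightarrow> 'a \<Rightarrow> real" where
  "mollify s z = (\<integral>x. gauss_kernel s (z - x) * g x \<partial>lborel)"

lemma mollify_measurable [measurable]: "mollify s \<in> borel_measurable borel"
  unfolding mollify_def by measurable

lemma mollify_integrand:
  assumes "s > 0" shows "integrable lborel (\<lambda>x. gauss_kernel s (z - x) * g x)"
proof (rule Bochner_Integration.integrable_bound)
  show "integrable lborel (\<lambda>x. 1 / (s ^ DIM('a) * gauss_mass TYPE('a)) * g x)"
    using g by simp
  show "AE x in lborel. norm (gauss_kernel s (z - x) * g x)
      \<le> norm (1 / (s ^ DIM('a) * gauss_mass TYPE('a)) * g x)"
    using gauss_kernel_nonneg[OF assms, where 'a='a] gauss_kernel_bounded[OF assms, where 'a='a]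
      gauss_mass_pos[where 'a='a] assms
    by (intro AE_I2) (auto simp: abs_mult intro!: mult_right_mono simp del: times_divide_eq_left)
qed measurable

lemma pair_integrable: "integrable lborel (\<lambda>(x, y). g x * g y)"
  by (intro integrable_lborel_pair_mult g)

text \<open>Expanding the square gives a double integral of \<open>g x * g y\<close>; integrating
  out z by the convolution property leaves one kernel in \<open>x - y\<close>. Fubini is justified
  because that kernel is bounded and \<open>g\<close> is integrable.\<close>

lemma mollify_power2_eq:
  assumes s: "s > 0"
  shows "integrable lborel (\<lambda>z. (mollify s z)\<^sup>2)"
    and "(\<integral>z. (mollify s z)\<^sup>2 \<partial>lborel)
      = (\<integral>p. g (fst p) * g (snd p) * gauss_kernel (sqrt 2 * s) (fst p - snd p) \<partial>lborel)"
proof -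
  let ?k = "gauss_kernel s :: 'a \<Rightarrow> real"
  define F where "F p z = g (fst p) * g (snd p) * (?k (z - fst p) * ?k (z - snd p))" for p z
  have sq: "(mollify s z)\<^sup>2 = (\<integral>p. F p z \<partial>lborel)" for z
  proof -
    have "(mollify s z)\<^sup>2 = (\<integral>x. (\<integral>y. (?k (z - x) * g x) * (?k (z - y) * g y) \<partial>lborel) \<partial>lborel)"
      unfolding power2_eq_square using mollify_integrand[OF s, of z]
      by (simp add: mollify_def)
    also have "\<dots> = (\<integral>p. (?k (z - fst p) * g (fst p)) * (?k (z - snd p) * g (snd p)) \<partial>lborel)"
      unfolding lborel_prod[symmetric]
      using integrable_lborel_pair_mult[OF mollify_integrand[OF s, of z] mollify_integrand[OF s, of z]]
      by (subst lborel_pair.integral_fst'[symmetric])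
        (auto simp: lborel_prod case_prod_unfold)
    finally show ?thesis unfolding F_def by (simp add: mult_ac)
  qed
  have sqrt2s: "sqrt 2 * s > 0" using s by simp
  have int: "integrable (lborel \<Otimes>\<^sub>M lborel) (\<lambda>(p, z). F p z)"
  proof (rule lborel_pair.Fubini_integrable)
    show "(\<lambda>(p, z). F p z) \<in> borel_measurable (lborel \<Otimes>\<^sub>M lborel)"
      unfolding F_def by measurable
    have "(\<integral>z. norm (F p z) \<partial>lborel)
        = \<bar>g (fst p) * g (snd p)\<bar> * gauss_kernel (sqrt 2 * s) (fst p - snd p)" for p
      unfolding F_def using gauss_kernel_nonneg[OF s, where 'a='a]
      by (simp add: abs_mult[of "_ * _" "_ * _"] abs_of_nonneg gauss_kernel_convolution[OF s])
    moreover have "integrable lborel (\<lambda>p. \<bar>g (fst p) * g (snd p)\<bar> * gauss_kernel (sqrt 2 * s) (fst p - snd p))"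
    proof (rule Bochner_Integration.integrable_bound)
      show "integrable lborel (\<lambda>p. 1 / ((sqrt 2 * s) ^ DIM('a) * gauss_mass TYPE('a))
          * (g (fst p) * g (snd p)))"
        using pair_integrable by (intro integrable_mult_right) (simp add: case_prod_unfold)
      show "AE p in lborel. norm (\<bar>g (fst p) * g (snd p)\<bar> * gauss_kernel (sqrt 2 * s) (fst p - snd p))
          \<le> norm (1 / ((sqrt 2 * s) ^ DIM('a) * gauss_mass TYPE('a)) * (g (fst p) * g (snd p)))"
        using gauss_kernel_nonneg[OF sqrt2s, where 'a='a] gauss_kernel_bounded[OF sqrt2s, where 'a='a]
          gauss_mass_pos[where 'a='a] s
        by (intro AE_I2) (auto simp: abs_mult mult.commute[of _ "gauss_kernel _ _"]
            intro!: mult_right_mono simp del: times_divide_eq_left)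
      show "(\<lambda>p. \<bar>g (fst p) * g (snd p)\<bar> * gauss_kernel (sqrt 2 * s) (fst p - snd p))
          \<in> borel_measurable lborel"
        unfolding lborel_prod[symmetric] by measurable
    qed
    ultimately show "integrable lborel (\<lambda>p. \<integral>z. norm (case (p, z) of (p, z) \<Rightarrow> F p z) \<partial>lborel)"
      by simp
    show "AE p in lborel. integrable lborel (\<lambda>z. case (p, z) of (p, z) \<Rightarrow> F p z)"
      unfolding F_def by (auto intro!: integrable_mult_right gauss_kernel_convolution s)
  qed
  show "integrable lborel (\<lambda>z. (mollify s z)\<^sup>2)"
    unfolding sq using lborel_pair.integrable_snd[OF int] .
  have "(\<integral>z. (mollify s z)\<^sup>2 \<partial>lborel) = (\<integral>p. (\<integral>z. F p z \<partial>lborel) \<partial>lborel)"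
    unfolding sq by (rule lborel_pair.Fubini_integral[OF int])
  also have "\<dots> = (\<integral>p. g (fst p) * g (snd p) * gauss_kernel (sqrt 2 * s) (fst p - snd p) \<partial>lborel)"
    unfolding F_def by (simp add: gauss_kernel_convolution[OF s])
  finally show "(\<integral>z. (mollify s z)\<^sup>2 \<partial>lborel)
      = (\<integral>p. g (fst p) * g (snd p) * gauss_kernel (sqrt 2 * s) (fst p - snd p) \<partial>lborel)" .
qed

definition fourier :: "'a \<Rightarrow> complex" where
  "fourier \<xi> = (\<integral>x. cis (\<xi> \<bullet> x) * of_real (g x) \<partial>lborel)"

lemma cis_measurable' [measurable]: "cis \<in> borel_measurable borel"
  unfolding cis_conv_exp[abs_def] by measurable

lemma fourier_measurable [measurable]: "fourier \<in> borel_measurable borel"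
  unfolding fourier_def by measurable

lemma fourier_integrand: "integrable lborel (\<lambda>x. cis (\<xi> \<bullet> x) * of_real (g x))"
  by (rule Bochner_Integration.integrable_bound[OF g]) (auto simp: norm_mult)

lemma cnj_fourier: "cnj (fourier \<xi>) = (\<integral>x. cis (- (\<xi> \<bullet> x)) * of_real (g x) \<partial>lborel)"
  unfolding fourier_def using Bochner_Integration.integral_cnj[of lborel "\<lambda>x. cis (\<xi> \<bullet> x) * of_real (g x)"]
  by (simp add: cis_cnj)

text \<open>The damping makes the frequency integral absolutely convergent before square
  integrability is known. Fubini then leads to the same double integral that appears for the
  mollified function in \<open>mollify_power2_eq\<close>, at a matching scale.\<close>

lemma fourier_gauss_weight:
  assumes s: "s > 0"
  shows "integrable lborel (\<lambda>\<xi>. (norm (fourier \<xi>))\<^sup>2 * gauss (s *\<^sub>R \<xi>))"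
    and "(\<integral>\<xi>. (norm (fourier \<xi>))\<^sup>2 * gauss (s *\<^sub>R \<xi>) \<partial>lborel)
      = (gauss_mass TYPE('a))\<^sup>2 *
        (\<integral>p. g (fst p) * g (snd p) * gauss_kernel s (fst p - snd p) \<partial>lborel)"
proof -
  define F where "F p \<xi> = of_real (g (fst p) * g (snd p)) *
      (cis ((fst p - snd p) \<bullet> \<xi>) * complex_of_real (gauss (s *\<^sub>R \<xi>)))" for p \<xi>
  have sq: "complex_of_real ((norm (fourier \<xi>))\<^sup>2 * gauss (s *\<^sub>R \<xi>)) = (\<integral>p. F p \<xi> \<partial>lborel)" for \<xi>
  proof -
    define u where "u x = cis (\<xi> \<bullet> x) * of_real (g x)" for x
    define v where "v x = cis (- (\<xi> \<bullet> x)) * of_real (g x)" for x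
    have u: "integrable lborel u" unfolding u_def by (rule fourier_integrand)
    have v: "integrable lborel v" unfolding v_def using fourier_integrand[of "- \<xi>"] by simp
    have uv: "integrable (lborel \<Otimes>\<^sub>M lborel) (\<lambda>p. u (fst p) * v (snd p))"
    proof (rule Bochner_Integration.integrable_bound)
      show "integrable (lborel \<Otimes>\<^sub>M lborel) (\<lambda>(x, y). g x * g y)"
        unfolding lborel_prod by (rule pair_integrable)
      show "(\<lambda>p. u (fst p) * v (snd p)) \<in> borel_measurable (lborel \<Otimes>\<^sub>M lborel)"
        unfolding u_def v_def by measurable
    qed (auto simp: u_def v_def norm_mult abs_mult)
    have "complex_of_real ((norm (fourier \<xi>))\<^sup>2) = fourier \<xi> * cnj (fourier \<xi>)"
      by (simp add: complex_norm_square del: of_real_power)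
    also have "\<dots> = (\<integral>x. (\<integral>y. u x * v y \<partial>lborel) \<partial>lborel)"
      unfolding cnj_fourier u_def[symmetric] v_def[symmetric] using u v
      by (simp add: fourier_def u_def[symmetric])
    also have "\<dots> = (\<integral>p. u (fst p) * v (snd p) \<partial>lborel)"
      unfolding lborel_prod[symmetric] using uv
      by (subst lborel_pair.integral_fst'[symmetric]) auto
    finally have "complex_of_real ((norm (fourier \<xi>))\<^sup>2 * gauss (s *\<^sub>R \<xi>))
        = (\<integral>p. u (fst p) * v (snd p) * complex_of_real (gauss (s *\<^sub>R \<xi>)) \<partial>lborel)"
      by simp
    also have "\<dots> = (\<integral>p. F p \<xi> \<partial>lborel)"
    proof (intro Bochner_Integration.integral_cong refl)
      fix p :: "'a \<times> 'a"
      have "cis ((fst p - snd p) \<bullet> \<xi>) = cis (\<xi> \<bullet> fst p) * cis (- (\<xi> \<bullet> snd p))"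
        by (simp add: cis_mult inner_diff_left inner_diff_right inner_commute)
      thus "u (fst p) * v (snd p) * complex_of_real (gauss (s *\<^sub>R \<xi>)) = F p \<xi>"
        by (simp add: F_def u_def v_def mult_ac)
    qed
    finally show ?thesis .
  qed
  have int: "integrable (lborel \<Otimes>\<^sub>M lborel) (\<lambda>(p, \<xi>). F p \<xi>)"
  proof (rule Bochner_Integration.integrable_bound)
    have "integrable lborel (\<lambda>\<xi>::'a. gauss (0 + s *\<^sub>R \<xi>))"
      using s by (intro integrable_lborel_affine gauss_integral) auto
    hence "integrable lborel (\<lambda>\<xi>::'a. gauss (s *\<^sub>R \<xi>))" by simp
    from integrable_lborel_pair_mult[OF pair_integrable this]
    show "integrable (lborel \<Otimes>\<^sub>M lborel) (\<lambda>(p, \<xi>::'a). (case p of (x, y) \<Rightarrow> g x * g y) * gauss (s *\<^sub>R \<xi>))"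
      unfolding lborel_prod .
    show "(\<lambda>(p, \<xi>). F p \<xi>) \<in> borel_measurable (lborel \<Otimes>\<^sub>M lborel)"
      unfolding F_def by measurable
  qed (auto simp: F_def norm_mult abs_mult)
  have "integrable lborel (\<lambda>\<xi>. complex_of_real ((norm (fourier \<xi>))\<^sup>2 * gauss (s *\<^sub>R \<xi>)))"
    unfolding sq using lborel_pair.integrable_snd[OF int] .
  from integrable_Re[OF this]
  show "integrable lborel (\<lambda>\<xi>. (norm (fourier \<xi>))\<^sup>2 * gauss (s *\<^sub>R \<xi>))" by simp
  have "complex_of_real (\<integral>\<xi>. (norm (fourier \<xi>))\<^sup>2 * gauss (s *\<^sub>R \<xi>) \<partial>lborel)
      = (\<integral>\<xi>. complex_of_real ((norm (fourier \<xi>))\<^sup>2 * gauss (s *\<^sub>R \<xi>)) \<partial>lborel)"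
    by (simp only: integral_complex_of_real)
  also have "\<dots> = (\<integral>p. (\<integral>\<xi>. F p \<xi> \<partial>lborel) \<partial>lborel)"
    unfolding sq by (rule lborel_pair.Fubini_integral[OF int])
  also have "\<dots> = (\<integral>p. complex_of_real ((gauss_mass TYPE('a))\<^sup>2 *
      (g (fst p) * g (snd p) * gauss_kernel s (fst p - snd p))) \<partial>lborel)"
    unfolding F_def integral_mult_right_zero fourier_gauss_scaled(2)[OF s] by (simp add: mult_ac)
  also have "\<dots> = complex_of_real ((gauss_mass TYPE('a))\<^sup>2 *
        (\<integral>p. g (fst p) * g (snd p) * gauss_kernel s (fst p - snd p) \<partial>lborel))"
    by (simp only: integral_complex_of_real integral_mult_right_zero)
  finally show "(\<integral>\<xi>. (norm (fourier \<xi>))\<^sup>2 * gauss (s *\<^sub>R \<xi>) \<partial>lborel)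
      = (gauss_mass TYPE('a))\<^sup>2 *
        (\<integral>p. g (fst p) * g (snd p) * gauss_kernel s (fst p - snd p) \<partial>lborel)"
    using of_real_eq_iff by blast
qed

text \<open>Both sides are expressed by the same double integral at scale \<open>sqrt 2 * s\<close>;
  the damping factor is then replaced by its upper bound 1, which makes the estimate independent of
  s.\<close>

lemma mollify_L2_bound:
  assumes s: "s > 0"
  shows "(\<integral>\<^sup>+z. ennreal ((mollify s z)\<^sup>2) \<partial>lborel)
    \<le> ennreal (1 / (gauss_mass TYPE('a))\<^sup>2) * (\<integral>\<^sup>+\<xi>. ennreal ((norm (fourier \<xi>))\<^sup>2) \<partial>lborel)"
proof -
  let ?c = "gauss_mass TYPE('a)"
  have s2: "sqrt 2 * s > 0" using s by simp
  have c: "?c > 0" by (rule gauss_mass_pos)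
  have "(\<integral>\<^sup>+z. ennreal ((mollify s z)\<^sup>2) \<partial>lborel) = ennreal (\<integral>z. (mollify s z)\<^sup>2 \<partial>lborel)"
    by (intro nn_integral_eq_integral mollify_power2_eq s) auto
  also have "(\<integral>z. (mollify s z)\<^sup>2 \<partial>lborel)
      = 1 / ?c\<^sup>2 * (\<integral>\<xi>. (norm (fourier \<xi>))\<^sup>2 * gauss ((sqrt 2 * s) *\<^sub>R \<xi>) \<partial>lborel)"
    unfolding mollify_power2_eq(2)[OF s] fourier_gauss_weight(2)[OF s2] using c by simp
  also have "ennreal \<dots> = ennreal (1 / ?c\<^sup>2) *
      (\<integral>\<^sup>+\<xi>. ennreal ((norm (fourier \<xi>))\<^sup>2 * gauss ((sqrt 2 * s) *\<^sub>R \<xi>)) \<partial>lborel)"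
    using gauss_pos[THEN less_imp_le] by (subst nn_integral_eq_integral)
      (auto intro!: fourier_gauss_weight s2 AE_I2 mult_nonneg_nonneg
        simp: less_imp_le ennreal_mult'[symmetric])
  also have "\<dots> \<le> ennreal (1 / ?c\<^sup>2) * (\<integral>\<^sup>+\<xi>. ennreal ((norm (fourier \<xi>))\<^sup>2) \<partial>lborel)"
    using gauss_le_1[where 'a='a]
    by (intro mult_left_mono nn_integral_mono ennreal_leI) (auto intro: mult_right_le_one_le
        less_imp_le[OF gauss_pos])
  finally show ?thesis .
qed

text \<open>The substitution \<open>x = z - s w\<close> exhibits the mollified function as an
  average of translates of \<open>g\<close>, so its L1 error is at most the same average of
  translation errors.\<close>

lemma mollify_tendsto_L1:
  shows "\<And>s. s > 0 \<Longrightarrow> integrable lborel (mollify s)"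
    and "(\<lambda>n. \<integral>z. norm (mollify (1 / real (Suc n)) z - g z) \<partial>lborel) \<longlonglongrightarrow> 0"
proof -
  have shift: "(\<integral>x. gauss_kernel s (z - x) * u x \<partial>lborel)
      = (\<integral>w. gauss_kernel 1 w * u (- (s *\<^sub>R w) + z) \<partial>lborel)"
    if s: "s > 0" and u: "integrable lborel (\<lambda>x. gauss_kernel s (z - x) * u x)"
    for s z and u :: "'a \<Rightarrow> real"
  proof -
    have "gauss_kernel s (z - (z + (- s) *\<^sub>R w)) = gauss_kernel 1 w / s ^ DIM('a)" for w :: 'a
      using s by (simp add: gauss_kernel_def)
    moreover have "- (s *\<^sub>R w) + z = z + (- s) *\<^sub>R w" for w by simp
    ultimately show ?thesis
      using integral_lborel_affine[OF u, of "- s" z] s by (simp only: times_divide_eq_left) (simp add: field_simps)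
  qed
  have diff_eq: "mollify s z - g z = (\<integral>w. gauss_kernel 1 w * (g (- (s *\<^sub>R w) + z) - g z) \<partial>lborel)"
    if s: "s > 0" for s z
  proof -
    have i: "integrable lborel (\<lambda>x. gauss_kernel s (z - x) * (g x - g z))"
    proof -
      have "integrable lborel (\<lambda>x. gauss_kernel s (z + (- 1) *\<^sub>R x))"
        by (intro integrable_lborel_affine gauss_kernel_integral s) simp
      thus ?thesis using mollify_integrand[OF s, of z] by (simp add: right_diff_distrib)
    qed
    have "(\<integral>x. gauss_kernel s (z + (- 1) *\<^sub>R x) \<partial>lborel) = 1"
      by (subst integral_lborel_affine) (auto simp: gauss_kernel_integral s)
    hence "mollify s z - g z = (\<integral>x. gauss_kernel s (z - x) * (g x - g z) \<partial>lborel)"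
      using mollify_integrand[OF s, of z] i
        integrable_lborel_affine[OF gauss_kernel_integral(1)[OF s], of "-1" z]
      by (simp add: mollify_def right_diff_distrib)
    thus ?thesis using shift[OF s i] by simp
  qed
  define D where "D h = (\<integral>z. \<bar>g (h + z) - g z\<bar> \<partial>lborel)" for h
  have D_le: "D h \<le> 2 * (\<integral>z. \<bar>g z\<bar> \<partial>lborel)" for h
    using integral_translation_diff_le[OF g integrable_zero, of h] by (simp add: D_def)
  have D_nonneg: "D h \<ge> 0" for h by (simp add: D_def)
  have [measurable]: "D \<in> borel_measurable borel" unfolding D_def by measurable
  have le: "(\<integral>\<^sup>+z. norm (mollify s z - g z) \<partial>lborel) \<le> ennreal (\<integral>w. gauss_kernel 1 w * D (- (s *\<^sub>R w)) \<partial>lborel)"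
    if s: "s > 0" for s
  proof -
    have "(\<integral>\<^sup>+z. norm (mollify s z - g z) \<partial>lborel)
        \<le> (\<integral>\<^sup>+z. (\<integral>\<^sup>+w. ennreal (gauss_kernel 1 w * \<bar>g (- (s *\<^sub>R w) + z) - g z\<bar>) \<partial>lborel) \<partial>lborel)"
    proof (rule nn_integral_mono)
      fix z
      have "ennreal (norm (mollify s z - g z))
          \<le> (\<integral>\<^sup>+w. norm (gauss_kernel 1 w * (g (- (s *\<^sub>R w) + z) - g z)) \<partial>lborel)"
        \<comment> \<open>If the integrand is not integrable, its Bochner integral is 0 by default
          and the bound is trivial.\<close>
        unfolding diff_eq[OF s] by (cases "integrable lborel (\<lambda>w. gauss_kernel 1 w * (g (- (s *\<^sub>R w) + z) - g z))")
          (rule integral_norm_bound_ennreal, assumption, subst not_integrable_integral_eq, simp_all)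
      thus "ennreal (norm (mollify s z - g z))
          \<le> (\<integral>\<^sup>+w. ennreal (gauss_kernel 1 w * \<bar>g (- (s *\<^sub>R w) + z) - g z\<bar>) \<partial>lborel)"
        using gauss_kernel_nonneg[of 1, where 'a='a] by (simp add: abs_mult abs_of_nonneg)
    qed
    also have "\<dots> = (\<integral>\<^sup>+w. (\<integral>\<^sup>+z. ennreal (gauss_kernel 1 w * \<bar>g (- (s *\<^sub>R w) + z) - g z\<bar>) \<partial>lborel) \<partial>lborel)"
      by (rule lborel_pair.Fubini') measurable
    also have "\<dots> = (\<integral>\<^sup>+w. ennreal (gauss_kernel 1 w * D (- (s *\<^sub>R w))) \<partial>lborel)"
    proof (intro nn_integral_cong)
      fix w :: 'a
      have "integrable lborel (\<lambda>z. \<bar>g (- (s *\<^sub>R w) + z) - g z\<bar>)"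
        using g integrable_lborel_translate[OF g, of "- (s *\<^sub>R w)"] by simp
      thus "(\<integral>\<^sup>+z. ennreal (gauss_kernel 1 w * \<bar>g (- (s *\<^sub>R w) + z) - g z\<bar>) \<partial>lborel)
          = ennreal (gauss_kernel 1 w * D (- (s *\<^sub>R w)))"
        unfolding D_def using gauss_kernel_nonneg[of 1 w]
        by (subst nn_integral_eq_integral) auto
    qed
    also have "\<dots> = ennreal (\<integral>w. gauss_kernel 1 w * D (- (s *\<^sub>R w)) \<partial>lborel)"
    proof (rule nn_integral_eq_integral)
      show "integrable lborel (\<lambda>w. gauss_kernel 1 w * D (- (s *\<^sub>R w)))"
      proof (rule Bochner_Integration.integrable_bound)
        show "integrable lborel (\<lambda>w::'a. gauss_kernel 1 w * (2 * (\<integral>z. \<bar>g z\<bar> \<partial>lborel)))"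
          by (intro integrable_mult_left gauss_kernel_integral) simp
        show "AE w in lborel. norm (gauss_kernel 1 w * D (- (s *\<^sub>R w)))
            \<le> norm (gauss_kernel 1 w * (2 * (\<integral>z. \<bar>g z\<bar> \<partial>lborel)))"
          using D_le D_nonneg by (intro AE_I2) (auto simp: abs_mult intro!: mult_left_mono)
      qed measurable
    qed (use D_nonneg gauss_kernel_nonneg[of 1, where 'a='a] in auto)
    finally show ?thesis .
  qed
  have diff_int: "integrable lborel (\<lambda>z. mollify s z - g z)" if "s > 0" for s
    using le[OF that] by (intro integrableI_bounded) (auto intro: le_less_trans)
  show "integrable lborel (mollify s)" if "s > 0" for s
    using Bochner_Integration.integrable_add[OF diff_int[OF that] g] by simp
  show "(\<lambda>n. \<integral>z. norm (mollify (1 / real (Suc n)) z - g z) \<partial>lborel) \<longlonglongrightarrow> 0"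
  proof (rule tendsto_sandwich[OF _ _ tendsto_const[of 0] integral_gauss_kernel_translation_tendsto[OF g]])
    show "\<forall>\<^sub>F n in sequentially. (\<integral>z. norm (mollify (1 / real (Suc n)) z - g z) \<partial>lborel)
        \<le> (\<integral>w. gauss_kernel 1 w * (\<integral>z. \<bar>g (- (w /\<^sub>R real (Suc n)) + z) - g z\<bar> \<partial>lborel) \<partial>lborel)"
    proof (intro always_eventually allI)
      fix n
      have s: "1 / real (Suc n) > 0" by simp
      have "ennreal (\<integral>z. norm (mollify (1 / real (Suc n)) z - g z) \<partial>lborel)
          \<le> ennreal (\<integral>w. gauss_kernel 1 w * D (- ((1 / real (Suc n)) *\<^sub>R w)) \<partial>lborel)"
        using le[OF s] diff_int[OF s] by (subst (asm) nn_integral_eq_integral) auto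
      thus "(\<integral>z. norm (mollify (1 / real (Suc n)) z - g z) \<partial>lborel)
        \<le> (\<integral>w. gauss_kernel 1 w * (\<integral>z. \<bar>g (- (w /\<^sub>R real (Suc n)) + z) - g z\<bar> \<partial>lborel) \<partial>lborel)"
        using D_nonneg gauss_kernel_nonneg[of 1, where 'a='a]
        by (subst (asm) ennreal_le_iff)
          (auto simp: D_def divide_inverse intro!: integral_nonneg_AE AE_I2 mult_nonneg_nonneg)
    qed
  qed (auto intro!: always_eventually integral_nonneg_AE)
qed

text \<open>Applied to a difference with vanishing Fourier transform, this also yields uniqueness of
  Fourier transforms.\<close>
lemma plancherel_le:
  "(\<integral>\<^sup>+z. ennreal ((g z)\<^sup>2) \<partial>lborel)
    \<le> ennreal (1 / (gauss_mass TYPE('a))\<^sup>2) * (\<integral>\<^sup>+\<xi>. ennreal ((norm (fourier \<xi>))\<^sup>2) \<partial>lborel)"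
proof -
  let ?u = "\<lambda>n. mollify (1 / real (Suc n))"
  have u: "integrable lborel (\<lambda>z. ?u n z - g z)" for n
    using mollify_tendsto_L1(1) g by simp
  \<comment> \<open>L1 convergence yields an almost everywhere convergent subsequence, along which
    Fatou's lemma transfers the uniform bound to the limit.\<close>
  obtain r where r: "strict_mono r" "AE z in lborel. (\<lambda>n. ?u (r n) z - g z) \<longlonglongrightarrow> 0"
    using tendsto_L1_AE_subseq[of lborel "\<lambda>n z. ?u n z - g z", OF u mollify_tendsto_L1(2)] by auto
  have "(\<integral>\<^sup>+z. ennreal ((g z)\<^sup>2) \<partial>lborel) = (\<integral>\<^sup>+z. liminf (\<lambda>n. ennreal ((?u (r n) z)\<^sup>2)) \<partial>lborel)"
  proof (rule nn_integral_cong_AE, use r(2) in eventually_elim)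
    case (elim z)
    have "(\<lambda>n. ?u (r n) z) \<longlonglongrightarrow> g z" using LIM_zero_cancel[OF elim] .
    hence "(\<lambda>n. ennreal ((?u (r n) z)\<^sup>2)) \<longlonglongrightarrow> ennreal ((g z)\<^sup>2)"
      by (intro tendsto_ennrealI tendsto_intros)
    thus ?case by (intro lim_imp_Liminf[symmetric]) auto
  qed
  also have "\<dots> \<le> liminf (\<lambda>n. \<integral>\<^sup>+z. ennreal ((?u (r n) z)\<^sup>2) \<partial>lborel)"
    by (rule nn_integral_liminf) measurable
  also have "\<dots> \<le> limsup (\<lambda>n. \<integral>\<^sup>+z. ennreal ((?u (r n) z)\<^sup>2) \<partial>lborel)"
    by (rule Liminf_le_Limsup) simp
  also have "\<dots> \<le> ennreal (1 / (gauss_mass TYPE('a))\<^sup>2) * (\<integral>\<^sup>+\<xi>. ennreal ((norm (fourier \<xi>))\<^sup>2) \<partial>lborel)"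
    by (rule Limsup_bounded) (auto intro!: always_eventually mollify_L2_bound)
  finally show ?thesis .
qed

end

section \<open>The time-fractional heat kernel\<close>

lemma nn_integral_lborel_pair:
  fixes f :: "'a::euclidean_space \<times> 'b::euclidean_space \<Rightarrow> ennreal"
  assumes "f \<in> borel_measurable borel"
  shows "(\<integral>\<^sup>+z. f z \<partial>lborel) = (\<integral>\<^sup>+x. (\<integral>\<^sup>+y. f (x, y) \<partial>lborel) \<partial>lborel)"
  unfolding lborel_prod[symmetric]
  by (rule lborel.nn_integral_fst[symmetric]) (use assms in \<open>simp add: lborel_prod\<close>)

lemma emeasure_lborel_ball_scale:
  assumes "r > 0"
  shows "emeasure lborel (ball (0::'a::euclidean_space) r) = ennreal (r ^ DIM('a)) * emeasure lborel (ball (0::'a) 1)"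
proof -
  have "emeasure lborel (ball (0::'a) r) = (\<integral>\<^sup>+x. indicator (ball (0::'a) r) x \<partial>lborel)" by simp
  also have "\<dots> = ennreal (\<bar>r\<bar> ^ DIM('a)) * (\<integral>\<^sup>+x. indicator (ball (0::'a) r) (0 + r *\<^sub>R x) \<partial>lborel)"
    using assms by (intro nn_integral_lborel_affine borel_measurable_indicator) auto
  also have "(\<lambda>x. indicator (ball (0::'a) r) (0 + r *\<^sub>R x)) = (indicator (ball (0::'a) 1) :: _ \<Rightarrow> ennreal)"
    using assms by (auto simp: indicator_def fun_eq_iff)
  finally show ?thesis using assms by simp
qed

text \<open>On the dyadic shell \<open>2 ^ n \<le> norm x < 2 ^ Suc n\<close> the integrand is at
  most \<open>w n\<close>. The volume of the ball of radius \<open>2 ^ Suc n\<close> grows like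
  \<open>2 ^ (d n)\<close>, so the shells are controlled by a geometric series of ratio
  \<open>q = 2 powr (d - 2 \<alpha>) < 1\<close>.\<close>

lemma nn_integral_inverse_powr_finite:
  fixes a \<alpha> :: real
  assumes a: "a > 0" and \<alpha>: "\<alpha> > 0" and d: "real DIM('a) < 2 * \<alpha>"
  shows "(\<integral>\<^sup>+(x::'a::euclidean_space). ennreal (1 / (1 + a * norm x powr \<alpha>)\<^sup>2) \<partial>lborel) < \<infinity>"
proof -
  let ?B = "\<lambda>r. ball (0::'a) r"
  have [measurable]: "?B r \<in> sets borel" for r by simp
  define w where "w n = 1 / a\<^sup>2 * 2 powr (- 2 * \<alpha> * real n)" for n
  have w: "w n \<ge> 0" for n by (simp add: w_def)
  have pt: "ennreal (1 / (1 + a * norm x powr \<alpha>)\<^sup>2)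
      \<le> indicator (?B 1) x + (\<Sum>n. ennreal (w n) * indicator (?B (2 ^ Suc n)) x)" for x :: 'a
  proof (cases "norm x < 1")
    case True
    have "1 / (1 + a * norm x powr \<alpha>)\<^sup>2 \<le> 1"
      using a by (simp add: divide_le_eq_1 one_le_power)
    hence "ennreal (1 / (1 + a * norm x powr \<alpha>)\<^sup>2) \<le> indicator (?B 1) x"
      using True by simp
    thus ?thesis by (rule order.trans) simp
  next
    case False
    define n where "n = nat \<lfloor>log 2 (norm x)\<rfloor>"
    have x: "norm x \<ge> 1" using False by simp
    have l: "0 \<le> log 2 (norm x)" by (subst zero_le_log_cancel_iff) (use x in auto)
    have n1: "real n \<le> log 2 (norm x)" "log 2 (norm x) < real n + 1"
      using l unfolding n_def by linarith+
    have e: "2 powr log 2 (norm x) = norm x" by (rule powr_log_cancel) (use x in auto)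
    have n2: "2 powr real n \<le> norm x" "norm x < 2 powr (real n + 1)"
      using powr_mono[OF n1(1), of 2, unfolded e] powr_less_mono[OF n1(2), of 2, unfolded e] by simp_all
    have "norm x < 2 ^ Suc n"
      using n2(2) by (simp add: powr_add powr_realpow)
    hence ind: "x \<in> ?B (2 ^ Suc n)" by simp
    have "a * 2 powr (\<alpha> * real n) = a * (2 powr real n) powr \<alpha>" by (simp add: powr_powr mult.commute)
    also have "\<dots> \<le> 1 + a * norm x powr \<alpha>"
      using n2(1) a \<alpha> powr_mono2[of \<alpha> "2 powr real n" "norm x"] by (simp add: mult_left_mono add_increasing)
    finally have "(a * 2 powr (\<alpha> * real n))\<^sup>2 \<le> (1 + a * norm x powr \<alpha>)\<^sup>2"
      using a by (intro power_mono) auto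
    hence "1 / (1 + a * norm x powr \<alpha>)\<^sup>2 \<le> 1 / (a * 2 powr (\<alpha> * real n))\<^sup>2"
      using a by (intro divide_left_mono mult_pos_pos zero_less_power) (auto simp: add_pos_nonneg)
    also have "\<dots> = w n"
      by (simp add: w_def power_mult_distrib powr_minus_divide powr_powr powr_power mult_ac)
    finally have "ennreal (1 / (1 + a * norm x powr \<alpha>)\<^sup>2) \<le> ennreal (w n)" by (rule ennreal_leI)
    also have "\<dots> = (\<Sum>k\<in>{n}. ennreal (w k) * indicator (?B (2 ^ Suc k)) x)"
      using ind by simp
    also have "\<dots> \<le> (\<Sum>k. ennreal (w k) * indicator (?B (2 ^ Suc k)) x)"
      by (rule sum_le_suminf) auto
    finally show ?thesis by (rule order.trans) simp
  qed
  define m where "m = measure lborel (?B 1)"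
  have m: "emeasure lborel (?B 1) = ennreal m"
    unfolding m_def using emeasure_lborel_ball_finite[of "0::'a" 1]
    by (intro emeasure_eq_ennreal_measure) (auto simp: less_top)
  define q where "q = 2 powr (real DIM('a) - 2 * \<alpha>)"
  have q: "0 < q" "q < 1" using d by (auto simp: q_def powr_less_one intro!: powr_less_one)
  have term_eq: "w n * (2 ^ Suc n) ^ DIM('a) = 2 ^ DIM('a) / a\<^sup>2 * q ^ n" for n
  proof -
    have "(2 ^ Suc n :: real) ^ DIM('a) = 2 ^ DIM('a) * 2 powr (real DIM('a) * real n)"
      by (simp add: power_mult_distrib powr_realpow[symmetric] powr_powr[symmetric] power_mult[symmetric] mult.commute
          flip: powr_realpow)
    moreover have "q ^ n = 2 powr (real DIM('a) * real n) * 2 powr (- 2 * \<alpha> * real n)"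
      by (simp add: q_def powr_power powr_add[symmetric] algebra_simps)
    ultimately show ?thesis by (simp add: w_def)
  qed
  have "(\<integral>\<^sup>+(x::'a). ennreal (1 / (1 + a * norm x powr \<alpha>)\<^sup>2) \<partial>lborel)
      \<le> (\<integral>\<^sup>+x. indicator (?B 1) x + (\<Sum>n. ennreal (w n) * indicator (?B (2 ^ Suc n)) x) \<partial>lborel)"
    by (intro nn_integral_mono pt)
  also have "\<dots> = emeasure lborel (?B 1) + (\<Sum>n. ennreal (w n) * emeasure lborel (?B (2 ^ Suc n)))"
    by (subst nn_integral_add, measurable, subst nn_integral_suminf, measurable)
      (simp add: nn_integral_cmult_indicator)
  also have "(\<Sum>n. ennreal (w n) * emeasure lborel (?B (2 ^ Suc n)))
      = (\<Sum>n. ennreal (2 ^ DIM('a) / a\<^sup>2 * q ^ n * m))"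
  proof (intro suminf_cong)
    fix n
    have "ennreal (w n) * emeasure lborel (?B (2 ^ Suc n)) = ennreal (w n * (2 ^ Suc n) ^ DIM('a) * m)"
      using w by (subst emeasure_lborel_ball_scale) (simp_all add: m ennreal_mult' mult.assoc m_def)
    thus "ennreal (w n) * emeasure lborel (?B (2 ^ Suc n)) = ennreal (2 ^ DIM('a) / a\<^sup>2 * q ^ n * m)"
      by (simp only: term_eq)
  qed
  also have "\<dots> = ennreal (\<Sum>n. 2 ^ DIM('a) / a\<^sup>2 * q ^ n * m)"
    using q by (intro suminf_ennreal2 summable_mult summable_mult2 summable_geometric) (auto simp: m_def)
  also have "emeasure lborel (?B 1) + \<dots> < \<infinity>" by (simp add: m)
  finally show ?thesis .
qed

lemma nn_integral_powr_exp:
  fixes \<gamma> \<theta> :: real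
  assumes "\<gamma> < 1" "\<theta> > 0"
  shows "(\<integral>\<^sup>+t. ennreal (indicator {0<..} t * t powr (-\<gamma>) * exp (- \<theta> * t)) \<partial>lborel)
    = ennreal (\<theta> powr (\<gamma> - 1) * Gamma (1 - \<gamma>))"
proof -
  have "(\<integral>\<^sup>+t. ennreal (indicator {0<..} t * t powr (-\<gamma>) * exp (- \<theta> * t)) \<partial>lborel)
      = ennreal \<bar>1 / \<theta>\<bar> * (\<integral>\<^sup>+t. ennreal (indicator {0<..} (0 + 1 / \<theta> * t) * (0 + 1 / \<theta> * t) powr (-\<gamma>)
          * exp (- \<theta> * (0 + 1 / \<theta> * t))) \<partial>lborel)"
    using assms by (intro nn_integral_real_affine) auto
  also have "(\<lambda>t. ennreal (indicator {0<..} (0 + 1 / \<theta> * t) * (0 + 1 / \<theta> * t) powr (-\<gamma>)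
          * exp (- \<theta> * (0 + 1 / \<theta> * t))))
      = (\<lambda>t. ennreal (\<theta> powr \<gamma>) * ennreal (indicator {0..} t * t powr ((1 - \<gamma>) - 1) / exp t))"
  proof
    fix t :: real
    show "ennreal (indicator {0<..} (0 + 1 / \<theta> * t) * (0 + 1 / \<theta> * t) powr (-\<gamma>)
          * exp (- \<theta> * (0 + 1 / \<theta> * t)))
        = ennreal (\<theta> powr \<gamma>) * ennreal (indicator {0..} t * t powr ((1 - \<gamma>) - 1) / exp t)"
    proof (cases "t > 0")
      case True
      thus ?thesis using assms
        by (simp add: ennreal_mult'[symmetric] powr_divide powr_minus exp_minus field_simps)
    next
      case False
      thus ?thesis using assms by (cases "t = 0") (auto simp: indicator_def zero_less_divide_iff)
    qed
  qed
  also have "(\<integral>\<^sup>+t. ennreal (\<theta> powr \<gamma>) * ennreal (indicator {0..} t * t powr ((1 - \<gamma>) - 1) / exp t) \<partial>lborel)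
      = ennreal (\<theta> powr \<gamma>) * ennreal (Gamma (1 - \<gamma>))"
    using assms by (subst nn_integral_cmult) (auto simp: Gamma_conv_nn_integral_real)
  also have "ennreal \<bar>1 / \<theta>\<bar> * (ennreal (\<theta> powr \<gamma>) * ennreal (Gamma (1 - \<gamma>)))
      = ennreal (\<theta> powr (\<gamma> - 1) * Gamma (1 - \<gamma>))"
    using assms Gamma_real_pos[of "1 - \<gamma>"]
    by (simp add: ennreal_mult'[symmetric] powr_diff less_imp_le)
  finally show ?thesis .
qed

section \<open>Norms of the kernel\<close>

locale frac_heat =
  fixes \<nu> \<alpha> \<beta> :: real and G :: "real \<Rightarrow> real^'d \<Rightarrow> real"
  assumes \<nu>: "\<nu> > 0" and \<alpha>: "0 < \<alpha>" and \<beta>: "0 < \<beta>" "\<beta> < 1"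
    and dim: "real CARD('d) < min 2 (1 / \<beta>) * \<alpha>"
    and kernel: "frac_heat_kernel \<nu> \<alpha> \<beta> G"
begin

definition \<gamma> :: real where "\<gamma> = real CARD('d) * \<beta> / \<alpha>"

text \<open>The entry \<open>1 / \<beta>\<close> of the minimum in \<open>dim\<close> makes the
  singularity \<open>t powr (- \<gamma>)\<close> integrable at time 0; the entry 2, used in
  \<open>dim_less\<close>, gives square integrability in frequency.\<close>

lemma \<gamma>_bounds: "0 \<le> \<gamma>" "\<gamma> < 1"
proof -
  have "min 2 (1 / \<beta>) * \<alpha> \<le> 1 / \<beta> * \<alpha>" using \<alpha> by (intro mult_right_mono) auto
  hence "real CARD('d) < \<alpha> / \<beta>" using dim by simp
  thus "\<gamma> < 1" using \<alpha> \<beta> by (simp add: \<gamma>_def field_simps)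
qed (use \<alpha> \<beta> in \<open>auto simp: \<gamma>_def\<close>)

lemma dim_less: "real CARD('d) < 2 * \<alpha>"
proof -
  have "min 2 (1 / \<beta>) * \<alpha> \<le> 2 * \<alpha>" using \<alpha> by (intro mult_right_mono) auto
  thus ?thesis using dim by simp
qed

lemma G_integrable: "t > 0 \<Longrightarrow> integrable lborel (G t)"
  using kernel by (simp add: frac_heat_kernel_def)

lemma fourier_G:
  "t > 0 \<Longrightarrow> fourier (G t) \<xi> = complex_of_real (mittag_leffler \<beta> (- (\<nu> * norm \<xi> powr \<alpha> * t powr \<beta>)))"
  using kernel by (simp add: frac_heat_kernel_def fourier_def)

text \<open>Plancherel's constant times the integral of the squared frequency bound at time 1. The
  conversion \<open>enn2real\<close> loses nothing, since the integral is shown to be finite in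
  \<open>G_L2_bound\<close>.\<close>

definition kernel_L2 :: real where
  "kernel_L2 = enn2real (ennreal (1 / (gauss_mass TYPE(real^'d))\<^sup>2)
     * (\<integral>\<^sup>+(\<xi>::real^'d). ennreal (1 / (1 + \<nu> / Gamma (1 + \<beta>) * norm \<xi> powr \<alpha>)\<^sup>2) \<partial>lborel))"

lemma kernel_L2_nonneg: "kernel_L2 \<ge> 0" by (simp add: kernel_L2_def)

text \<open>Under \<open>\<xi> = t powr (- \<beta> / \<alpha>) * \<eta>\<close> the transform of
  \<open>G t\<close> no longer depends on t, and the Jacobian of the substitution is exactly
  \<open>t powr (- \<gamma>)\<close>.\<close>

lemma G_L2_bound:
  assumes t: "t > 0"
  shows "(\<integral>\<^sup>+x. ennreal ((G t x)\<^sup>2) \<partial>lborel) \<le> ennreal (kernel_L2 * t powr (- \<gamma>))"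
proof -
  let ?c = "ennreal (1 / (gauss_mass TYPE(real^'d))\<^sup>2)"
  let ?J = "\<integral>\<^sup>+(\<xi>::real^'d). ennreal (1 / (1 + \<nu> / Gamma (1 + \<beta>) * norm \<xi> powr \<alpha>)\<^sup>2) \<partial>lborel"
  define c where "c = t powr (- \<beta> / \<alpha>)"
  have c: "c > 0" using t by (simp add: c_def)
  have \<Gamma>: "Gamma (1 + \<beta>) > 0" using \<beta> by (intro Gamma_real_pos) auto
  have "?J < \<infinity>"
    using nn_integral_inverse_powr_finite[where 'a="real^'d", of "\<nu> / Gamma (1 + \<beta>)" \<alpha>] \<nu> \<Gamma> \<alpha> dim_less
    by simp
  hence J: "?c * ?J = ennreal kernel_L2"
    unfolding kernel_L2_def by (subst ennreal_enn2real) (auto simp: ennreal_mult_less_top)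
  have [measurable]: "fourier (G t) \<in> borel_measurable borel"
    by (rule fourier_measurable[OF G_integrable[OF t]])
  have scale: "norm (c *\<^sub>R \<eta>) powr \<alpha> * t powr \<beta> = norm \<eta> powr \<alpha>" for \<eta> :: "real^'d"
  proof -
    have "c powr \<alpha> = t powr (- \<beta>)" unfolding c_def powr_powr using \<alpha> by simp
    thus ?thesis using c t by (simp add: powr_mult powr_minus)
  qed
  have pt: "ennreal ((norm (fourier (G t) (0 + c *\<^sub>R \<eta>)))\<^sup>2)
      \<le> ennreal (1 / (1 + \<nu> / Gamma (1 + \<beta>) * norm \<eta> powr \<alpha>)\<^sup>2)" for \<eta>
  proof (rule ennreal_leI)
    have z: "\<nu> * norm \<eta> powr \<alpha> \<ge> 0" using \<nu> by simp
    have "(mittag_leffler \<beta> (- (\<nu> * norm \<eta> powr \<alpha>)))\<^sup>2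
        \<le> (1 / (1 + \<nu> * norm \<eta> powr \<alpha> / Gamma (1 + \<beta>)))\<^sup>2"
      using mittag_leffler_bounds[OF \<beta> z] by (intro power_mono) auto
    moreover have "fourier (G t) (0 + c *\<^sub>R \<eta>) = complex_of_real (mittag_leffler \<beta> (- (\<nu> * norm \<eta> powr \<alpha>)))"
      using fourier_G[OF t, of "0 + c *\<^sub>R \<eta>"] scale[of \<eta>] by (simp only: mult.assoc add_0_left)
    ultimately show "(norm (fourier (G t) (0 + c *\<^sub>R \<eta>)))\<^sup>2
      \<le> 1 / (1 + \<nu> / Gamma (1 + \<beta>) * norm \<eta> powr \<alpha>)\<^sup>2"
      by (simp add: power_divide)
  qed
  have "(\<integral>\<^sup>+x. ennreal ((G t x)\<^sup>2) \<partial>lborel) \<le> ?c * (\<integral>\<^sup>+\<xi>. ennreal ((norm (fourier (G t) \<xi>))\<^sup>2) \<partial>lborel)"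
    by (rule plancherel_le[OF G_integrable[OF t]])
  also have "(\<integral>\<^sup>+\<xi>. ennreal ((norm (fourier (G t) \<xi>))\<^sup>2) \<partial>lborel)
      = ennreal (\<bar>c\<bar> ^ CARD('d)) * (\<integral>\<^sup>+\<eta>. ennreal ((norm (fourier (G t) (0 + c *\<^sub>R \<eta>)))\<^sup>2) \<partial>lborel)"
    using c by (subst nn_integral_lborel_affine[of _ c 0]) auto
  also have "?c * \<dots> \<le> ?c * (ennreal (\<bar>c\<bar> ^ CARD('d)) * ?J)"
    by (intro mult_left_mono nn_integral_mono pt) auto
  also have "\<dots> = ennreal (\<bar>c\<bar> ^ CARD('d)) * (?c * ?J)" by (simp add: mult_ac)
  also have "\<dots> = ennreal (kernel_L2 * t powr (- \<gamma>))"
    unfolding J using c t kernel_L2_nonneg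
    by (simp add: ennreal_mult'[symmetric] mult.commute c_def \<gamma>_def powr_power)
  finally show ?thesis .
qed

definition kernel_L1 :: real where "kernel_L1 = (\<integral>x. \<bar>G 1 x\<bar> \<partial>lborel)"

lemma kernel_L1_nonneg: "kernel_L1 \<ge> 0" by (simp add: kernel_L1_def)

text \<open>By uniqueness of Fourier transforms \<open>G\<^sub>t\<close> is a rescaling of \<open>G\<^sub>1\<close>.\<close>
lemma G_L1:
  assumes t: "t > 0"
  shows "(\<integral>x. \<bar>G t x\<bar> \<partial>lborel) = kernel_L1"
proof -
  define r where "r = t powr (\<beta> / \<alpha>)"
  have r: "r > 0" using t by (simp add: r_def)
  have c: "1 / r \<noteq> 0" using r by simp
  define S where "S x = G 1 (0 + (1 / r) *\<^sub>R x) / r ^ CARD('d)" for x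
  note G1 = G_integrable[of 1, simplified]
  have S: "integrable lborel S"
    unfolding S_def by (intro Bochner_Integration.integrable_divide integrable_lborel_affine G1 c)
  have fS: "fourier S \<xi> = fourier (G 1) (r *\<^sub>R \<xi>)" for \<xi>
  proof -
    let ?f = "\<lambda>y. cis ((r *\<^sub>R \<xi>) \<bullet> y) * of_real (G 1 y)"
    have "fourier S \<xi> = (\<integral>x. ?f (0 + (1 / r) *\<^sub>R x) / of_real (r ^ CARD('d)) \<partial>lborel)"
      unfolding fourier_def[OF S] S_def using r by (intro Bochner_Integration.integral_cong) auto
    also have "\<dots> = (\<integral>x. ?f (0 + (1 / r) *\<^sub>R x) \<partial>lborel) / of_real (r ^ CARD('d))"
      by (rule integral_divide_zero)
    also have "\<dots> = fourier (G 1) (r *\<^sub>R \<xi>)"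
      unfolding integral_lborel_affine[OF fourier_integrand[OF G1] c] fourier_def[OF G1]
      using r by (simp add: scaleR_conv_of_real power_divide)
    finally show ?thesis .
  qed
  define h where "h x = G t x - S x" for x
  have h: "integrable lborel h" unfolding h_def using S G_integrable[OF t] by simp
  have [measurable]: "h \<in> borel_measurable borel" using h by auto
  have "fourier h \<xi> = 0" for \<xi>
  proof -
    have "fourier h \<xi> = fourier (G t) \<xi> - fourier S \<xi>"
      unfolding fourier_def[OF h] fourier_def[OF G_integrable[OF t]] fourier_def[OF S] h_def
      using fourier_integrand[OF G_integrable[OF t]] fourier_integrand[OF S]
      by (simp add: right_diff_distrib)
    also have "\<dots> = 0"
      unfolding fS fourier_G[OF t] using fourier_G[of 1 "r *\<^sub>R \<xi>"] r t \<alpha>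
      by (simp add: powr_mult r_def powr_powr mult_ac)
    finally show ?thesis .
  qed
  hence "(\<integral>\<^sup>+x. ennreal ((h x)\<^sup>2) \<partial>lborel) = 0"
    using plancherel_le[OF h] by simp
  hence "AE x in lborel. h x = 0" by (simp add: nn_integral_0_iff_AE)
  hence ae: "AE x in lborel. \<bar>G t x\<bar> = \<bar>S x\<bar>"
    by eventually_elim (simp add: h_def)
  have "(\<integral>x. \<bar>G t x\<bar> \<partial>lborel) = (\<integral>x. \<bar>S x\<bar> \<partial>lborel)"
    using ae G_integrable[OF t] S by (intro integral_cong_AE) auto
  also have "\<dots> = (\<integral>x. \<bar>G 1 (0 + (1 / r) *\<^sub>R x)\<bar> \<partial>lborel) / r ^ CARD('d)"
    unfolding S_def using r by (simp add: abs_divide)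
  also have "\<dots> = kernel_L1"
    using integral_lborel_affine[of "\<lambda>x. \<bar>G 1 x\<bar>", OF _ c, of 0] G1 r
    by (simp add: kernel_L1_def power_divide)
  finally show ?thesis .
qed

text \<open>Extension by 0 to nonpositive times: it builds the causal cut \<open>s < t\<close> into
  the kernel and makes it one Borel function on space-time, on which translations act.\<close>

definition G0 :: "real \<times> (real^'d) \<Rightarrow> real" where
  "G0 z = (if fst z > 0 then G (fst z) (snd z) else 0)"

lemma G0_measurable [measurable]: "G0 \<in> borel_measurable borel"
proof -
  have m: "(\<lambda>z. G (fst z) (snd z)) \<in> borel_measurable (restrict_space lborel ({0<..} \<times> UNIV))"
    using kernel by (simp add: frac_heat_kernel_def case_prod_unfold)
  have "({0<..} :: real set) \<times> (UNIV :: (real^'d) set) \<in> sets borel"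
    by (intro borel_open open_Times) auto
  hence "(\<lambda>z. indicator ({0<..} \<times> UNIV) z *\<^sub>R G (fst z) (snd z)) \<in> borel_measurable lborel"
    using m by (subst (asm) borel_measurable_restrict_space_iff) auto
  also have "(\<lambda>z. indicator ({0<..} \<times> UNIV) z *\<^sub>R G (fst z) (snd z)) = G0"
    by (auto simp: G0_def fun_eq_iff indicator_def)
  finally show ?thesis by simp
qed

definition kernel_const :: real where "kernel_const = kernel_L2 * Gamma (1 - \<gamma>)"

lemma kernel_const_nonneg: "kernel_const \<ge> 0"
  using kernel_L2_nonneg \<gamma>_bounds Gamma_real_pos[of "1 - \<gamma>"] by (simp add: kernel_const_def)

text \<open>The L2 bound turns the left side into the Laplace transform of
  \<open>t powr (- \<gamma>)\<close>. Its decay as \<theta> grows is the source of the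
  contraction.\<close>

lemma G0_weighted_L2:
  assumes \<theta>: "\<theta> > 0"
  shows "(\<integral>\<^sup>+z. ennreal ((G0 z)\<^sup>2 * exp (- \<theta> * fst z)) \<partial>lborel)
    \<le> ennreal (kernel_const * \<theta> powr (\<gamma> - 1))"
proof -
  have "(\<integral>\<^sup>+z. ennreal ((G0 z)\<^sup>2 * exp (- \<theta> * fst z)) \<partial>lborel)
      = (\<integral>\<^sup>+t. (\<integral>\<^sup>+x. ennreal ((G0 (t, x))\<^sup>2 * exp (- \<theta> * t)) \<partial>lborel) \<partial>lborel)"
    by (subst nn_integral_lborel_pair) auto
  also have "\<dots> \<le> (\<integral>\<^sup>+t. ennreal kernel_L2 * ennreal (indicator {0<..} t * t powr (-\<gamma>) * exp (- \<theta> * t)) \<partial>lborel)"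
  proof (rule nn_integral_mono)
    fix t :: real
    show "(\<integral>\<^sup>+x. ennreal ((G0 (t, x))\<^sup>2 * exp (- \<theta> * t)) \<partial>lborel)
        \<le> ennreal kernel_L2 * ennreal (indicator {0<..} t * t powr (-\<gamma>) * exp (- \<theta> * t))"
    proof (cases "t > 0")
      case True
      have [measurable]: "G t \<in> borel_measurable borel" using G_integrable[OF True] by auto
      have "(\<integral>\<^sup>+x. ennreal ((G0 (t, x))\<^sup>2 * exp (- \<theta> * t)) \<partial>lborel)
          = (\<integral>\<^sup>+x. ennreal ((G t x)\<^sup>2) \<partial>lborel) * ennreal (exp (- \<theta> * t))"
        using True by (simp add: G0_def ennreal_mult' nn_integral_multc)
      also have "\<dots> \<le> ennreal (kernel_L2 * t powr (- \<gamma>)) * ennreal (exp (- \<theta> * t))"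
        by (intro mult_right_mono G_L2_bound True) auto
      also have "\<dots> = ennreal kernel_L2 * ennreal (indicator {0<..} t * t powr (-\<gamma>) * exp (- \<theta> * t))"
        using True kernel_L2_nonneg by (simp add: ennreal_mult'[symmetric] mult_ac)
      finally show ?thesis .
    qed (simp add: G0_def)
  qed
  also have "\<dots> = ennreal (kernel_const * \<theta> powr (\<gamma> - 1))"
  proof (subst nn_integral_cmult)
    show "ennreal kernel_L2 * (\<integral>\<^sup>+t. ennreal (indicator {0<..} t * t powr (-\<gamma>) * exp (- \<theta> * t)) \<partial>lborel)
        = ennreal (kernel_const * \<theta> powr (\<gamma> - 1))"
      unfolding nn_integral_powr_exp[OF \<gamma>_bounds(2) \<theta>] using kernel_L2_nonneg
      by (simp add: kernel_const_def ennreal_mult'[symmetric] mult_ac)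
  qed auto
  finally show ?thesis .
qed

text \<open>All time slices have the same L1 norm, so the cut-off at \<open>T\<close> is what puts
  the kernel into L1; in L2 the cut-off is paid for by \<open>exp T\<close> times the weighted bound
  with \<theta> = 1.\<close>

lemma G0_translation_continuous:
  fixes h :: "nat \<Rightarrow> real \<times> (real^'d)"
  assumes h: "h \<longlonglongrightarrow> 0"
  defines "H \<equiv> \<lambda>T z. G0 z * indicator {..T} (fst z)"
  shows "(\<lambda>n. \<integral>\<^sup>+z. ennreal ((H T (h n + z) - H T z)\<^sup>2) \<partial>lborel) \<longlonglongrightarrow> 0"
proof (rule translation_continuous_L2[OF _ _ h])
  have [measurable]: "H T \<in> borel_measurable borel" unfolding H_def by measurable
  show "integrable lborel (H T)"
  proof (rule integrableI_bounded)
    have "(\<integral>\<^sup>+z. ennreal (norm (H T z)) \<partial>lborel)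
        = (\<integral>\<^sup>+t. (\<integral>\<^sup>+x. ennreal (norm (H T (t, x))) \<partial>lborel) \<partial>lborel)"
      by (subst nn_integral_lborel_pair) auto
    also have "\<dots> \<le> (\<integral>\<^sup>+t. ennreal kernel_L1 * indicator {0..T} t \<partial>lborel)"
    proof (rule nn_integral_mono)
      fix t :: real
      show "(\<integral>\<^sup>+x. ennreal (norm (H T (t, x))) \<partial>lborel) \<le> ennreal kernel_L1 * indicator {0..T} t"
      proof (cases "t \<in> {0<..T}")
        case True
        hence "(\<integral>\<^sup>+x. ennreal (norm (H T (t, x))) \<partial>lborel) = (\<integral>\<^sup>+x. ennreal \<bar>G t x\<bar> \<partial>lborel)"
          by (simp add: H_def G0_def)
        also have "\<dots> = ennreal kernel_L1"
          using G_integrable[of t] G_L1[of t] True by (subst nn_integral_eq_integral) auto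
        finally show ?thesis using True by simp
      next
        case False
        hence "H T (t, x) = 0" for x by (auto simp: H_def G0_def)
        thus ?thesis by simp
      qed
    qed
    also have "\<dots> < \<infinity>" by (simp add: nn_integral_cmult_indicator ennreal_mult_less_top emeasure_lborel_Icc_eq)
    finally show "(\<integral>\<^sup>+z. ennreal (norm (H T z)) \<partial>lborel) < \<infinity>" .
  qed simp
  show "integrable lborel (\<lambda>z. (H T z)\<^sup>2)"
  proof (rule integrableI_bounded)
    have "(\<integral>\<^sup>+z. ennreal (norm ((H T z)\<^sup>2)) \<partial>lborel)
        \<le> (\<integral>\<^sup>+z. ennreal (exp T) * ennreal ((G0 z)\<^sup>2 * exp (- 1 * fst z)) \<partial>lborel)"
    proof (rule nn_integral_mono)
      fix z :: "real \<times> (real^'d)"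
      have "(H T z)\<^sup>2 \<le> exp T * ((G0 z)\<^sup>2 * exp (- 1 * fst z))"
      proof (cases "fst z \<le> T")
        case True
        hence "1 \<le> exp (T - fst z)" by simp
        hence "(G0 z)\<^sup>2 * 1 \<le> (G0 z)\<^sup>2 * exp (T - fst z)" by (intro mult_left_mono) auto
        thus ?thesis using True by (simp add: H_def exp_diff exp_minus field_simps)
      qed (simp add: H_def)
      thus "ennreal (norm ((H T z)\<^sup>2)) \<le> ennreal (exp T) * ennreal ((G0 z)\<^sup>2 * exp (- 1 * fst z))"
        by (simp add: ennreal_mult'[symmetric] ennreal_leI)
    qed
    also have "\<dots> \<le> ennreal (exp T) * ennreal (kernel_const * 1 powr (\<gamma> - 1))"
      using G0_weighted_L2[of 1] by (subst nn_integral_cmult) (auto intro: mult_left_mono)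
    also have "\<dots> < \<infinity>" by (simp add: ennreal_mult'[symmetric])
    finally show "(\<integral>\<^sup>+z. ennreal (norm ((H T z)\<^sup>2)) \<partial>lborel) < \<infinity>" .
  qed simp
qed

end

section \<open>Mean-square convergence and Gaussian moments\<close>

lemma ennreal_add_power2_le: "ennreal ((a + b)\<^sup>2) \<le> 2 * ennreal (a\<^sup>2) + 2 * ennreal (b\<^sup>2)" for a b :: real
proof -
  have "(a + b)\<^sup>2 \<le> 2 * a\<^sup>2 + 2 * b\<^sup>2"
    using zero_le_power2[of "a - b"] by (simp add: power2_eq_square algebra_simps)
  hence "ennreal ((a + b)\<^sup>2) \<le> ennreal (2 * a\<^sup>2 + 2 * b\<^sup>2)" by (rule ennreal_leI)
  also have "\<dots> = 2 * ennreal (a\<^sup>2) + 2 * ennreal (b\<^sup>2)" by (simp add: ennreal_mult')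
  finally show ?thesis .
qed

lemma nn_integral_add_power2_le:
  fixes f g :: "'a \<Rightarrow> real"
  assumes [measurable]: "f \<in> borel_measurable M" "g \<in> borel_measurable M"
  shows "(\<integral>\<^sup>+x. ennreal ((f x + g x)\<^sup>2) \<partial>M)
    \<le> 2 * (\<integral>\<^sup>+x. ennreal ((f x)\<^sup>2) \<partial>M) + 2 * (\<integral>\<^sup>+x. ennreal ((g x)\<^sup>2) \<partial>M)"
proof -
  have "(\<integral>\<^sup>+x. ennreal ((f x + g x)\<^sup>2) \<partial>M) \<le> (\<integral>\<^sup>+x. 2 * ennreal ((f x)\<^sup>2) + 2 * ennreal ((g x)\<^sup>2) \<partial>M)"
    by (intro nn_integral_mono ennreal_add_power2_le)
  thus ?thesis by (simp add: nn_integral_add nn_integral_cmult)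
qed

text \<open>With \<open>r\<close> between \<open>q\<close> and 1, the sum of
  \<open>(1 / r) ^ n * (Y n x)\<^sup>2\<close> has finite integral, hence is almost everywhere
  finite, say at most K. Then \<open>Y n x\<close> is bounded by a multiple of
  \<open>sqrt r ^ n\<close>.\<close>

lemma AE_summable_of_power2_bound:
  fixes Y :: "nat \<Rightarrow> 'a \<Rightarrow> real"
  assumes [measurable]: "\<And>n. Y n \<in> borel_measurable M"
    and q: "0 < q" "q < 1" and bound: "\<And>n. (\<integral>\<^sup>+x. ennreal ((Y n x)\<^sup>2) \<partial>M) \<le> ennreal (C * q ^ n)"
  shows "AE x in M. summable (\<lambda>n. \<bar>Y n x\<bar>)"
proof -
  define r where "r = (1 + q) / 2"
  have r: "q < r" "r < 1" "r > 0" using q by (auto simp: r_def)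
  have C: "C \<le> max C 0" "max C 0 \<ge> 0" by auto
  have "(\<integral>\<^sup>+x. (\<Sum>n. ennreal ((1 / r) ^ n) * ennreal ((Y n x)\<^sup>2)) \<partial>M)
      = (\<Sum>n. ennreal ((1 / r) ^ n) * (\<integral>\<^sup>+x. ennreal ((Y n x)\<^sup>2) \<partial>M))"
    by (simp add: nn_integral_suminf nn_integral_cmult)
  also have "\<dots> \<le> (\<Sum>n. ennreal (max C 0 * (q / r) ^ n))"
  proof (rule suminf_le)
    fix n
    have "ennreal ((1 / r) ^ n) * (\<integral>\<^sup>+x. ennreal ((Y n x)\<^sup>2) \<partial>M) \<le> ennreal ((1 / r) ^ n) * ennreal (max C 0 * q ^ n)"
      using q by (intro mult_left_mono order.trans[OF bound] ennreal_leI mult_right_mono) auto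
    also have "\<dots> = ennreal (max C 0 * (q / r) ^ n)"
      using q r by (simp add: ennreal_mult'[symmetric] power_divide mult.commute)
    finally show "ennreal ((1 / r) ^ n) * (\<integral>\<^sup>+x. ennreal ((Y n x)\<^sup>2) \<partial>M) \<le> ennreal (max C 0 * (q / r) ^ n)" .
  qed auto
  also have "\<dots> = ennreal (\<Sum>n. max C 0 * (q / r) ^ n)"
    using q r by (intro suminf_ennreal2 summable_mult summable_geometric) auto
  finally have "(\<integral>\<^sup>+x. (\<Sum>n. ennreal ((1 / r) ^ n) * ennreal ((Y n x)\<^sup>2)) \<partial>M) < \<infinity>"
    by (simp add: le_less_trans)
  hence "AE x in M. (\<Sum>n. ennreal ((1 / r) ^ n) * ennreal ((Y n x)\<^sup>2)) \<noteq> \<infinity>"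
    by (intro nn_integral_PInf_AE) auto
  thus ?thesis
  proof eventually_elim
    case (elim x)
    then obtain K where K: "K \<ge> 0" "(\<Sum>n. ennreal ((1 / r) ^ n) * ennreal ((Y n x)\<^sup>2)) = ennreal K"
      by (cases "\<Sum>n. ennreal ((1 / r) ^ n) * ennreal ((Y n x)\<^sup>2)") auto
    have le: "(Y n x)\<^sup>2 \<le> K * r ^ n" for n
    proof -
      have "ennreal ((1 / r) ^ n * (Y n x)\<^sup>2) = (\<Sum>k\<in>{n}. ennreal ((1 / r) ^ k) * ennreal ((Y k x)\<^sup>2))"
        using r by (simp add: ennreal_mult')
      also have "\<dots> \<le> ennreal K" unfolding K(2)[symmetric] by (intro sum_le_suminf) auto
      finally have "(1 / r) ^ n * (Y n x)\<^sup>2 \<le> K" using K by (simp add: ennreal_le_iff)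
      thus ?thesis using r by (simp add: power_divide field_simps)
    qed
    have "\<bar>Y n x\<bar> \<le> sqrt K * sqrt r ^ n" for n
      using real_sqrt_le_mono[OF le[of n]] by (simp only: real_sqrt_abs real_sqrt_mult) (simp add: real_sqrt_power)
    moreover have "summable (\<lambda>n. sqrt K * sqrt r ^ n)"
      using r by (intro summable_mult summable_geometric) auto
    ultimately show ?case
      by (intro summable_comparison_test[of "\<lambda>n. \<bar>Y n x\<bar>" "\<lambda>n. sqrt K * sqrt r ^ n"]) auto
  qed
qed

lemma AE_tendsto_of_power2_bound:
  fixes X :: "nat \<Rightarrow> 'a \<Rightarrow> real"
  assumes [measurable]: "\<And>n. X n \<in> borel_measurable M" "Y \<in> borel_measurable M"
    and q: "0 < q" "q < 1"
    and bound: "\<And>n. n \<ge> N \<Longrightarrow> (\<integral>\<^sup>+x. ennreal ((Y x - X n x)\<^sup>2) \<partial>M) \<le> ennreal (C * q ^ n)"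
  shows "AE x in M. (\<lambda>n. X n x) \<longlonglongrightarrow> Y x"
proof -
  have "AE x in M. summable (\<lambda>n. \<bar>Y x - X (n + N) x\<bar>)"
  proof (rule AE_summable_of_power2_bound[OF _ q])
    show "(\<integral>\<^sup>+x. ennreal ((Y x - X (n + N) x)\<^sup>2) \<partial>M) \<le> ennreal ((C * q ^ N) * q ^ n)" for n
      using bound[of "n + N"] by (simp add: power_add mult_ac)
  qed measurable
  thus ?thesis
  proof eventually_elim
    case (elim x)
    hence "(\<lambda>n. Y x - X (n + N) x) \<longlonglongrightarrow> 0"
      using summable_LIMSEQ_zero tendsto_rabs_zero_iff by blast
    hence "(\<lambda>n. Y x - (Y x - X (n + N) x)) \<longlonglongrightarrow> Y x - 0" by (intro tendsto_intros)
    hence "(\<lambda>n. X (n + N) x) \<longlonglongrightarrow> Y x" by simp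
    thus ?case by (simp only: LIMSEQ_offset)
  qed
qed

text \<open>Total, with value 0 off the set of convergence. Measurability therefore passes to the
  limit for any sigma-algebra, be it \<open>F t\<close> or the predictable one, without discarding
  null sets.\<close>

definition seq_limit :: "(nat \<Rightarrow> 'a \<Rightarrow> real) \<Rightarrow> 'a \<Rightarrow> real" where
  "seq_limit X x = (if Cauchy (\<lambda>n. X n x) then lim (\<lambda>n. X n x) else 0)"

lemma seq_limit_measurable [measurable]:
  assumes [measurable]: "\<And>n. X n \<in> borel_measurable M"
  shows "seq_limit X \<in> borel_measurable M"
  unfolding seq_limit_def by measurable

lemma seq_limit_eq: "(\<lambda>n. X n x) \<longlonglongrightarrow> l \<Longrightarrow> seq_limit X x = l"
  unfolding seq_limit_def using LIMSEQ_imp_Cauchy limI by force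

text \<open>The geometric rate makes consecutive differences almost everywhere summable, so the
  whole sequence converges there; Fatou in \<open>m\<close> then retains the Cauchy bound with the
  same constant.\<close>

lemma seq_limit_power2_bound:
  fixes X :: "nat \<Rightarrow> 'a \<Rightarrow> real"
  assumes [measurable]: "\<And>n. X n \<in> borel_measurable M"
    and q: "0 < q" "q < 1"
    and bound: "\<And>n m. n \<le> m \<Longrightarrow> (\<integral>\<^sup>+x. ennreal ((X m x - X n x)\<^sup>2) \<partial>M) \<le> ennreal (C * q ^ n)"
  shows "(\<integral>\<^sup>+x. ennreal ((seq_limit X x - X n x)\<^sup>2) \<partial>M) \<le> ennreal (C * q ^ n)"
proof -
  have "AE x in M. summable (\<lambda>n. \<bar>X (Suc n) x - X n x\<bar>)"
    by (rule AE_summable_of_power2_bound[OF _ q, where C = C]) (auto intro: bound)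
  hence ae: "AE x in M. (\<lambda>n. X n x) \<longlonglongrightarrow> seq_limit X x"
  proof eventually_elim
    case (elim x)
    hence "summable (\<lambda>n. X (Suc n) x - X n x)" by (rule summable_rabs_cancel)
    then obtain l where "(\<lambda>n. \<Sum>k<n. X (Suc k) x - X k x) \<longlonglongrightarrow> l"
      using summable_LIMSEQ by blast
    hence "(\<lambda>n. X n x - X 0 x) \<longlonglongrightarrow> l"
      unfolding sum_lessThan_telescope[where f = "\<lambda>k. X k x"] .
    hence "(\<lambda>n. (X n x - X 0 x) + X 0 x) \<longlonglongrightarrow> l + X 0 x" by (intro tendsto_intros)
    hence "(\<lambda>n. X n x) \<longlonglongrightarrow> l + X 0 x" by simp
    thus ?case using seq_limit_eq by metis
  qed
  have "(\<integral>\<^sup>+x. ennreal ((seq_limit X x - X n x)\<^sup>2) \<partial>M)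
      = (\<integral>\<^sup>+x. liminf (\<lambda>m. ennreal ((X m x - X n x)\<^sup>2)) \<partial>M)"
  proof (rule nn_integral_cong_AE, use ae in eventually_elim)
    case (elim x)
    hence "(\<lambda>m. ennreal ((X m x - X n x)\<^sup>2)) \<longlonglongrightarrow> ennreal ((seq_limit X x - X n x)\<^sup>2)"
      by (intro tendsto_ennrealI tendsto_intros)
    thus ?case by (intro lim_imp_Liminf[symmetric]) auto
  qed
  also have "\<dots> \<le> liminf (\<lambda>m. \<integral>\<^sup>+x. ennreal ((X m x - X n x)\<^sup>2) \<partial>M)"
    by (rule nn_integral_liminf) measurable
  also have "\<dots> \<le> limsup (\<lambda>m. \<integral>\<^sup>+x. ennreal ((X m x - X n x)\<^sup>2) \<partial>M)"
    by (rule Liminf_le_Limsup) simp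
  also have "\<dots> \<le> ennreal (C * q ^ n)"
    by (rule Limsup_bounded) (auto intro!: eventually_sequentiallyI[of n] bound)
  finally show ?thesis .
qed

section \<open>Moments from characteristic functions\<close>

lemma sinc_tendsto: "(\<lambda>n. sin (x / real (Suc n)) * real (Suc n)) \<longlonglongrightarrow> (x::real)"
proof -
  have "((\<lambda>h. (sin (x * (0 + h)) - sin (x * 0)) / h) \<longlongrightarrow> x) (at 0)"
  proof -
    have "((\<lambda>h. sin (x * h)) has_field_derivative x) (at 0)"
      by (auto intro!: derivative_eq_intros)
    thus ?thesis by (simp add: DERIV_def)
  qed
  hence "((\<lambda>h. sin (x * h) / h) \<longlongrightarrow> x) (at 0)" by simp
  moreover have "filterlim (\<lambda>n. inverse (real (Suc n))) (at 0) sequentially"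
    by (rule filterlim_atI[OF LIMSEQ_inverse_real_of_nat]) simp
  ultimately have "(\<lambda>n. sin (x * inverse (real (Suc n))) / inverse (real (Suc n))) \<longlonglongrightarrow> x"
    by (rule filterlim_compose)
  thus ?thesis by (simp add: divide_inverse)
qed

lemma one_minus_exp_tendsto:
  "(\<lambda>n. (1 - exp (- (2 * v) * (1 / real (Suc n))\<^sup>2)) * (real (Suc n))\<^sup>2 / 2) \<longlonglongrightarrow> (v::real)"
proof -
  have "((\<lambda>h. (exp (- (2 * v) * (0 + h)) - exp (- (2 * v) * 0)) / h) \<longlongrightarrow> - (2 * v)) (at 0)"
  proof -
    have "((\<lambda>h. exp (- (2 * v) * h)) has_field_derivative - (2 * v)) (at 0)"
      by (auto intro!: derivative_eq_intros)
    thus ?thesis by (simp add: DERIV_def)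
  qed
  hence "((\<lambda>h. (exp (- (2 * v) * h) - 1) / h) \<longlongrightarrow> - (2 * v)) (at 0)" by simp
  moreover have "filterlim (\<lambda>n. (1 / real (Suc n))\<^sup>2) (at 0) sequentially"
  proof (rule filterlim_atI)
    have "(\<lambda>n. (inverse (real (Suc n)))\<^sup>2) \<longlonglongrightarrow> 0\<^sup>2"
      by (intro tendsto_intros LIMSEQ_inverse_real_of_nat)
    thus "(\<lambda>n. (1 / real (Suc n))\<^sup>2) \<longlonglongrightarrow> 0" by (simp add: inverse_eq_divide)
  qed simp
  ultimately have "(\<lambda>n. (exp (- (2 * v) * (1 / real (Suc n))\<^sup>2) - 1) / (1 / real (Suc n))\<^sup>2) \<longlonglongrightarrow> - (2 * v)"
    by (rule filterlim_compose)
  from tendsto_mult[OF this tendsto_const[of "- 1 / 2"]] show ?thesis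
    by (simp add: power_divide algebra_simps diff_divide_distrib)
qed

text \<open>The moments are read off the characteristic function through \<open>(sin (h z) / h)\<^sup>2 \<rightarrow> z\<^sup>2\<close>:
  Fatou gives integrability, dominated convergence the values.\<close>
lemma (in prob_space) gaussian_moments:
  assumes E [measurable]: "E \<in> events" and [measurable]: "random_variable borel Z"
    and cf: "\<And>s. (\<integral>\<omega>. complex_of_real (indicator E \<omega>) * cis (s * Z \<omega>) \<partial>M)
        = complex_of_real (prob E * exp (- (s\<^sup>2 * v / 2)))"
  shows "integrable M (\<lambda>\<omega>. indicator E \<omega> * (Z \<omega>)\<^sup>2)"
    and "(\<integral>\<omega>. indicator E \<omega> * (Z \<omega>)\<^sup>2 \<partial>M) = prob E * v"
    and "integrable M (\<lambda>\<omega>. indicator E \<omega> * Z \<omega>)"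
    and "(\<integral>\<omega>. indicator E \<omega> * Z \<omega> \<partial>M) = 0"
proof -
  have [measurable]: "cis \<in> borel_measurable borel" unfolding cis_conv_exp[abs_def] by measurable
  have int: "integrable M (\<lambda>\<omega>. complex_of_real (indicator E \<omega>) * cis (s * Z \<omega>))" for s
    by (rule integrable_const_bound[of _ 1]) (auto simp: norm_mult indicator_def)
  have cos: "(\<integral>\<omega>. indicator E \<omega> * cos (s * Z \<omega>) \<partial>M) = prob E * exp (- (s\<^sup>2 * v / 2))" for s
    using arg_cong[OF cf[of s], of Re] integral_Re[OF int[of s]] by simp
  have sin: "(\<integral>\<omega>. indicator E \<omega> * sin (s * Z \<omega>) \<partial>M) = 0" for s
    using arg_cong[OF cf[of s], of Im] integral_Im[OF int[of s]] by simp
  define S where "S n \<omega> = indicator E \<omega> * (sin (Z \<omega> / real (Suc n)) * real (Suc n))\<^sup>2" for n \<omega>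
  have [measurable]: "S n \<in> borel_measurable M" for n unfolding S_def by measurable
  have S_nonneg: "S n \<omega> \<ge> 0" for n \<omega> by (simp add: S_def)
  have S_int: "integrable M (S n)" for n
  proof (rule integrable_const_bound[of _ "(real (Suc n))\<^sup>2"])
    show "AE \<omega> in M. norm (S n \<omega>) \<le> (real (Suc n))\<^sup>2"
      by (intro AE_I2) (auto simp: S_def indicator_def power_mult_distrib abs_mult power_le_one_iff
          abs_square_le_1 intro!: mult_left_le_one_le)
  qed measurable
  have S_val: "(\<integral>\<omega>. S n \<omega> \<partial>M)
      = prob E * ((1 - exp (- (2 * v) * (1 / real (Suc n))\<^sup>2)) * (real (Suc n))\<^sup>2 / 2)" for n
  proof -
    have "S n \<omega> = (real (Suc n))\<^sup>2 / 2 * (indicator E \<omega> - indicator E \<omega> * cos ((2 / real (Suc n)) * Z \<omega>))" for \<omega>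
    proof -
      have "cos ((2 / real (Suc n)) * Z \<omega>) = 1 - 2 * (sin (Z \<omega> / real (Suc n)))\<^sup>2"
        using cos_double_sin[of "Z \<omega> / real (Suc n)"] by (simp add: mult.commute)
      thus ?thesis unfolding S_def power_mult_distrib by (simp only:) (simp add: algebra_simps del: of_nat_Suc)
    qed
    moreover have "integrable M (\<lambda>\<omega>. indicator E \<omega> * cos ((2 / real (Suc n)) * Z \<omega>))"
      by (rule integrable_const_bound[of _ 1]) (auto simp: indicator_def)
    moreover have "integrable M (indicator E :: _ \<Rightarrow> real)"
      by (rule integrable_real_indicator) (auto simp: less_top[symmetric])
    ultimately have "(\<integral>\<omega>. S n \<omega> \<partial>M)
      = (real (Suc n))\<^sup>2 / 2 * (prob E - prob E * exp (- ((2 / real (Suc n))\<^sup>2 * v / 2)))"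
      by (simp add: cos del: times_divide_eq_left)
    thus ?thesis by (simp add: power_divide algebra_simps)
  qed
  have S_lim: "(\<lambda>n. S n \<omega>) \<longlonglongrightarrow> indicator E \<omega> * (Z \<omega>)\<^sup>2" for \<omega>
    unfolding S_def by (intro tendsto_intros sinc_tendsto)
  have val_lim: "(\<lambda>n. \<integral>\<omega>. S n \<omega> \<partial>M) \<longlonglongrightarrow> prob E * v"
    unfolding S_val by (intro tendsto_intros one_minus_exp_tendsto)
  have S_le: "S n \<omega> \<le> indicator E \<omega> * (Z \<omega>)\<^sup>2" for n \<omega>
  proof -
    have "\<bar>sin (Z \<omega> / real (Suc n)) * real (Suc n)\<bar> \<le> \<bar>Z \<omega> / real (Suc n)\<bar> * real (Suc n)"
      unfolding abs_mult abs_of_nat by (intro mult_right_mono abs_sin_x_le_abs_x) simp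
    hence "(sin (Z \<omega> / real (Suc n)) * real (Suc n))\<^sup>2 \<le> (Z \<omega>)\<^sup>2"
      by (simp add: abs_le_square_iff[symmetric])
    thus ?thesis by (simp add: S_def mult_left_mono)
  qed
  show int2: "integrable M (\<lambda>\<omega>. indicator E \<omega> * (Z \<omega>)\<^sup>2)"
  proof (rule integrableI_bounded)
    have "(\<integral>\<^sup>+\<omega>. ennreal (norm (indicator E \<omega> * (Z \<omega>)\<^sup>2)) \<partial>M) = (\<integral>\<^sup>+\<omega>. liminf (\<lambda>n. ennreal (S n \<omega>)) \<partial>M)"
    proof (rule nn_integral_cong)
      fix \<omega>
      show "ennreal (norm (indicator E \<omega> * (Z \<omega>)\<^sup>2)) = liminf (\<lambda>n. ennreal (S n \<omega>))"
        using lim_imp_Liminf[OF _ tendsto_ennrealI[OF S_lim[of \<omega>]]] by simp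
    qed
    also have "\<dots> \<le> liminf (\<lambda>n. \<integral>\<^sup>+\<omega>. ennreal (S n \<omega>) \<partial>M)"
      by (rule nn_integral_liminf) measurable
    also have "(\<lambda>n. \<integral>\<^sup>+\<omega>. ennreal (S n \<omega>) \<partial>M) = (\<lambda>n. ennreal (\<integral>\<omega>. S n \<omega> \<partial>M))"
      using S_nonneg S_int by (intro ext nn_integral_eq_integral) auto
    also have "liminf \<dots> = ennreal (prob E * v)"
      by (rule lim_imp_Liminf[OF _ tendsto_ennrealI[OF val_lim]]) simp
    finally show "(\<integral>\<^sup>+\<omega>. ennreal (norm (indicator E \<omega> * (Z \<omega>)\<^sup>2)) \<partial>M) < \<infinity>"
      by (rule le_less_trans) simp
  qed measurable
  have "(\<lambda>n. \<integral>\<omega>. S n \<omega> \<partial>M) \<longlonglongrightarrow> (\<integral>\<omega>. indicator E \<omega> * (Z \<omega>)\<^sup>2 \<partial>M)"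
    by (rule integral_dominated_convergence[OF _ _ int2]) (use S_lim S_le S_nonneg in auto)
  thus "(\<integral>\<omega>. indicator E \<omega> * (Z \<omega>)\<^sup>2 \<partial>M) = prob E * v"
    using val_lim LIMSEQ_unique by blast
  show int1: "integrable M (\<lambda>\<omega>. indicator E \<omega> * Z \<omega>)"
  proof (rule Bochner_Integration.integrable_bound)
    show "integrable M (\<lambda>\<omega>. 1 + indicator E \<omega> * (Z \<omega>)\<^sup>2)" using int2 by simp
    have "\<bar>z\<bar> \<le> 1 + z\<^sup>2" for z :: real
      using zero_le_power2[of "\<bar>z\<bar> - 1"] by (simp add: power2_eq_square algebra_simps)
    thus "AE \<omega> in M. norm (indicator E \<omega> * Z \<omega>) \<le> norm (1 + indicator E \<omega> * (Z \<omega>)\<^sup>2)"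
      by (intro AE_I2) (auto simp: indicator_def)
  qed measurable
  have "(\<lambda>n. \<integral>\<omega>. indicator E \<omega> * (sin (Z \<omega> / real (Suc n)) * real (Suc n)) \<partial>M)
      \<longlonglongrightarrow> (\<integral>\<omega>. indicator E \<omega> * Z \<omega> \<partial>M)"
  proof (rule integral_dominated_convergence[where w = "\<lambda>\<omega>. \<bar>indicator E \<omega> * Z \<omega>\<bar>"])
    show "AE \<omega> in M. (\<lambda>n. indicator E \<omega> * (sin (Z \<omega> / real (Suc n)) * real (Suc n))) \<longlonglongrightarrow> indicator E \<omega> * Z \<omega>"
      by (intro AE_I2 tendsto_intros sinc_tendsto)
    show "AE \<omega> in M. norm (indicator E \<omega> * (sin (Z \<omega> / real (Suc n)) * real (Suc n))) \<le> \<bar>indicator E \<omega> * Z \<omega>\<bar>" for n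
    proof (rule AE_I2)
      fix \<omega>
      have "\<bar>sin (Z \<omega> / real (Suc n)) * real (Suc n)\<bar> \<le> \<bar>Z \<omega> / real (Suc n)\<bar> * real (Suc n)"
        unfolding abs_mult abs_of_nat by (intro mult_right_mono abs_sin_x_le_abs_x) simp
      thus "norm (indicator E \<omega> * (sin (Z \<omega> / real (Suc n)) * real (Suc n))) \<le> \<bar>indicator E \<omega> * Z \<omega>\<bar>"
        by (simp add: indicator_def)
    qed
  qed (use int1 in auto)
  moreover have "(\<integral>\<omega>. indicator E \<omega> * (sin (Z \<omega> / real (Suc n)) * real (Suc n)) \<partial>M) = 0" for n
    using sin[of "1 / real (Suc n)"] by (simp add: mult.assoc[symmetric] del: of_nat_Suc)
  ultimately show "(\<integral>\<omega>. indicator E \<omega> * Z \<omega> \<partial>M) = 0"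
    by (simp add: LIMSEQ_const_iff)
qed

section \<open>White noise and the isometry for simple processes\<close>

locale walsh = prob_space M for M :: "'w measure" +
  fixes F :: "real \<Rightarrow> 'w measure" and W :: "(real \<times> (real^'d)) set \<Rightarrow> 'w \<Rightarrow> real"
  assumes noise: "white_noise M F W"
begin

lemma subalg: "subalgebra M (F t)"
  using noise by (simp add: white_noise_def)

lemma space_F: "space (F t) = space M"
  using subalg by (simp add: subalgebra_def)

lemma sets_F: "E \<in> sets (F t) \<Longrightarrow> E \<in> events"
  using subalg by (auto simp: subalgebra_def)

lemma F_mono: "s \<le> t \<Longrightarrow> E \<in> sets (F s) \<Longrightarrow> E \<in> sets (F t)"
  using noise by (auto simp: white_noise_def)

lemma measurable_F: "X \<in> borel_measurable (F t) \<Longrightarrow> X \<in> borel_measurable M"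
  using subalg measurable_from_subalg by blast

lemma measurable_F_mono: "s \<le> t \<Longrightarrow> X \<in> borel_measurable (F s) \<Longrightarrow> X \<in> borel_measurable (F t)"
  by (rule measurable_from_subalg[of "F t" "F s"]) (auto simp: subalgebra_def space_F F_mono)

sublocale F: finite_measure_subalgebra M "F t" for t
  by standard (rule subalg)

lemma W_measurable: "wn_set A \<Longrightarrow> W A \<in> borel_measurable M"
  using noise by (simp add: white_noise_def)

lemma W_adapted: "wn_set A \<Longrightarrow> 0 \<le> t \<Longrightarrow> A \<subseteq> {0..t} \<times> UNIV \<Longrightarrow> W A \<in> borel_measurable (F t)"
  using noise by (simp add: white_noise_def)

definition wn_sum :: "((real \<times> (real^'d)) set \<times> real) list \<Rightarrow> 'w \<Rightarrow> real" where
  "wn_sum L \<omega> = (\<Sum>p\<leftarrow>L. snd p * W (fst p) \<omega>)"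

definition wn_cov :: "((real \<times> (real^'d)) set \<times> real) list \<Rightarrow> real" where
  "wn_cov L = (\<Sum>p\<leftarrow>L. \<Sum>q\<leftarrow>L. snd p * snd q * measure lborel (fst p \<inter> fst q))"

lemma noise_cf:
  "\<forall>p\<in>set L. wn_set (fst p) \<Longrightarrow>
    (\<integral>\<omega>. cis (wn_sum L \<omega>) \<partial>M) = complex_of_real (exp (- (1 / 2) * wn_cov L))"
  unfolding wn_sum_def wn_cov_def wn_cf_def[symmetric]
  using noise[unfolded white_noise_def, THEN conjunct2, THEN conjunct2, THEN conjunct2, THEN conjunct2,
      THEN conjunct1] by (rule allE) (erule mp)

lemma noise_cf_past:
  "\<forall>p\<in>set L. wn_set (fst p) \<and> fst p \<subseteq> {t<..} \<times> UNIV \<Longrightarrow> 0 \<le> t \<Longrightarrow> E \<in> sets (F t) \<Longrightarrow>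
    (\<integral>\<omega>. complex_of_real (indicator E \<omega>) * cis (wn_sum L \<omega>) \<partial>M)
      = complex_of_real (prob E * exp (- (1 / 2) * wn_cov L))"
  unfolding wn_sum_def wn_cov_def wn_cf_def[symmetric]
  using noise[unfolded white_noise_def, THEN conjunct2, THEN conjunct2, THEN conjunct2, THEN conjunct2,
      THEN conjunct2, THEN conjunct2, rule_format, of t L E] by simp

lemma wn_sum_scale: "wn_sum (map (\<lambda>p. (fst p, s * snd p)) L) \<omega> = s * wn_sum L \<omega>"
  by (simp add: wn_sum_def o_def sum_list_const_mult mult.assoc)

lemma wn_cov_scale: "wn_cov (map (\<lambda>p. (fst p, s * snd p)) L) = s\<^sup>2 * wn_cov L"
proof -
  have "wn_cov (map (\<lambda>p. (fst p, s * snd p)) L)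
      = (\<Sum>p\<leftarrow>L. \<Sum>q\<leftarrow>L. s\<^sup>2 * (snd p * snd q * measure lborel (fst p \<inter> fst q)))"
    by (simp add: wn_cov_def o_def power2_eq_square mult_ac)
  thus ?thesis by (simp add: wn_cov_def sum_list_const_mult)
qed

lemma wn_sum_measurable:
  assumes "\<forall>p\<in>set L. wn_set (fst p)"
  shows "wn_sum L \<in> borel_measurable M"
  using assms
proof (induction L)
  case (Cons p L)
  hence [measurable]: "wn_sum L \<in> borel_measurable M" "W (fst p) \<in> borel_measurable M"
    by (auto intro: W_measurable)
  have "wn_sum (p # L) = (\<lambda>\<omega>. snd p * W (fst p) \<omega> + wn_sum L \<omega>)"
    by (simp add: wn_sum_def fun_eq_iff)
  thus ?case by simp
qed (simp add: wn_sum_def[abs_def])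

text \<open>Scaling all coefficients by s turns the joint characteristic function into that of a
  single Gaussian variable on the event E of the past, with variance
  \<open>wn_cov L\<close>.\<close>

lemma wn_sum_moments:
  assumes L: "\<forall>p\<in>set L. wn_set (fst p) \<and> fst p \<subseteq> {t<..} \<times> UNIV" and t: "0 \<le> t" and E: "E \<in> sets (F t)"
  shows "integrable M (\<lambda>\<omega>. indicator E \<omega> * (wn_sum L \<omega>)\<^sup>2)"
    and "(\<integral>\<omega>. indicator E \<omega> * (wn_sum L \<omega>)\<^sup>2 \<partial>M) = prob E * wn_cov L"
    and "integrable M (\<lambda>\<omega>. indicator E \<omega> * wn_sum L \<omega>)"
    and "(\<integral>\<omega>. indicator E \<omega> * wn_sum L \<omega> \<partial>M) = 0"
proof -
  have cf: "(\<integral>\<omega>. complex_of_real (indicator E \<omega>) * cis (s * wn_sum L \<omega>) \<partial>M)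
        = complex_of_real (prob E * exp (- (s\<^sup>2 * wn_cov L / 2)))" for s
  proof -
    let ?L = "map (\<lambda>p. (fst p, s * snd p)) L"
    have "(\<integral>\<omega>. complex_of_real (indicator E \<omega>) * cis (wn_sum ?L \<omega>) \<partial>M)
        = complex_of_real (prob E * exp (- (1 / 2) * wn_cov ?L))"
      using L t E by (intro noise_cf_past) auto
    thus ?thesis unfolding wn_sum_scale wn_cov_scale by simp
  qed
  have *: "random_variable borel (wn_sum L)" using L by (intro wn_sum_measurable) auto
  note m = gaussian_moments[OF sets_F[OF E] * cf]
  show "integrable M (\<lambda>\<omega>. indicator E \<omega> * (wn_sum L \<omega>)\<^sup>2)"
    "(\<integral>\<omega>. indicator E \<omega> * (wn_sum L \<omega>)\<^sup>2 \<partial>M) = prob E * wn_cov L"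
    "integrable M (\<lambda>\<omega>. indicator E \<omega> * wn_sum L \<omega>)"
    "(\<integral>\<omega>. indicator E \<omega> * wn_sum L \<omega> \<partial>M) = 0"
    by (fact m)+
qed

text \<open>The unconditional counterpart of \<open>wn_sum_moments\<close>: the sets need not lie
  after a common time, so the plain characteristic function is used, with the whole space as
  event.\<close>

lemma wn_sum_power2:
  assumes L: "\<forall>p\<in>set L. wn_set (fst p)"
  shows "integrable M (\<lambda>\<omega>. (wn_sum L \<omega>)\<^sup>2)" and "(\<integral>\<omega>. (wn_sum L \<omega>)\<^sup>2 \<partial>M) = wn_cov L"
proof -
  have cf: "(\<integral>\<omega>. complex_of_real (indicator (space M) \<omega>) * cis (s * wn_sum L \<omega>) \<partial>M)
        = complex_of_real (prob (space M) * exp (- (s\<^sup>2 * wn_cov L / 2)))" for s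
  proof -
    let ?L = "map (\<lambda>p. (fst p, s * snd p)) L"
    have "(\<integral>\<omega>. cis (wn_sum ?L \<omega>) \<partial>M) = complex_of_real (exp (- (1 / 2) * wn_cov ?L))"
      using L by (intro noise_cf) auto
    moreover have "(\<integral>\<omega>. complex_of_real (indicator (space M) \<omega>) * cis (s * wn_sum L \<omega>) \<partial>M)
        = (\<integral>\<omega>. cis (s * wn_sum L \<omega>) \<partial>M)"
      by (intro Bochner_Integration.integral_cong) auto
    ultimately show ?thesis unfolding wn_sum_scale wn_cov_scale by (simp add: prob_space)
  qed
  note m = gaussian_moments[OF sets.top wn_sum_measurable[OF L] cf]
  have eq: "integrable M (\<lambda>\<omega>. indicator (space M) \<omega> * (wn_sum L \<omega>)\<^sup>2) = integrable M (\<lambda>\<omega>. (wn_sum L \<omega>)\<^sup>2)"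
    "(\<integral>\<omega>. indicator (space M) \<omega> * (wn_sum L \<omega>)\<^sup>2 \<partial>M) = (\<integral>\<omega>. (wn_sum L \<omega>)\<^sup>2 \<partial>M)"
    by (intro Bochner_Integration.integrable_cong Bochner_Integration.integral_cong; simp)+
  show "integrable M (\<lambda>\<omega>. (wn_sum L \<omega>)\<^sup>2)" "(\<integral>\<omega>. (wn_sum L \<omega>)\<^sup>2 \<partial>M) = wn_cov L"
    using m(1,2) unfolding eq by (simp_all add: prob_space)
qed

lemma W_power2_integrable: "wn_set A \<Longrightarrow> integrable M (\<lambda>\<omega>. (W A \<omega>)\<^sup>2)"
  using wn_sum_power2(1)[of "[(A, 1)]"] by (simp add: wn_sum_def)

text \<open>Only the joint law of the noise is given. Additivity follows because
  \<open>W (A \<union> B) - W A - W B\<close> has variance 0, which also explains why it holds only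
  almost surely for each pair.\<close>

lemma W_additive:
  assumes A: "wn_set A" and B: "wn_set B" and disj: "A \<inter> B = {}"
  shows "AE \<omega> in M. W (A \<union> B) \<omega> = W A \<omega> + W B \<omega>"
proof -
  let ?L = "[(A \<union> B, 1), (A, - 1), (B, - 1)]"
  have fin: "emeasure lborel A \<noteq> \<infinity>" "emeasure lborel B \<noteq> \<infinity>"
    using A B by (auto simp: wn_set_def)
  have sets: "A \<in> sets lborel" "B \<in> sets lborel" using A B by (auto simp: wn_set_def)
  have "emeasure lborel (A \<union> B) \<le> emeasure lborel A + emeasure lborel B"
    using sets by (rule emeasure_subadditive)
  also have "\<dots> < \<infinity>" using fin by (simp add: less_top)
  finally have AB: "wn_set (A \<union> B)" using A B by (auto simp: wn_set_def)
  have L: "\<forall>p\<in>set ?L. wn_set (fst p)" using A B AB by auto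
  have meas: "measure lborel (A \<union> B) = measure lborel A + measure lborel B"
    using fin sets disj by (intro measure_Union) auto
  have inter: "(A \<union> B) \<inter> A = A" "(A \<union> B) \<inter> B = B" "A \<inter> (A \<union> B) = A" "B \<inter> (A \<union> B) = B"
    "B \<inter> A = {}" using disj by auto
  have "wn_cov ?L = 0" by (simp add: wn_cov_def inter disj meas)
  hence "(\<integral>\<omega>. (wn_sum ?L \<omega>)\<^sup>2 \<partial>M) = 0" using wn_sum_power2(2)[OF L] by simp
  hence "AE \<omega> in M. (wn_sum ?L \<omega>)\<^sup>2 = 0"
    using wn_sum_power2(1)[OF L] by (subst (asm) integral_nonneg_eq_0_iff_AE) auto
  thus ?thesis by eventually_elim (simp add: wn_sum_def)
qed

text \<open>Polarisation of the second moments.\<close>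

lemma W_prod_indicator:
  assumes A: "wn_set A" "A \<subseteq> {t<..} \<times> UNIV" and B: "wn_set B" "B \<subseteq> {t<..} \<times> UNIV"
    and t: "0 \<le> t" and E: "E \<in> sets (F t)"
  shows "integrable M (\<lambda>\<omega>. indicator E \<omega> * (W A \<omega> * W B \<omega>))"
    and "(\<integral>\<omega>. indicator E \<omega> * (W A \<omega> * W B \<omega>) \<partial>M) = prob E * measure lborel (A \<inter> B)"
proof -
  have AB: "\<forall>p\<in>set [(A, 1), (B, 1)]. wn_set (fst p) \<and> fst p \<subseteq> {t<..} \<times> UNIV" using A B by auto
  have A1: "\<forall>p\<in>set [(A, 1)]. wn_set (fst p) \<and> fst p \<subseteq> {t<..} \<times> UNIV" using A by auto
  have B1: "\<forall>p\<in>set [(B, 1)]. wn_set (fst p) \<and> fst p \<subseteq> {t<..} \<times> UNIV" using B by auto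
  note ab = wn_sum_moments(1,2)[OF AB t E] and a = wn_sum_moments(1,2)[OF A1 t E]
    and b = wn_sum_moments(1,2)[OF B1 t E]
  have eq: "indicator E \<omega> * (W A \<omega> * W B \<omega>)
      = (indicator E \<omega> * (wn_sum [(A, 1), (B, 1)] \<omega>)\<^sup>2
         - indicator E \<omega> * (wn_sum [(A, 1)] \<omega>)\<^sup>2 - indicator E \<omega> * (wn_sum [(B, 1)] \<omega>)\<^sup>2) / 2" for \<omega>
    by (simp add: wn_sum_def power2_eq_square algebra_simps)
  show "integrable M (\<lambda>\<omega>. indicator E \<omega> * (W A \<omega> * W B \<omega>))"
    unfolding eq using ab a b by (intro Bochner_Integration.integrable_divide Bochner_Integration.integrable_diff)
  show "(\<integral>\<omega>. indicator E \<omega> * (W A \<omega> * W B \<omega>) \<partial>M) = prob E * measure lborel (A \<inter> B)"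
    unfolding eq using ab a b
    by (simp add: wn_cov_def Int_commute[of B A] algebra_simps)
qed

text \<open>Given \<open>F t\<close>, the product of two later increments has the constant
  conditional expectation \<open>measure lborel (A \<inter> B)\<close>; an
  \<open>F t\<close>-measurable factor can then be taken out.\<close>

lemma W_prod_conditional:
  assumes A: "wn_set A" "A \<subseteq> {t<..} \<times> UNIV" and B: "wn_set B" "B \<subseteq> {t<..} \<times> UNIV" and t: "0 \<le> t"
    and Y: "Y \<in> borel_measurable (F t)" "integrable M (\<lambda>\<omega>. Y \<omega> * (W A \<omega> * W B \<omega>))"
  shows "(\<integral>\<omega>. Y \<omega> * (W A \<omega> * W B \<omega>) \<partial>M) = (\<integral>\<omega>. Y \<omega> \<partial>M) * measure lborel (A \<inter> B)"
proof -
  let ?Z = "\<lambda>\<omega>. W A \<omega> * W B \<omega>" and ?c = "measure lborel (A \<inter> B)"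
  have [measurable]: "W A \<in> borel_measurable M" "W B \<in> borel_measurable M"
    using A B by (auto intro: W_measurable)
  have "space M \<in> sets (F t)" using sets.top[of "F t"] by (simp add: space_F)
  from W_prod_indicator(1)[OF A B t this] have Z: "integrable M ?Z"
    by (rule Bochner_Integration.integrable_cong[THEN iffD1, rotated 2]) auto
  have "AE \<omega> in M. real_cond_exp M (F t) ?Z \<omega> = ?c"
  proof (rule F.real_cond_exp_charact)
    fix E assume E: "E \<in> sets (F t)"
    have "(\<integral>\<omega>\<in>E. ?Z \<omega> \<partial>M) = prob E * ?c"
      using W_prod_indicator(2)[OF A B t E] by (simp add: set_lebesgue_integral_def)
    also have "\<dots> = (\<integral>\<omega>\<in>E. ?c \<partial>M)"
      using sets_F[OF E] by (simp add: set_lebesgue_integral_def)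
    finally show "(\<integral>\<omega>\<in>E. ?Z \<omega> \<partial>M) = (\<integral>\<omega>\<in>E. ?c \<partial>M)" .
  qed (use Z in auto)
  hence "(\<integral>\<omega>. Y \<omega> * real_cond_exp M (F t) ?Z \<omega> \<partial>M) = (\<integral>\<omega>. Y \<omega> * ?c \<partial>M)"
    using measurable_F[OF Y(1)] by (intro integral_cong_AE) auto
  thus ?thesis using F.real_cond_exp_intg(2)[OF Y(2) Y(1)] by simp
qed

lemma W_conditional_0:
  assumes A: "wn_set A" "A \<subseteq> {t<..} \<times> UNIV" and t: "0 \<le> t"
    and Y: "Y \<in> borel_measurable (F t)" "integrable M (\<lambda>\<omega>. Y \<omega> * W A \<omega>)"
  shows "(\<integral>\<omega>. Y \<omega> * W A \<omega> \<partial>M) = 0"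
proof -
  have [measurable]: "W A \<in> borel_measurable M" using A by (auto intro: W_measurable)
  have A1: "\<forall>p\<in>set [(A, 1)]. wn_set (fst p) \<and> fst p \<subseteq> {t<..} \<times> UNIV" using A by auto
  have "space M \<in> sets (F t)" using sets.top[of "F t"] by (simp add: space_F)
  from wn_sum_moments(3)[OF A1 t this] have Z: "integrable M (W A)"
    by (rule Bochner_Integration.integrable_cong[THEN iffD1, rotated 2]) (auto simp: wn_sum_def)
  have "AE \<omega> in M. real_cond_exp M (F t) (W A) \<omega> = 0"
  proof (rule F.real_cond_exp_charact)
    fix E assume E: "E \<in> sets (F t)"
    show "(\<integral>\<omega>\<in>E. W A \<omega> \<partial>M) = (\<integral>\<omega>\<in>E. 0 \<partial>M)"
      using wn_sum_moments(4)[OF A1 t E] by (simp add: set_lebesgue_integral_def wn_sum_def)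
  qed (use Z in auto)
  hence "(\<integral>\<omega>. Y \<omega> * real_cond_exp M (F t) (W A) \<omega> \<partial>M) = (\<integral>\<omega>. 0 \<partial>M)"
    using measurable_F[OF Y(1)] by (intro integral_cong_AE) auto
  thus ?thesis using F.real_cond_exp_intg(2)[OF Y(2) Y(1)] by simp
qed

section \<open>Orthogonality of increments over space-time slabs\<close>

lemma wn_set_slab:
  assumes "0 \<le> a" "A \<in> sets lborel" "emeasure lborel A < \<infinity>"
  shows "wn_set ({a<..b} \<times> A)"
proof -
  have "emeasure lborel ({a<..b} \<times> A) = emeasure lborel {a<..b} * emeasure lborel A"
    unfolding lborel_prod[symmetric] using assms
    by (intro lborel.emeasure_pair_measure_Times) auto
  also have "emeasure lborel {a<..b} < \<infinity>" by (cases "a \<le> b") auto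
  hence "emeasure lborel {a<..b} * emeasure lborel A < \<infinity>" using assms by (simp add: ennreal_mult_less_top)
  finally have "emeasure lborel ({a<..b} \<times> A) < \<infinity>" .
  moreover have "{a<..b} \<times> A \<in> sets (lborel \<Otimes>\<^sub>M lborel)" using assms by (intro pair_measureI) auto
  hence "{a<..b} \<times> A \<in> sets lborel" unfolding lborel_prod .
  ultimately show ?thesis using assms by (auto simp: wn_set_def)
qed

lemma integrable_bounded_mult:
  assumes X: "X \<in> borel_measurable M" "\<And>\<omega>. \<bar>X \<omega>\<bar> \<le> C" and Z: "integrable M Z"
  shows "integrable M (\<lambda>\<omega>. X \<omega> * Z \<omega> :: real)"
proof (rule Bochner_Integration.integrable_bound)
  show "integrable M (\<lambda>\<omega>. C * Z \<omega>)" using Z by simp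
  have "0 \<le> C" using X(2) abs_ge_zero order_trans by blast
  thus "AE \<omega> in M. norm (X \<omega> * Z \<omega>) \<le> norm (C * Z \<omega>)"
    using X(2) by (intro AE_I2) (auto simp: abs_mult intro!: mult_right_mono)
qed (use X Z in auto)

lemma W_mult_integrable:
  assumes A: "wn_set A" and B: "wn_set B"
  shows "integrable M (\<lambda>\<omega>. W A \<omega> * W B \<omega>)"
proof (rule Bochner_Integration.integrable_bound)
  have [measurable]: "W A \<in> borel_measurable M" "W B \<in> borel_measurable M"
    using A B by (auto intro: W_measurable)
  show "integrable M (\<lambda>\<omega>. (W A \<omega>)\<^sup>2 + (W B \<omega>)\<^sup>2)"
    using A B by (intro Bochner_Integration.integrable_add W_power2_integrable)
  have "\<bar>x * y\<bar> \<le> x\<^sup>2 + y\<^sup>2" for x y :: real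
  proof -
    have "2 * (\<bar>x\<bar> * \<bar>y\<bar>) \<le> x\<^sup>2 + y\<^sup>2"
      using zero_le_power2[of "\<bar>x\<bar> - \<bar>y\<bar>"] by (simp add: power2_diff mult.assoc)
    moreover have "0 \<le> \<bar>x\<bar> * \<bar>y\<bar>" by simp
    ultimately show ?thesis unfolding abs_mult by linarith
  qed
  thus "AE \<omega> in M. norm (W A \<omega> * W B \<omega>) \<le> norm ((W A \<omega>)\<^sup>2 + (W B \<omega>)\<^sup>2)"
    by (intro AE_I2) auto
  show "(\<lambda>\<omega>. W A \<omega> * W B \<omega>) \<in> borel_measurable M" by measurable
qed

text \<open>Condition at the later of the two starting times. The slab that starts earlier is split
  there: its first part belongs to the past and is orthogonal to the other increment, its second
  part contributes the measure of the intersection.\<close>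

lemma W_slab_prod:
  fixes b b' :: real
  assumes X: "X \<in> borel_measurable (F a)" "\<And>\<omega>. \<bar>X \<omega>\<bar> \<le> C"
    and Y: "Y \<in> borel_measurable (F a')" "\<And>\<omega>. \<bar>Y \<omega>\<bar> \<le> C'"
    and a: "0 \<le> a" "0 \<le> a'" and A: "A \<in> sets lborel" "emeasure lborel A < \<infinity>"
    and A': "A' \<in> sets lborel" "emeasure lborel A' < \<infinity>"
  defines "R \<equiv> {a<..b} \<times> A" and "R' \<equiv> {a'<..b'} \<times> A'"
  shows "integrable M (\<lambda>\<omega>. (X \<omega> * W R \<omega>) * (Y \<omega> * W R' \<omega>))"
    and "(\<integral>\<omega>. (X \<omega> * W R \<omega>) * (Y \<omega> * W R' \<omega>) \<partial>M) = (\<integral>\<omega>. X \<omega> * Y \<omega> \<partial>M) * measure lborel (R \<inter> R')"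
proof -
  have R: "wn_set R" "wn_set R'" unfolding R_def R'_def using a A A' by (auto intro: wn_set_slab)
  have XM: "X \<in> borel_measurable M" and YM: "Y \<in> borel_measurable M"
    using X Y by (auto intro: measurable_F)
  have bd: "\<bar>X \<omega> * Y \<omega>\<bar> \<le> C * C'" for \<omega>
    unfolding abs_mult using X(2)[of \<omega>] Y(2)[of \<omega>] by (intro mult_mono) auto
  have XYM: "(\<lambda>\<omega>. X \<omega> * Y \<omega>) \<in> borel_measurable M" using XM YM by simp
  have "integrable M (\<lambda>\<omega>. X \<omega> * Y \<omega> * (W R \<omega> * W R' \<omega>))"
    by (rule integrable_bounded_mult[OF XYM bd W_mult_integrable[OF R]])
  thus "integrable M (\<lambda>\<omega>. (X \<omega> * W R \<omega>) * (Y \<omega> * W R' \<omega>))" by (simp add: mult_ac)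
  \<comment> \<open>Stated with fresh variables so that the case \<open>a' < a\<close> follows by
    exchanging the roles of the two slabs.\<close>
  have main: "(\<integral>\<omega>. X \<omega> * Y \<omega> * (W ({a<..b} \<times> A) \<omega> * W ({a'<..b'} \<times> A') \<omega>) \<partial>M)
      = (\<integral>\<omega>. X \<omega> * Y \<omega> \<partial>M) * measure lborel (({a<..b} \<times> A) \<inter> ({a'<..b'} \<times> A'))"
    if le: "a \<le> a'" and X: "X \<in> borel_measurable (F a)" and Y: "Y \<in> borel_measurable (F a')"
      and bd: "\<And>\<omega>. \<bar>X \<omega> * Y \<omega>\<bar> \<le> C"
      and a: "0 \<le> a" "0 \<le> a'" and A: "A \<in> sets lborel" "emeasure lborel A < \<infinity>"
      and A': "A' \<in> sets lborel" "emeasure lborel A' < \<infinity>"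
    for a a' b b' X Y A A' C
  proof -
    \<comment> \<open>The minimum also covers \<open>b \<le> a'\<close>, when the first slab ends
      before the second begins and \<open>R2\<close> is empty.\<close>
    define R1 where "R1 = {a<..min b a'} \<times> A"
    define R2 where "R2 = {a'<..b} \<times> A"
    define R where "R = {a<..b} \<times> A"
    define R' where "R' = {a'<..b'} \<times> A'"
    have wn: "wn_set R1" "wn_set R2" "wn_set R" "wn_set R'" unfolding R1_def R2_def R'_def R_def
      using a A A' by (auto intro: wn_set_slab)
    have un: "R = R1 \<union> R2" unfolding R1_def R2_def R_def using le by auto
    have "R1 \<inter> R2 = {}" unfolding R1_def R2_def by auto
    from W_additive[OF wn(1,2) this] have split: "AE \<omega> in M. W R \<omega> = W R1 \<omega> + W R2 \<omega>"
      by (simp add: un)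
    have [measurable]: "W R1 \<in> borel_measurable M" "W R2 \<in> borel_measurable M" "W R \<in> borel_measurable M"
        "W R' \<in> borel_measurable M" by (auto intro: W_measurable wn)
    have [measurable]: "X \<in> borel_measurable (F a')" "Y \<in> borel_measurable (F a')"
      using measurable_F_mono[OF le X] Y by auto
    have XY: "(\<lambda>\<omega>. X \<omega> * Y \<omega>) \<in> borel_measurable (F a')" by measurable
    have [measurable]: "(\<lambda>\<omega>. X \<omega> * Y \<omega>) \<in> borel_measurable M" by (rule measurable_F[OF XY])
    have W1: "W R1 \<in> borel_measurable (F a')"
      using a le wn by (intro W_adapted) (auto simp: R1_def)
    hence XYW1: "(\<lambda>\<omega>. X \<omega> * Y \<omega> * W R1 \<omega>) \<in> borel_measurable (F a')" using XY by measurable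
    have R'_sub: "R' \<subseteq> {a'<..} \<times> UNIV" "R2 \<subseteq> {a'<..} \<times> UNIV" by (auto simp: R'_def R2_def)
    have i1: "integrable M (\<lambda>\<omega>. X \<omega> * Y \<omega> * (W R1 \<omega> * W R' \<omega>))"
      by (rule integrable_bounded_mult[OF _ bd W_mult_integrable[OF wn(1,4)]]) measurable
    have i2: "integrable M (\<lambda>\<omega>. X \<omega> * Y \<omega> * (W R2 \<omega> * W R' \<omega>))"
      by (rule integrable_bounded_mult[OF _ bd W_mult_integrable[OF wn(2,4)]]) measurable
    have "(\<integral>\<omega>. X \<omega> * Y \<omega> * (W R \<omega> * W R' \<omega>) \<partial>M)
        = (\<integral>\<omega>. X \<omega> * Y \<omega> * (W R1 \<omega> * W R' \<omega>) + X \<omega> * Y \<omega> * (W R2 \<omega> * W R' \<omega>) \<partial>M)"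
    proof (rule integral_cong_AE)
      show "AE \<omega> in M. X \<omega> * Y \<omega> * (W R \<omega> * W R' \<omega>)
          = X \<omega> * Y \<omega> * (W R1 \<omega> * W R' \<omega>) + X \<omega> * Y \<omega> * (W R2 \<omega> * W R' \<omega>)"
        using split by eventually_elim (simp add: algebra_simps)
    qed measurable
    also have "\<dots> = (\<integral>\<omega>. X \<omega> * Y \<omega> * (W R1 \<omega> * W R' \<omega>) \<partial>M) + (\<integral>\<omega>. X \<omega> * Y \<omega> * (W R2 \<omega> * W R' \<omega>) \<partial>M)"
      using i1 i2 by simp
    also have "(\<integral>\<omega>. X \<omega> * Y \<omega> * (W R1 \<omega> * W R' \<omega>) \<partial>M) = 0"
      using W_conditional_0[OF wn(4) R'_sub(1) a(2) XYW1] i1 by (simp add: mult.assoc)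
    also have "(\<integral>\<omega>. X \<omega> * Y \<omega> * (W R2 \<omega> * W R' \<omega>) \<partial>M) = (\<integral>\<omega>. X \<omega> * Y \<omega> \<partial>M) * measure lborel (R2 \<inter> R')"
      by (rule W_prod_conditional[OF wn(2) R'_sub(2) wn(4) R'_sub(1) a(2) XY i2])
    also have "R2 \<inter> R' = R \<inter> R'" using le by (auto simp: R2_def R_def R'_def)
    finally show ?thesis by (simp add: R_def R'_def)
  qed
  have "(\<integral>\<omega>. X \<omega> * Y \<omega> * (W R \<omega> * W R' \<omega>) \<partial>M) = (\<integral>\<omega>. X \<omega> * Y \<omega> \<partial>M) * measure lborel (R \<inter> R')"
  proof (cases "a \<le> a'")
    case True
    show ?thesis unfolding R_def R'_def
      by (rule main[OF True X(1) Y(1) bd a A A'])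
  next
    case False
    hence le: "a' \<le> a" by simp
    have bd': "\<bar>Y \<omega> * X \<omega>\<bar> \<le> C * C'" for \<omega> using bd[of \<omega>] by (simp add: mult.commute)
    show ?thesis unfolding R_def R'_def
      using main[OF le Y(1) X(1) bd' a(2,1) A' A, of b' b] by (simp add: mult_ac Int_commute)
  qed
  thus "(\<integral>\<omega>. (X \<omega> * W R \<omega>) * (Y \<omega> * W R' \<omega>) \<partial>M) = (\<integral>\<omega>. X \<omega> * Y \<omega> \<partial>M) * measure lborel (R \<inter> R')"
    by (simp add: mult_ac)
qed

section \<open>The space of square-integrable integrands\<close>

abbreviation times_pos :: "(real \<times> (real^'d)) set" where
  "times_pos \<equiv> {0<..} \<times> UNIV"

sublocale Q: pair_sigma_finite "lborel :: (real \<times> (real^'d)) measure" M ..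

lemma times_pos_sets [measurable]: "times_pos \<in> sets borel"
  by (intro borel_open open_Times) auto

text \<open>Integrands are only relevant at positive times: \<open>{0} \<times> \<real>\<^sup>d\<close> is a null set.\<close>
definition ito_measurable :: "(real \<times> (real^'d) \<Rightarrow> 'w \<Rightarrow> real) \<Rightarrow> bool" where
  "ito_measurable f \<longleftrightarrow>
     (\<lambda>p. indicator times_pos (fst p) * f (fst p) (snd p)) \<in> borel_measurable (lborel \<Otimes>\<^sub>M M)"

text \<open>This is the square of an L2 norm on space-time times probability; hence the factors 2 in
  \<open>ito_norm_add\<close> and \<open>ito_norm_triangle\<close>.\<close>

definition ito_norm :: "(real \<times> (real^'d) \<Rightarrow> 'w \<Rightarrow> real) \<Rightarrow> ennreal" where
  "ito_norm f = (\<integral>\<^sup>+p. ennreal ((indicator times_pos (fst p) * f (fst p) (snd p))\<^sup>2) \<partial>(lborel \<Otimes>\<^sub>M M))"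

lemma slab_borel: "A \<in> sets lborel \<Longrightarrow> T \<in> sets borel \<Longrightarrow> T \<times> A \<in> sets (borel :: (real \<times> (real^'d)) measure)"
  unfolding borel_prod[symmetric] by (intro pair_measureI) auto

lemma AE_times_pos: "AE z in (lborel :: (real \<times> (real^'d)) measure). fst z \<noteq> 0"
proof -
  have "emeasure (lborel \<Otimes>\<^sub>M lborel) ({0::real} \<times> (UNIV :: (real^'d) set)) = 0"
    by (subst lborel.emeasure_pair_measure_Times) auto
  hence "({0::real} \<times> (UNIV :: (real^'d) set)) \<in> null_sets lborel"
    by (simp add: null_sets_def lborel_prod slab_borel)
  from AE_not_in[OF this] show ?thesis by eventually_elim (auto simp: mem_Times_iff)
qed

lemma ito_norm_alt:
  assumes f: "ito_measurable f"
  shows "(\<integral>\<^sup>+\<omega>. (\<integral>\<^sup>+z. ennreal ((f z \<omega>)\<^sup>2) * indicator ({0..} \<times> UNIV) z \<partial>lborel) \<partial>M) = ito_norm f"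
proof -
  have "(\<integral>\<^sup>+\<omega>. (\<integral>\<^sup>+z. ennreal ((f z \<omega>)\<^sup>2) * indicator ({0..} \<times> UNIV) z \<partial>lborel) \<partial>M)
      = (\<integral>\<^sup>+\<omega>. (\<integral>\<^sup>+z. ennreal ((indicator times_pos z * f z \<omega>)\<^sup>2) \<partial>lborel) \<partial>M)"
  proof (rule nn_integral_cong)
    fix \<omega>
    show "(\<integral>\<^sup>+z. ennreal ((f z \<omega>)\<^sup>2) * indicator ({0..} \<times> UNIV) z \<partial>lborel)
        = (\<integral>\<^sup>+z. ennreal ((indicator times_pos z * f z \<omega>)\<^sup>2) \<partial>lborel)"
      by (rule nn_integral_cong_AE, use AE_times_pos in eventually_elim)
        (auto simp: indicator_def mem_Times_iff)
  qed
  also have "\<dots> = ito_norm f"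
    unfolding ito_norm_def
    using f[unfolded ito_measurable_def]
    by (subst Q.nn_integral_snd[symmetric]) auto
  finally show ?thesis .
qed

lemma ito_norm_alt':
  assumes f: "ito_measurable f"
  shows "ito_norm f = (\<integral>\<^sup>+z. (\<integral>\<^sup>+\<omega>. ennreal ((f z \<omega>)\<^sup>2) \<partial>M) * indicator times_pos z \<partial>lborel)"
proof -
  have "ito_norm f = (\<integral>\<^sup>+z. (\<integral>\<^sup>+\<omega>. ennreal ((indicator times_pos z * f z \<omega>)\<^sup>2) \<partial>M) \<partial>lborel)"
    unfolding ito_norm_def using f[unfolded ito_measurable_def]
    by (subst nn_integral_fst[symmetric]) auto
  also have "\<dots> = (\<integral>\<^sup>+z. (\<integral>\<^sup>+\<omega>. ennreal ((f z \<omega>)\<^sup>2) \<partial>M) * indicator times_pos z \<partial>lborel)"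
    by (intro nn_integral_cong) (auto simp: indicator_def)
  finally show ?thesis .
qed

lemma ito_cong:
  assumes "\<And>z \<omega>. z \<in> times_pos \<Longrightarrow> \<omega> \<in> space M \<Longrightarrow> f z \<omega> = g z \<omega>"
  shows "ito_measurable f = ito_measurable g" "ito_norm f = ito_norm g"
proof -
  have eq: "indicator times_pos (fst p) * f (fst p) (snd p) = indicator times_pos (fst p) * g (fst p) (snd p)"
    if "p \<in> space (lborel \<Otimes>\<^sub>M M)" for p :: "(real \<times> (real^'d)) \<times> 'w"
    using assms[of "fst p" "snd p"] that by (auto simp: indicator_def space_pair_measure)
  show "ito_measurable f = ito_measurable g" unfolding ito_measurable_def
    by (intro measurable_cong eq)
  show "ito_norm f = ito_norm g" unfolding ito_norm_def
    by (intro nn_integral_cong) (simp add: eq)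
qed

lemma ito_norm_mono:
  assumes "\<And>z \<omega>. z \<in> times_pos \<Longrightarrow> \<omega> \<in> space M \<Longrightarrow> \<bar>f z \<omega>\<bar> \<le> \<bar>g z \<omega>\<bar>"
  shows "ito_norm f \<le> ito_norm g"
  unfolding ito_norm_def
proof (intro nn_integral_mono ennreal_leI)
  fix p :: "(real \<times> (real^'d)) \<times> 'w" assume "p \<in> space (lborel \<Otimes>\<^sub>M M)"
  hence "\<bar>indicator times_pos (fst p) * f (fst p) (snd p)\<bar> \<le> \<bar>indicator times_pos (fst p) * g (fst p) (snd p)\<bar>"
    using assms[of "fst p" "snd p"] by (auto simp: indicator_def space_pair_measure)
  thus "(indicator times_pos (fst p) * f (fst p) (snd p))\<^sup>2 \<le> (indicator times_pos (fst p) * g (fst p) (snd p))\<^sup>2"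
    by (simp add: abs_le_square_iff)
qed

lemma ito_measurable_add: "ito_measurable f \<Longrightarrow> ito_measurable g \<Longrightarrow> ito_measurable (\<lambda>z \<omega>. f z \<omega> + g z \<omega>)"
  and ito_measurable_diff: "ito_measurable f \<Longrightarrow> ito_measurable g \<Longrightarrow> ito_measurable (\<lambda>z \<omega>. f z \<omega> - g z \<omega>)"
  and ito_measurable_cmult: "ito_measurable f \<Longrightarrow> ito_measurable (\<lambda>z \<omega>. c * f z \<omega>)"
  unfolding ito_measurable_def distrib_left right_diff_distrib
  by (simp_all add: mult.left_commute[of _ c])

lemma ito_norm_add:
  assumes "ito_measurable f" "ito_measurable g"
  shows "ito_norm (\<lambda>z \<omega>. f z \<omega> + g z \<omega>) \<le> 2 * ito_norm f + 2 * ito_norm g"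
  using nn_integral_add_power2_le[OF assms[unfolded ito_measurable_def]]
  by (simp add: ito_norm_def distrib_left)

lemma ito_norm_diff_commute: "ito_norm (\<lambda>z \<omega>. f z \<omega> - g z \<omega>) = ito_norm (\<lambda>z \<omega>. g z \<omega> - f z \<omega>)"
  unfolding ito_norm_def right_diff_distrib by (subst power2_commute) (rule refl)

lemma ito_norm_triangle:
  assumes "ito_measurable f" "ito_measurable g" "ito_measurable h"
  shows "ito_norm (\<lambda>z \<omega>. f z \<omega> - g z \<omega>)
    \<le> 2 * ito_norm (\<lambda>z \<omega>. f z \<omega> - h z \<omega>) + 2 * ito_norm (\<lambda>z \<omega>. h z \<omega> - g z \<omega>)"
  using ito_norm_add[OF ito_measurable_diff[OF assms(1,3)] ito_measurable_diff[OF assms(3,2)]] by simp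

section \<open>The predictable sigma-algebra\<close>

lemma space_predictable: "space (predictable M F) = ({0..} \<times> UNIV) \<times> space M"
  unfolding predictable_def by (rule space_measure_of) (auto dest!: sets.sets_into_space simp: space_F)

definition pred_rects :: "((real \<times> (real^'d)) \<times> 'w) set set" where
  "pred_rects = {({a<..b} \<times> A) \<times> E | a b A E. 0 \<le> a \<and> a < b \<and> A \<in> sets (lborel :: (real^'d) measure)
      \<and> E \<in> sets (F a)} \<union> {({0} \<times> A) \<times> E | A E. A \<in> sets (lborel :: (real^'d) measure) \<and> E \<in> sets (F 0)}"

lemma pred_rects_Pow: "pred_rects \<subseteq> Pow (({0..} \<times> UNIV) \<times> space M)"
  unfolding pred_rects_def by (auto dest!: sets.sets_into_space simp: space_F)

lemma sets_predictable: "sets (predictable M F) = sigma_sets (({0..} \<times> UNIV) \<times> space M) pred_rects"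
  unfolding predictable_def pred_rects_def[symmetric] by (rule sets_measure_of[OF pred_rects_Pow])

lemma predictable_sets_subset:
  fixes P :: "((real \<times> (real^'d)) \<times> 'w) set"
  assumes "P \<in> sets (predictable M F)"
  shows "P \<in> sets (lborel \<Otimes>\<^sub>M M)"
proof -
  have top: "({0..} \<times> UNIV :: (real \<times> (real^'d)) set) \<times> space M \<in> sets (lborel \<Otimes>\<^sub>M M)"
    by (intro pair_measureI) (simp_all add: slab_borel)
  have gen: "R \<in> sets (lborel \<Otimes>\<^sub>M M)" if "R \<in> pred_rects" for R
    using that unfolding pred_rects_def
    by (auto intro!: pair_measureI slab_borel dest: sets_F)
  have "P \<in> sigma_sets (({0..} \<times> UNIV) \<times> space M) pred_rects"
    using assms by (simp add: sets_predictable)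
  thus ?thesis
  proof (induction rule: sigma_sets.induct)
    case (Basic a)
    thus ?case by (rule gen)
  next
    case (Compl a)
    thus ?case using top by (intro sets.Diff)
  next
    case (Union A)
    thus ?case by (intro sets.countable_UN) auto
  qed simp
qed

lemma predictable_ito_measurable:
  assumes "(\<lambda>(z, \<omega>). f z \<omega>) \<in> borel_measurable (predictable M F)"
  shows "ito_measurable f"
proof -
  have S: "times_pos \<times> space M \<in> sets (lborel \<Otimes>\<^sub>M M)" by (intro pair_measureI) auto
  let ?R = "restrict_space (lborel \<Otimes>\<^sub>M M) (times_pos \<times> space M)"
  have "(\<lambda>(z, \<omega>). f z \<omega>) \<in> borel_measurable ?R"
  proof (rule measurableI)
    fix B :: "real set" assume "B \<in> sets borel"
    hence "(\<lambda>(z, \<omega>). f z \<omega>) -` B \<inter> space (predictable M F) \<in> sets (predictable M F)"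
      by (rule measurable_sets[OF assms])
    from predictable_sets_subset[OF this]
    have 1: "(\<lambda>(z, \<omega>). f z \<omega>) -` B \<inter> (({0..} \<times> UNIV) \<times> space M) \<in> sets (lborel \<Otimes>\<^sub>M M)"
      by (simp only: space_predictable)
    have sp: "space ?R = times_pos \<times> space M"
      by (auto simp: space_restrict_space space_pair_measure)
    have "(\<lambda>(z, \<omega>). f z \<omega>) -` B \<inter> space ?R = (times_pos \<times> space M) \<inter>
        ((\<lambda>(z, \<omega>). f z \<omega>) -` B \<inter> (({0..} \<times> UNIV) \<times> space M))"
      unfolding sp by auto
    thus "(\<lambda>(z, \<omega>). f z \<omega>) -` B \<inter> space ?R \<in> sets ?R"
      using 1 S by (auto simp: sets_restrict_space)
  qed simp
  hence "(\<lambda>p. indicator (times_pos \<times> space M) p *\<^sub>R (\<lambda>(z, \<omega>). f z \<omega>) p) \<in> borel_measurable (lborel \<Otimes>\<^sub>M M)"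
    using S by (subst (asm) borel_measurable_restrict_space_iff) (auto simp: space_pair_measure)
  also have "?this \<longleftrightarrow> ito_measurable f"
    unfolding ito_measurable_def
    by (intro measurable_cong) (auto simp: indicator_def space_pair_measure)
  finally show ?thesis .
qed

section \<open>Simple processes\<close>

type_synonym ('u, 'v) simple_term = "('u \<Rightarrow> real) \<times> real \<times> real \<times> 'v set"

abbreviation slab :: "('w, real^'d) simple_term \<Rightarrow> (real \<times> (real^'d)) set" where
  "slab p \<equiv> {fst (snd p)<..fst (snd (snd p))} \<times> snd (snd (snd p))"

lemma simple_eval_sum: "simple_eval L z \<omega> = (\<Sum>i<length L. fst (L ! i) \<omega> * indicator (slab (L ! i)) z)"
  unfolding simple_eval_def by (simp add: sum_list_sum_nth atLeast0LessThan case_prod_unfold)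

lemma simple_int_sum: "simple_int W L \<omega> = (\<Sum>i<length L. fst (L ! i) \<omega> * W (slab (L ! i)) \<omega>)"
  unfolding simple_int_def by (simp add: sum_list_sum_nth atLeast0LessThan case_prod_unfold)

lemma simple_okD:
  assumes "simple_ok F L" "i < length L"
  shows "0 \<le> fst (snd (L ! i))" "snd (snd (snd (L ! i))) \<in> sets lborel"
    "emeasure lborel (snd (snd (snd (L ! i)))) < \<infinity>" "fst (L ! i) \<in> borel_measurable (F (fst (snd (L ! i))))"
    "\<exists>C. \<forall>\<omega>. \<bar>fst (L ! i) \<omega>\<bar> \<le> C" "slab (L ! i) \<subseteq> times_pos"
  using assms(1) nth_mem[OF assms(2)] unfolding simple_ok_def
  by (cases "L ! i"; force)+

lemma simple_slab_wn: "simple_ok F L \<Longrightarrow> i < length L \<Longrightarrow> wn_set (slab (L ! i))"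
  by (intro wn_set_slab simple_okD)

lemma simple_int_measurable:
  assumes "simple_ok F L" shows "simple_int W L \<in> borel_measurable M"
proof -
  have "fst (L ! i) \<in> borel_measurable M" "W (slab (L ! i)) \<in> borel_measurable M" if "i < length L" for i
    using simple_okD(4)[OF assms that] simple_slab_wn[OF assms that] by (auto intro: measurable_F W_measurable)
  thus ?thesis unfolding simple_int_sum[abs_def] by (intro borel_measurable_sum borel_measurable_times) auto
qed

lemma simple_ito_measurable:
  assumes "simple_ok F L" shows "ito_measurable (simple_eval L)"
proof -
  have "(\<lambda>p. indicator times_pos (fst p) * (fst (L ! i) (snd p) * indicator (slab (L ! i)) (fst p)))
      \<in> borel_measurable (lborel \<Otimes>\<^sub>M M)" if i: "i < length L" for i
  proof -
    have [measurable]: "fst (L ! i) \<in> borel_measurable M"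
      using simple_okD(4)[OF assms i] by (rule measurable_F)
    have [measurable]: "slab (L ! i) \<in> sets borel"
      using simple_slab_wn[OF assms i] by (simp add: wn_set_def)
    show ?thesis by measurable
  qed
  thus ?thesis unfolding ito_measurable_def simple_eval_sum sum_distrib_left
    by (intro borel_measurable_sum) auto
qed

text \<open>The slabs of a simple process may overlap, so off-diagonal terms survive. Both sides
  equal the double sum of \<open>E [X i * X j] * m i j\<close>: for the integral by
  \<open>W_slab_prod\<close>, for the process by integrating products of indicators.\<close>

lemma simple_isometry:
  assumes L: "simple_ok F L"
  shows "(\<integral>\<^sup>+\<omega>. ennreal ((simple_int W L \<omega>)\<^sup>2) \<partial>M) = ito_norm (simple_eval L)"
proof -
  define n where "n = length L"
  define X where "X i = fst (L ! i)" for i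
  define R where "R i = slab (L ! i)" for i
  define m where "m i j = measure lborel (R i \<inter> R j)" for i j
  have wn: "wn_set (R i)" if "i < n" for i
    using simple_slab_wn[OF L] that by (simp add: R_def n_def)
  have XM: "X i \<in> borel_measurable M" if "i < n" for i
    using simple_okD(4)[OF L] that by (auto simp: X_def n_def intro: measurable_F)
  have XX: "integrable M (\<lambda>\<omega>. X i \<omega> * X j \<omega>)" if ij: "i < n" "j < n" for i j
  proof -
    obtain C C' where C: "\<And>\<omega>. \<bar>X i \<omega>\<bar> \<le> C" "\<And>\<omega>. \<bar>X j \<omega>\<bar> \<le> C'"
      using simple_okD(5)[OF L] ij unfolding X_def n_def by metis
    have "integrable M (X j)" by (rule integrable_const_bound[of _ C']) (use C XM ij in auto)
    thus ?thesis by (rule integrable_bounded_mult[OF XM[OF ij(1)] C(1)])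
  qed
  have pair: "integrable M (\<lambda>\<omega>. (X i \<omega> * W (R i) \<omega>) * (X j \<omega> * W (R j) \<omega>))"
    "(\<integral>\<omega>. (X i \<omega> * W (R i) \<omega>) * (X j \<omega> * W (R j) \<omega>) \<partial>M) = (\<integral>\<omega>. X i \<omega> * X j \<omega> \<partial>M) * m i j"
    if ij: "i < n" "j < n" for i j
  proof -
    obtain C C' where C: "\<And>\<omega>. \<bar>X i \<omega>\<bar> \<le> C" "\<And>\<omega>. \<bar>X j \<omega>\<bar> \<le> C'"
      using simple_okD(5)[OF L] ij unfolding X_def n_def by metis
    note ij' = ij[unfolded n_def]
    show "integrable M (\<lambda>\<omega>. (X i \<omega> * W (R i) \<omega>) * (X j \<omega> * W (R j) \<omega>))"
      "(\<integral>\<omega>. (X i \<omega> * W (R i) \<omega>) * (X j \<omega> * W (R j) \<omega>) \<partial>M) = (\<integral>\<omega>. X i \<omega> * X j \<omega> \<partial>M) * m i j"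
      using W_slab_prod[OF simple_okD(4)[OF L ij'(1)] C(1)[unfolded X_def] simple_okD(4)[OF L ij'(2)]
          C(2)[unfolded X_def] simple_okD(1)[OF L ij'(1)] simple_okD(1)[OF L ij'(2)]
          simple_okD(2,3)[OF L ij'(1)] simple_okD(2,3)[OF L ij'(2)]]
      unfolding X_def R_def m_def by blast+
  qed
  have ind: "integrable lborel (\<lambda>z. indicator (R i) z * indicator (R j) z :: real)"
    "(\<integral>z. indicator (R i) z * indicator (R j) z \<partial>lborel) = m i j" if ij: "i < n" "j < n" for i j
  proof -
    have sets: "R i \<in> sets lborel" "R j \<in> sets lborel" using wn ij by (auto simp: wn_set_def)
    have "emeasure lborel (R i \<inter> R j) \<le> emeasure lborel (R i)" using sets by (intro emeasure_mono) auto
    also have "\<dots> < \<infinity>" using wn[OF ij(1)] by (simp add: wn_set_def)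
    finally have "emeasure lborel (R i \<inter> R j) < \<infinity>" .
    thus "integrable lborel (\<lambda>z. indicator (R i) z * indicator (R j) z :: real)"
      unfolding indicator_inter_arith[symmetric] using sets by (intro integrable_real_indicator) auto
    show "(\<integral>z. indicator (R i) z * indicator (R j) z \<partial>lborel) = m i j"
      unfolding indicator_inter_arith[symmetric] m_def using sets by simp
  qed
  have inner: "(\<integral>\<^sup>+z. ennreal ((simple_eval L z \<omega>)\<^sup>2) \<partial>lborel) = ennreal (\<Sum>i<n. \<Sum>j<n. X i \<omega> * X j \<omega> * m i j)"
    "0 \<le> (\<Sum>i<n. \<Sum>j<n. X i \<omega> * X j \<omega> * m i j)" for \<omega>
  proof -
    have sq: "(simple_eval L z \<omega>)\<^sup>2
        = (\<Sum>i<n. \<Sum>j<n. (X i \<omega> * X j \<omega>) * (indicator (R i) z * indicator (R j) z))" for z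
      unfolding simple_eval_sum power2_eq_square sum_product
      by (simp add: n_def X_def R_def mult_ac)
    have int: "integrable lborel (\<lambda>z. (simple_eval L z \<omega>)\<^sup>2)"
      unfolding sq by (intro Bochner_Integration.integrable_sum integrable_mult_right ind) auto
    have val: "(\<integral>z. (simple_eval L z \<omega>)\<^sup>2 \<partial>lborel) = (\<Sum>i<n. \<Sum>j<n. X i \<omega> * X j \<omega> * m i j)"
      unfolding sq by (subst Bochner_Integration.integral_sum; (auto simp: ind)?)+
    show "(\<integral>\<^sup>+z. ennreal ((simple_eval L z \<omega>)\<^sup>2) \<partial>lborel) = ennreal (\<Sum>i<n. \<Sum>j<n. X i \<omega> * X j \<omega> * m i j)"
      using int by (subst nn_integral_eq_integral) (auto simp: val)
    show "0 \<le> (\<Sum>i<n. \<Sum>j<n. X i \<omega> * X j \<omega> * m i j)"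
      unfolding val[symmetric] by simp
  qed
  have sq: "(simple_int W L \<omega>)\<^sup>2 = (\<Sum>i<n. \<Sum>j<n. (X i \<omega> * W (R i) \<omega>) * (X j \<omega> * W (R j) \<omega>))" for \<omega>
    by (simp add: simple_int_sum power2_eq_square sum_product n_def X_def R_def)
  have "(\<integral>\<^sup>+\<omega>. ennreal ((simple_int W L \<omega>)\<^sup>2) \<partial>M) = ennreal (\<integral>\<omega>. (simple_int W L \<omega>)\<^sup>2 \<partial>M)"
  proof (rule nn_integral_eq_integral)
    show "integrable M (\<lambda>\<omega>. (simple_int W L \<omega>)\<^sup>2)"
      unfolding sq by (intro Bochner_Integration.integrable_sum pair) auto
  qed simp
  also have "(\<integral>\<omega>. (simple_int W L \<omega>)\<^sup>2 \<partial>M) = (\<Sum>i<n. \<Sum>j<n. (\<integral>\<omega>. X i \<omega> * X j \<omega> \<partial>M) * m i j)"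
    unfolding sq by (subst Bochner_Integration.integral_sum; auto simp: pair)+
  also have "\<dots> = (\<integral>\<omega>. (\<Sum>i<n. \<Sum>j<n. X i \<omega> * X j \<omega> * m i j) \<partial>M)"
    by (subst Bochner_Integration.integral_sum; auto simp: XX)+
  also have "ennreal \<dots> = (\<integral>\<^sup>+\<omega>. ennreal (\<Sum>i<n. \<Sum>j<n. X i \<omega> * X j \<omega> * m i j) \<partial>M)"
  proof (rule nn_integral_eq_integral[symmetric])
    show "integrable M (\<lambda>\<omega>. \<Sum>i<n. \<Sum>j<n. X i \<omega> * X j \<omega> * m i j)"
      by (intro Bochner_Integration.integrable_sum integrable_mult_left XX) auto
  next
    show "AE \<omega> in M. 0 \<le> (\<Sum>i<n. \<Sum>j<n. X i \<omega> * X j \<omega> * m i j)" using inner(2) by simp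
  qed
  also have "\<dots> = ito_norm (simple_eval L)"
  proof -
    have "simple_eval L z \<omega> = 0" if "z \<notin> times_pos" for z \<omega>
      using simple_okD(6)[OF L] that by (auto simp: simple_eval_sum indicator_def intro!: sum.neutral)
    hence *: "ennreal ((simple_eval L z \<omega>)\<^sup>2) * indicator ({0..} \<times> UNIV) z = ennreal ((simple_eval L z \<omega>)\<^sup>2)"
      for z \<omega> by (cases "z \<in> times_pos") (auto simp: indicator_def)
    show ?thesis
      unfolding ito_norm_alt[OF simple_ito_measurable[OF L], symmetric] * inner(1) ..
  qed
  finally show ?thesis .
qed

section \<open>Density of simple processes\<close>

lemma simple_eval_append: "simple_eval (L @ L') z \<omega> = simple_eval L z \<omega> + simple_eval L' z \<omega>"
  by (simp add: simple_eval_def)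

lemma simple_int_append: "simple_int W (L @ L') \<omega> = simple_int W L \<omega> + simple_int W L' \<omega>"
  by (simp add: simple_int_def)

lemma simple_ok_append: "simple_ok F L \<Longrightarrow> simple_ok F L' \<Longrightarrow> simple_ok F (L @ L')"
  by (auto simp: simple_ok_def)

definition simple_scale :: "real \<Rightarrow> ('w, real^'d) simple_term list \<Rightarrow> ('w, real^'d) simple_term list" where
  "simple_scale c = map (\<lambda>(X, r). (\<lambda>\<omega>. c * X \<omega>, r))"

lemma simple_eval_scale: "simple_eval (simple_scale c L) z \<omega> = c * simple_eval L z \<omega>"
  by (simp add: simple_eval_def simple_scale_def o_def case_prod_unfold sum_list_const_mult mult.assoc)

lemma simple_int_scale: "simple_int W (simple_scale c L) \<omega> = c * simple_int W L \<omega>"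
  by (simp add: simple_int_def simple_scale_def o_def case_prod_unfold sum_list_const_mult mult.assoc)

lemma simple_ok_scale: "simple_ok F L \<Longrightarrow> simple_ok F (simple_scale c L)"
proof -
  have "\<exists>C'. \<forall>\<omega>. \<bar>c * X \<omega>\<bar> \<le> C'" if "\<forall>\<omega>. \<bar>X \<omega>\<bar> \<le> C" for X :: "'w \<Rightarrow> real" and C
    using that by (intro exI[of _ "\<bar>c\<bar> * C"]) (auto simp: abs_mult intro!: mult_left_mono)
  note bounded = this
  assume ok: "simple_ok F L"
  show "simple_ok F (simple_scale c L)"
    unfolding simple_ok_def
  proof (safe)
    fix X a b A assume "(X, a, b, A) \<in> set (simple_scale c L)"
    then obtain X' where X': "(X', a, b, A) \<in> set L" "X = (\<lambda>\<omega>. c * X' \<omega>)"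
      by (auto simp: simple_scale_def)
    with ok have *: "0 \<le> a \<and> a < b \<and> A \<in> sets lborel \<and> emeasure lborel A < \<infinity>
        \<and> X' \<in> borel_measurable (F a) \<and> (\<exists>C. \<forall>\<omega>. \<bar>X' \<omega>\<bar> \<le> C)"
      unfolding simple_ok_def by blast
    thus "0 \<le> a" "a < b" "A \<in> sets lborel" "emeasure lborel A < \<infinity>" by auto
    show "X \<in> borel_measurable (F a)"
      unfolding X'(2) using * by (intro borel_measurable_times borel_measurable_const) simp
    show "\<exists>C. \<forall>\<omega>. \<bar>X \<omega>\<bar> \<le> C" using * bounded unfolding X'(2) by blast
  qed
qed

lemma ennreal_quarters:
  assumes "e \<ge> 0" shows "2 * ennreal (e / 4) + 2 * ennreal (e / 4) = ennreal e"
proof -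
  have "ennreal e = ennreal (2 * (e / 4) + 2 * (e / 4))" by simp
  also have "\<dots> = ennreal (2 * (e / 4)) + ennreal (2 * (e / 4))"
    using assms by (intro ennreal_plus) auto
  also have "ennreal (2 * (e / 4)) = 2 * ennreal (e / 4)"
    using ennreal_mult'[of 2 "e / 4"] by simp
  finally show ?thesis by simp
qed

text \<open>Closed under linear combinations and dominated limits, as the Dynkin induction and the
  passage to general integrands require.\<close>

definition simple_approx :: "(real \<times> (real^'d) \<Rightarrow> 'w \<Rightarrow> real) \<Rightarrow> bool" where
  "simple_approx f \<longleftrightarrow> ito_measurable f \<and>
     (\<forall>e>0. \<exists>L. simple_ok F L \<and> ito_norm (\<lambda>z \<omega>. f z \<omega> - simple_eval L z \<omega>) \<le> ennreal e)"

lemma simple_approx_cong: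
  assumes "\<And>z \<omega>. z \<in> times_pos \<Longrightarrow> \<omega> \<in> space M \<Longrightarrow> f z \<omega> = g z \<omega>"
  shows "simple_approx f = simple_approx g"
proof -
  have "ito_norm (\<lambda>z \<omega>. f z \<omega> - simple_eval L z \<omega>) = ito_norm (\<lambda>z \<omega>. g z \<omega> - simple_eval L z \<omega>)" for L
    by (rule ito_cong(2)) (simp add: assms)
  thus ?thesis unfolding simple_approx_def using ito_cong(1)[of f g, OF assms] by simp
qed

lemma simple_approx_simple: "simple_ok F L \<Longrightarrow> simple_approx (simple_eval L)"
proof -
  have "ito_norm (\<lambda>z \<omega>. 0) = 0" by (simp add: ito_norm_def)
  thus "simple_ok F L \<Longrightarrow> simple_approx (simple_eval L)"
    unfolding simple_approx_def
    by (intro conjI simple_ito_measurable allI impI exI[of _ L]) simp_all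
qed

lemma simple_approx_limit:
  assumes f: "ito_measurable f"
    and "\<And>e. e > 0 \<Longrightarrow> \<exists>g. simple_approx g \<and> ito_norm (\<lambda>z \<omega>. f z \<omega> - g z \<omega>) \<le> ennreal e"
  shows "simple_approx f"
  unfolding simple_approx_def
proof (intro conjI allI impI f)
  fix e :: real assume e: "e > 0"
  then obtain g where g: "simple_approx g" "ito_norm (\<lambda>z \<omega>. f z \<omega> - g z \<omega>) \<le> ennreal (e / 4)"
    using assms(2)[of "e / 4"] by auto
  then obtain L where L: "simple_ok F L" "ito_norm (\<lambda>z \<omega>. g z \<omega> - simple_eval L z \<omega>) \<le> ennreal (e / 4)"
    using e unfolding simple_approx_def by (metis divide_pos_pos zero_less_numeral)
  have gm: "ito_measurable g" using g by (simp add: simple_approx_def)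
  have "ito_norm (\<lambda>z \<omega>. f z \<omega> - simple_eval L z \<omega>) \<le> 2 * ennreal (e / 4) + 2 * ennreal (e / 4)"
    using g(2) L(2)
    by (intro order.trans[OF ito_norm_triangle[OF f simple_ito_measurable[OF L(1)] gm]] add_mono mult_left_mono) auto
  also have "\<dots> = ennreal e"
    using e by (intro ennreal_quarters) simp
  finally show "\<exists>L. simple_ok F L \<and> ito_norm (\<lambda>z \<omega>. f z \<omega> - simple_eval L z \<omega>) \<le> ennreal e"
    using L by blast
qed

lemma simple_approx_add:
  assumes f: "simple_approx f" and g: "simple_approx g"
  shows "simple_approx (\<lambda>z \<omega>. f z \<omega> + g z \<omega>)"
  unfolding simple_approx_def
proof (intro conjI allI impI ito_measurable_add)
  show m: "ito_measurable f" "ito_measurable g" using f g by (auto simp: simple_approx_def)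
  fix e :: real assume e: "e > 0"
  have e4: "e / 4 > 0" using e by simp
  obtain L where L: "simple_ok F L" "ito_norm (\<lambda>z \<omega>. f z \<omega> - simple_eval L z \<omega>) \<le> ennreal (e / 4)"
    using f e4 unfolding simple_approx_def by blast
  obtain L' where L': "simple_ok F L'" "ito_norm (\<lambda>z \<omega>. g z \<omega> - simple_eval L' z \<omega>) \<le> ennreal (e / 4)"
    using g e4 unfolding simple_approx_def by blast
  have "ito_norm (\<lambda>z \<omega>. f z \<omega> + g z \<omega> - simple_eval (L @ L') z \<omega>)
      = ito_norm (\<lambda>z \<omega>. (f z \<omega> - simple_eval L z \<omega>) + (g z \<omega> - simple_eval L' z \<omega>))"
    by (simp add: simple_eval_append algebra_simps)
  also have "\<dots> \<le> 2 * ennreal (e / 4) + 2 * ennreal (e / 4)"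
    using L L' m by (intro order.trans[OF ito_norm_add] add_mono mult_left_mono
        ito_measurable_diff simple_ito_measurable) auto
  also have "\<dots> = ennreal e"
    using e by (intro ennreal_quarters) simp
  finally show "\<exists>L. simple_ok F L \<and> ito_norm (\<lambda>z \<omega>. f z \<omega> + g z \<omega> - simple_eval L z \<omega>) \<le> ennreal e"
    using simple_ok_append[OF L(1) L'(1)] by blast
qed

lemma ito_norm_cmult: 
  assumes "ito_measurable f"
  shows "ito_norm (\<lambda>z \<omega>. c * f z \<omega>) = ennreal (c\<^sup>2) * ito_norm f"
proof -
  let ?g = "\<lambda>p. indicator times_pos (fst p) * f (fst p) (snd p)"
  have m: "(\<lambda>p. ennreal ((?g p)\<^sup>2)) \<in> borel_measurable (lborel \<Otimes>\<^sub>M M)"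
    using assms[unfolded ito_measurable_def] by measurable
  show ?thesis
    unfolding ito_norm_def nn_integral_cmult[OF m, symmetric]
    by (simp add: ennreal_mult'[symmetric] power_mult_distrib mult_ac)
qed

lemma simple_approx_cmult:
  assumes f: "simple_approx f"
  shows "simple_approx (\<lambda>z \<omega>. c * f z \<omega>)"
  unfolding simple_approx_def
proof (intro conjI allI impI ito_measurable_cmult)
  show m: "ito_measurable f" using f by (auto simp: simple_approx_def)
  fix e :: real assume e: "e > 0"
  hence "e / (c\<^sup>2 + 1) > 0" by (simp add: add_nonneg_pos)
  then obtain L where L: "simple_ok F L" "ito_norm (\<lambda>z \<omega>. f z \<omega> - simple_eval L z \<omega>) \<le> ennreal (e / (c\<^sup>2 + 1))"
    using f unfolding simple_approx_def by blast
  have "ito_norm (\<lambda>z \<omega>. c * f z \<omega> - simple_eval (simple_scale c L) z \<omega>)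
      = ito_norm (\<lambda>z \<omega>. c * (f z \<omega> - simple_eval L z \<omega>))"
    by (simp add: simple_eval_scale algebra_simps)
  also have "\<dots> = ennreal (c\<^sup>2) * ito_norm (\<lambda>z \<omega>. f z \<omega> - simple_eval L z \<omega>)"
    by (intro ito_norm_cmult ito_measurable_diff m simple_ito_measurable L)
  also have "\<dots> \<le> ennreal (c\<^sup>2) * ennreal (e / (c\<^sup>2 + 1))"
    by (intro mult_left_mono L) auto
  also have "\<dots> = ennreal (c\<^sup>2 * (e / (c\<^sup>2 + 1)))" by (simp add: ennreal_mult'[symmetric])
  also have "\<dots> \<le> ennreal e"
  proof (rule ennreal_leI)
    have "c\<^sup>2 + 1 > 0" by (simp add: add_nonneg_pos)
    thus "c\<^sup>2 * (e / (c\<^sup>2 + 1)) \<le> e" using e by (simp add: field_simps)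
  qed
  finally show "\<exists>L. simple_ok F L \<and> ito_norm (\<lambda>z \<omega>. c * f z \<omega> - simple_eval L z \<omega>) \<le> ennreal e"
    using simple_ok_scale[OF L(1)] by blast
qed

lemma simple_approx_dominated:
  assumes f: "ito_measurable f" and g: "\<And>n. simple_approx (g n)"
    and w: "ito_measurable w" "ito_norm w < \<infinity>"
    and lim: "\<And>z \<omega>. z \<in> times_pos \<Longrightarrow> \<omega> \<in> space M \<Longrightarrow> (\<lambda>n. g n z \<omega>) \<longlonglongrightarrow> f z \<omega>"
    and dom: "\<And>n z \<omega>. z \<in> times_pos \<Longrightarrow> \<omega> \<in> space M \<Longrightarrow> \<bar>f z \<omega> - g n z \<omega>\<bar> \<le> \<bar>w z \<omega>\<bar>"
  shows "simple_approx f"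
proof (rule simple_approx_limit[OF f])
  fix e :: real assume e: "e > 0"
  have gm: "ito_measurable (g n)" for n using g by (auto simp: simple_approx_def)
  let ?r = "\<lambda>h p. indicator times_pos (fst p) * h (fst p) (snd p)"
  have "(\<lambda>n. \<integral>\<^sup>+p. ennreal ((?r (\<lambda>z \<omega>. f z \<omega> - g n z \<omega>) p)\<^sup>2) \<partial>(lborel \<Otimes>\<^sub>M M)) \<longlonglongrightarrow>
      (\<integral>\<^sup>+p. 0 \<partial>((lborel :: (real \<times> (real^'d)) measure) \<Otimes>\<^sub>M M))"
  proof (rule nn_integral_dominated_convergence[where w = "\<lambda>p. ennreal ((?r w p)\<^sup>2)"])
    show "(\<lambda>p. ennreal ((?r (\<lambda>z \<omega>. f z \<omega> - g n z \<omega>) p)\<^sup>2)) \<in> borel_measurable (lborel \<Otimes>\<^sub>M M)" for n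
      using ito_measurable_diff[OF f gm[of n], unfolded ito_measurable_def] by measurable
    show "(\<lambda>p. ennreal ((?r w p)\<^sup>2)) \<in> borel_measurable (lborel \<Otimes>\<^sub>M M)"
      using w(1)[unfolded ito_measurable_def] by measurable
    show "(\<integral>\<^sup>+p. ennreal ((?r w p)\<^sup>2) \<partial>(lborel \<Otimes>\<^sub>M M)) < \<infinity>"
      using w(2) by (simp add: ito_norm_def)
    show "AE p in lborel \<Otimes>\<^sub>M M. ennreal ((?r (\<lambda>z \<omega>. f z \<omega> - g n z \<omega>) p)\<^sup>2) \<le> ennreal ((?r w p)\<^sup>2)" for n
    proof (rule AE_I2)
      fix p :: "(real \<times> (real^'d)) \<times> 'w" assume "p \<in> space (lborel \<Otimes>\<^sub>M M)"
      hence "\<bar>?r (\<lambda>z \<omega>. f z \<omega> - g n z \<omega>) p\<bar> \<le> \<bar>?r w p\<bar>"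
        using dom[of "fst p" "snd p" n] by (auto simp: indicator_def space_pair_measure)
      thus "ennreal ((?r (\<lambda>z \<omega>. f z \<omega> - g n z \<omega>) p)\<^sup>2) \<le> ennreal ((?r w p)\<^sup>2)"
        by (intro ennreal_leI) (simp add: abs_le_square_iff)
    qed
    show "AE p in lborel \<Otimes>\<^sub>M M. (\<lambda>n. ennreal ((?r (\<lambda>z \<omega>. f z \<omega> - g n z \<omega>) p)\<^sup>2)) \<longlonglongrightarrow> 0"
    proof (rule AE_I2)
      fix p :: "(real \<times> (real^'d)) \<times> 'w" assume p: "p \<in> space (lborel \<Otimes>\<^sub>M M)"
      have "(\<lambda>n. ?r (\<lambda>z \<omega>. f z \<omega> - g n z \<omega>) p) \<longlonglongrightarrow> 0"
      proof (cases "fst p \<in> times_pos")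
        case True
        have "snd p \<in> space M" using p by (auto simp: space_pair_measure)
        from lim[OF True this] have "(\<lambda>n. f (fst p) (snd p) - g n (fst p) (snd p)) \<longlonglongrightarrow> f (fst p) (snd p) - f (fst p) (snd p)"
          by (intro tendsto_intros)
        thus ?thesis using True by simp
      qed simp
      hence "(\<lambda>n. ennreal ((?r (\<lambda>z \<omega>. f z \<omega> - g n z \<omega>) p)\<^sup>2)) \<longlonglongrightarrow> ennreal (0\<^sup>2)"
        by (intro tendsto_ennrealI tendsto_intros)
      thus "(\<lambda>n. ennreal ((?r (\<lambda>z \<omega>. f z \<omega> - g n z \<omega>) p)\<^sup>2)) \<longlonglongrightarrow> 0" by simp
    qed
  qed simp
  hence "(\<lambda>n. ito_norm (\<lambda>z \<omega>. f z \<omega> - g n z \<omega>)) \<longlonglongrightarrow> 0" by (simp add: ito_norm_def)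
  hence "\<forall>\<^sub>F n in sequentially. ito_norm (\<lambda>z \<omega>. f z \<omega> - g n z \<omega>) < ennreal e"
    using e by (intro order_tendstoD(2)) auto
  then obtain n where "ito_norm (\<lambda>z \<omega>. f z \<omega> - g n z \<omega>) < ennreal e"
    using eventually_happens' sequentially_bot by blast
  thus "\<exists>g. simple_approx g \<and> ito_norm (\<lambda>z \<omega>. f z \<omega> - g z \<omega>) \<le> ennreal e"
    using g[of n] less_imp_le by blast
qed

text \<open>Simple terms need spatial sets of finite measure, and complements of predictable sets
  must keep finite norm; multiplying by a box secures both. Boxes exclude time 0 and exhaust the
  positive times.\<close>

definition time_box :: "nat \<Rightarrow> (real \<times> (real^'d)) set" where
  "time_box n = {0<..real n} \<times> ball 0 (real n)"

lemma time_box_wn: "wn_set (time_box n)"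
  unfolding time_box_def using emeasure_lborel_ball_finite by (intro wn_set_slab) auto

lemma time_box_borel [measurable]: "time_box n \<in> sets borel"
  using time_box_wn[of n] by (simp add: wn_set_def)

lemma pred_measurable_indicator:
  assumes "P \<in> sets (predictable M F)"
  shows "ito_measurable (\<lambda>z \<omega>. indicator P (z, \<omega>) * indicator (time_box n) z)"
proof -
  have [measurable]: "P \<in> sets (lborel \<Otimes>\<^sub>M M)" using predictable_sets_subset[OF assms] .
  show ?thesis unfolding ito_measurable_def prod.collapse by measurable
qed

lemma ito_norm_time_box: "ito_norm (\<lambda>z \<omega>. c * indicator (time_box n) z) < \<infinity>"
proof -
  have "ito_norm (\<lambda>z \<omega>. c * indicator (time_box n) z)
      \<le> (\<integral>\<^sup>+p. ennreal (c\<^sup>2) * indicator (time_box n \<times> space M) p \<partial>(lborel \<Otimes>\<^sub>M M))"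
    unfolding ito_norm_def
    by (intro nn_integral_mono) (auto simp: indicator_def space_pair_measure)
  also have "\<dots> = ennreal (c\<^sup>2) * (emeasure lborel (time_box n) * emeasure M (space M))"
    by (subst nn_integral_cmult_indicator) (auto simp: emeasure_pair_measure_Times)
  also have "\<dots> < \<infinity>"
    using time_box_wn[of n] by (simp add: wn_set_def ennreal_mult_less_top emeasure_space_1)
  finally show ?thesis .
qed

text \<open>Two slabs meet in a slab that starts at the later starting time, where both events are
  measurable. Generators at time 0 never meet a slab, because slabs are open on the left.\<close>

lemma pred_rects_Int_stable: "Int_stable pred_rects"
proof (rule Int_stableI)
  fix P Q assume P: "P \<in> pred_rects" and Q: "Q \<in> pred_rects"
  have empty: "{} \<in> pred_rects"
    unfolding pred_rects_def using sets.empty_sets[of "F 0"]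
    by (intro UnI2) (auto intro!: exI[of _ "{}"])
  have rect: "({a<..b} \<times> A) \<times> E \<in> pred_rects" if "0 \<le> a" "A \<in> sets lborel" "E \<in> sets (F a)" for a b A E
  proof (cases "a < b")
    case True
    thus ?thesis using that unfolding pred_rects_def by blast
  qed (use empty in auto)
  have zero_rect: "({0} \<times> A) \<times> E \<in> pred_rects" if "A \<in> sets lborel" "E \<in> sets (F 0)" for A E
    using that unfolding pred_rects_def by blast
  from P consider
    (pos) a b A E where "P = ({a<..b} \<times> A) \<times> E" "0 \<le> a" "A \<in> sets lborel" "E \<in> sets (F a)"
    | (zero) A E where "P = ({0} \<times> A) \<times> E" "A \<in> sets lborel" "E \<in> sets (F 0)"
    unfolding pred_rects_def by auto
  note Pc = this
  from Q consider
    (pos) a b A E where "Q = ({a<..b} \<times> A) \<times> E" "0 \<le> a" "A \<in> sets lborel" "E \<in> sets (F a)"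
    | (zero) A E where "Q = ({0} \<times> A) \<times> E" "A \<in> sets lborel" "E \<in> sets (F 0)"
    unfolding pred_rects_def by auto
  note Qc = this
  show "P \<inter> Q \<in> pred_rects"
  proof (cases rule: Pc)
    case (pos a b A E)
    note P = pos
    show ?thesis
    proof (cases rule: Qc)
      case (pos a' b' A' E')
      have "P \<inter> Q = ({max a a'<..min b b'} \<times> (A \<inter> A')) \<times> (E \<inter> E')"
        unfolding P pos by auto
      moreover have "E \<inter> E' \<in> sets (F (max a a'))"
        using F_mono[of a "max a a'" E] F_mono[of a' "max a a'" E'] P pos by auto
      ultimately show ?thesis using P pos by (simp add: rect)
    next
      case (zero A' E')
      hence "P \<inter> Q = {}" unfolding P zero using P(2) by auto
      thus ?thesis using empty by simp
    qed
  next
    case (zero A E)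
    note P = zero
    show ?thesis
    proof (cases rule: Qc)
      case (pos a' b' A' E')
      hence "P \<inter> Q = {}" unfolding P pos using pos(2) by auto
      thus ?thesis using empty by simp
    next
      case (zero A' E')
      have "P \<inter> Q = ({0} \<times> (A \<inter> A')) \<times> (E \<inter> E')" unfolding P zero by auto
      thus ?thesis using P zero by (simp add: zero_rect sets.Int)
    qed
  qed
qed

text \<open>Inside the box a generating slab becomes a single simple term with a bounded spatial
  set, and a generator at time 0 vanishes. Complements are taken relative to the box itself, and
  disjoint unions are limits dominated by it.\<close>

lemma simple_approx_pred_indicator:
  assumes "P \<in> sets (predictable M F)"
  shows "simple_approx (\<lambda>z \<omega>. indicator P (z, \<omega>) * indicator (time_box n) z)"
proof -
  have nil: "simple_approx (\<lambda>z \<omega>. 0)"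
    using simple_approx_simple[of "[]"] by (simp add: simple_ok_def simple_eval_def[abs_def])
  have single: "simple_approx (\<lambda>z \<omega>. indicator E \<omega> * indicator ({a<..b} \<times> A) z)"
    if "0 \<le> a" "A \<in> sets lborel" "emeasure lborel A < \<infinity>" "E \<in> sets (F a)" for a b A E
  proof (cases "a < b")
    case True
    have "simple_ok F [(indicator E, a, b, A)]"
      using that True by (auto simp: simple_ok_def indicator_def intro!: exI[of _ 1])
    from simple_approx_simple[OF this] show ?thesis
      by (simp add: simple_eval_def[abs_def])
  qed (use nil in simp)
  have ball: "A \<inter> ball 0 (real n) \<in> sets lborel" "emeasure lborel (A \<inter> ball 0 (real n)) < \<infinity>"
    if "A \<in> sets lborel" for A :: "(real^'d) set"
  proof -
    show "A \<inter> ball 0 (real n) \<in> sets lborel" using that by auto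
    have "emeasure lborel (A \<inter> ball 0 (real n)) \<le> emeasure lborel (ball (0::real^'d) (real n))"
      by (intro emeasure_mono) auto
    also have "\<dots> < \<infinity>" by (rule emeasure_lborel_ball_finite)
    finally show "emeasure lborel (A \<inter> ball 0 (real n)) < \<infinity>" .
  qed
  have box: "simple_approx (\<lambda>z \<omega>. indicator (time_box n) z)"
  proof -
    have "space M \<in> sets (F 0)" using sets.top[of "F 0"] by (simp add: space_F)
    hence "simple_approx (\<lambda>z \<omega>. indicator (space M) \<omega> * indicator (time_box n) z)"
      unfolding time_box_def using emeasure_lborel_ball_finite by (intro single) auto
    also have "?this \<longleftrightarrow> ?thesis" by (rule simple_approx_cong) simp
    finally show ?thesis .
  qed
  have "P \<in> sigma_sets (({0..} \<times> UNIV) \<times> space M) pred_rects"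
    using assms by (simp add: sets_predictable)
  with pred_rects_Int_stable pred_rects_Pow show ?thesis
  proof (induction rule: sigma_sets_induct_disjoint)
    case (basic P)
    then consider
      (pos) a b A E where "P = ({a<..b} \<times> A) \<times> E" "0 \<le> a" "A \<in> sets lborel" "E \<in> sets (F a)"
      | (zero) A E where "P = ({0} \<times> A) \<times> E"
      unfolding pred_rects_def by auto
    thus ?case
    proof cases
      case (pos a b A E)
      have "indicator P (z, \<omega>) * indicator (time_box n) z
          = (indicator E \<omega> * indicator ({a<..min b (real n)} \<times> (A \<inter> ball 0 (real n))) z :: real)" for z \<omega>
        using pos by (auto simp: indicator_def time_box_def)
      thus ?thesis using single[OF pos(2) ball[OF pos(3)] pos(4)] by simp
    next
      case (zero A E)
      have "indicator P (z, \<omega>) * indicator (time_box n) z = (0 :: real)" for z \<omega>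
        using zero by (auto simp: indicator_def time_box_def)
      thus ?thesis using nil by (simp only:)
    qed
  next
    case empty
    show ?case using nil by simp
  next
    case (compl P)
    have "simple_approx (\<lambda>z \<omega>. indicator (time_box n) z + (- 1) * (indicator P (z, \<omega>) * indicator (time_box n) z))"
      by (intro simple_approx_add simple_approx_cmult box compl)
    also have "?this \<longleftrightarrow> ?case"
      by (rule simple_approx_cong) (auto simp: indicator_def)
    finally show ?case .
  next
    case (union A)
    have A: "A i \<in> sets (predictable M F)" for i
      using union(2) by (auto simp: sets_predictable)
    let ?g = "\<lambda>k z \<omega>. \<Sum>i<k. indicator (A i) (z, \<omega>) * indicator (time_box n) z :: real"
    have g_eq: "?g k z \<omega> = indicator (\<Union>i<k. A i) (z, \<omega>) * indicator (time_box n) z" for k z \<omega>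
      unfolding sum_distrib_right[symmetric]
      by (subst indicator_UN_disjoint) (auto intro: disjoint_family_on_mono[OF _ union(1)])
    show ?case
    proof (rule simple_approx_dominated[where g = ?g and w = "\<lambda>z \<omega>. 1 * indicator (time_box n) z"])
      show "ito_measurable (\<lambda>z \<omega>. indicator (\<Union>i. A i) (z, \<omega>) * indicator (time_box n) z)"
        using A by (intro pred_measurable_indicator sets.countable_UN) auto
      show "simple_approx (?g k)" for k
      proof (induction k)
        case (Suc k)
        show ?case unfolding sum.lessThan_Suc by (intro simple_approx_add Suc union(3))
      qed (use nil in simp)
      show "ito_measurable (\<lambda>z \<omega>. 1 * indicator (time_box n) z)"
        using box by (simp add: simple_approx_def)
      show "ito_norm (\<lambda>z \<omega>. 1 * indicator (time_box n) z) < \<infinity>" by (rule ito_norm_time_box)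
      show "(\<lambda>k. ?g k z \<omega>) \<longlonglongrightarrow> indicator (\<Union>i. A i) (z, \<omega>) * indicator (time_box n) z" for z \<omega>
        unfolding g_eq by (intro tendsto_intros LIMSEQ_indicator_UN)
      show "\<bar>indicator (\<Union>i. A i) (z, \<omega>) * indicator (time_box n) z - ?g k z \<omega>\<bar>
          \<le> \<bar>1 * indicator (time_box n) z\<bar>" for k z \<omega>
        unfolding g_eq by (auto simp: indicator_def)
    qed
  qed
qed

lemma simple_approx_predictable:
  assumes f: "(\<lambda>(z, \<omega>). f z \<omega>) \<in> borel_measurable (predictable M F)" and fin: "ito_norm f < \<infinity>"
  shows "simple_approx f"
proof -
  obtain s where "\<forall>i. simple_function (predictable M F) (s i)"
    "\<forall>x\<in>space (predictable M F). (\<lambda>i. s i x) \<longlonglongrightarrow> (\<lambda>(z, \<omega>). f z \<omega>) x"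
    "\<forall>i. \<forall>x\<in>space (predictable M F). dist (s i x) 0 \<le> 2 * dist ((\<lambda>(z, \<omega>). f z \<omega>) x) 0"
    using borel_measurable_implies_sequence_metric[OF f, of 0] by blast
  note s = this[rule_format]
  have sp: "(z, \<omega>) \<in> space (predictable M F)" if "z \<in> times_pos" "\<omega> \<in> space M" for z \<omega>
    using that by (auto simp: space_predictable)
  let ?g = "\<lambda>n z \<omega>. s n (z, \<omega>) * indicator (time_box n) z"
  have fm: "ito_measurable f" by (rule predictable_ito_measurable[OF f])
  show ?thesis
  \<comment> \<open>The simple functions satisfy
    \<open>\<bar>s n\<bar> \<le> 2 * \<bar>f\<bar>\<close>, so their distance from \<open>f\<close>
    is dominated by \<open>3 * \<bar>f\<bar>\<close>, inside and outside the box.\<close>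
  proof (rule simple_approx_dominated[where g = ?g and w = "\<lambda>z \<omega>. 3 * f z \<omega>"])
    show "simple_approx (?g n)" for n
    proof -
      have fin: "finite (s n ` space (predictable M F))" by (rule simple_functionD(1)[OF s(1)])
      have sets: "s n -` {y} \<inter> space (predictable M F) \<in> sets (predictable M F)" for y
        by (rule simple_functionD(2)[OF s(1)])
      have sum: "simple_approx (\<lambda>z \<omega>. \<Sum>y\<in>Y. y * (indicator (s n -` {y} \<inter> space (predictable M F)) (z, \<omega>)
          * indicator (time_box n) z))" if "finite Y" for Y
        using that
      proof (induction Y)
        case empty
        show ?case using simple_approx_simple[of "[]"] by (simp add: simple_ok_def simple_eval_def[abs_def])
      next
        case (insert y Y)
        show ?case unfolding sum.insert[OF insert(1,2)]
          by (intro simple_approx_add simple_approx_cmult simple_approx_pred_indicator sets insert)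
      qed
      have "simple_approx (\<lambda>z \<omega>. \<Sum>y\<in>s n ` space (predictable M F).
          y * (indicator (s n -` {y} \<inter> space (predictable M F)) (z, \<omega>) * indicator (time_box n) z))"
        by (rule sum[OF fin])
      also have "?this \<longleftrightarrow> ?thesis"
      proof (rule simple_approx_cong)
        fix z \<omega> assume "z \<in> times_pos" "\<omega> \<in> space M"
        hence x: "(z, \<omega>) \<in> space (predictable M F)" by (rule sp)
        have "(\<Sum>y\<in>s n ` space (predictable M F).
            y * (indicator (s n -` {y} \<inter> space (predictable M F)) (z, \<omega>) * indicator (time_box n) z))
          = (\<Sum>y\<in>s n ` space (predictable M F). if y = s n (z, \<omega>) then y * indicator (time_box n) z else 0)"
          using x by (intro sum.cong) (auto simp: indicator_def)
        thus "(\<Sum>y\<in>s n ` space (predictable M F).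
            y * (indicator (s n -` {y} \<inter> space (predictable M F)) (z, \<omega>) * indicator (time_box n) z)) = ?g n z \<omega>"
          using fin x by (simp add: sum.delta)
      qed
      finally show ?thesis .
    qed
    show "ito_measurable f" "ito_measurable (\<lambda>z \<omega>. 3 * f z \<omega>)" by (intro ito_measurable_cmult fm)+
    show "ito_norm (\<lambda>z \<omega>. 3 * f z \<omega>) < \<infinity>"
      using fin by (simp add: ito_norm_cmult[OF fm] ennreal_mult_less_top)
  next
    fix z \<omega> assume z: "z \<in> times_pos" "\<omega> \<in> space M"
    obtain N :: nat where N: "max (fst z) (norm (snd z)) < real N" using reals_Archimedean2 by blast
    have "\<forall>\<^sub>F n in sequentially. indicator (time_box n) z = (1 :: real)"
      using eventually_ge_at_top[of N]
    proof eventually_elim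
      case (elim n)
      hence "real N \<le> real n" by simp
      thus ?case using N z by (cases z) (auto simp: time_box_def indicator_def)
    qed
    hence "(\<lambda>n. indicator (time_box n) z :: real) \<longlonglongrightarrow> 1" by (rule tendsto_eventually)
    from tendsto_mult[OF s(2)[OF sp[OF z]] this]
    show "(\<lambda>n. ?g n z \<omega>) \<longlonglongrightarrow> f z \<omega>" by simp
    show "\<bar>f z \<omega> - ?g n z \<omega>\<bar> \<le> \<bar>3 * f z \<omega>\<bar>" for n
      using s(3)[OF sp[OF z], of n] by (auto simp: indicator_def)
  qed
qed

section \<open>The Walsh integral\<close>

lemma walsh_integral_iff:
  assumes f: "(\<lambda>(z, \<omega>). f z \<omega>) \<in> borel_measurable (predictable M F)"
  shows "walsh_integral M F W f I \<longleftrightarrow> ito_norm f < \<infinity> \<and> I \<in> borel_measurable M \<and>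
     (\<exists>S. (\<forall>n. simple_ok F (S n)) \<and> (\<lambda>n. ito_norm (\<lambda>z \<omega>. f z \<omega> - simple_eval (S n) z \<omega>)) \<longlonglongrightarrow> 0 \<and>
        (\<lambda>n. \<integral>\<^sup>+\<omega>. ennreal ((I \<omega> - simple_int W (S n) \<omega>)\<^sup>2) \<partial>M) \<longlonglongrightarrow> 0)"
proof -
  note fm = predictable_ito_measurable[OF f]
  have eq: "(\<integral>\<^sup>+\<omega>. (\<integral>\<^sup>+z. ennreal ((f z \<omega> - simple_eval L z \<omega>)\<^sup>2) * indicator ({0..} \<times> UNIV) z \<partial>lborel) \<partial>M)
      = ito_norm (\<lambda>z \<omega>. f z \<omega> - simple_eval L z \<omega>)" if "simple_ok F L" for L
    by (intro ito_norm_alt ito_measurable_diff fm simple_ito_measurable that)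
  show ?thesis
    unfolding walsh_integral_def ito_norm_alt[OF fm] using f by (auto simp: eq cong: conj_cong)
qed

lemma simple_int_diff:
  "simple_int W (L @ simple_scale (- 1) L') \<omega> = simple_int W L \<omega> - simple_int W L' \<omega>"
  by (simp add: simple_int_append simple_int_scale)

lemma simple_eval_diff:
  "simple_eval (L @ simple_scale (- 1) L') z \<omega> = simple_eval L z \<omega> - simple_eval L' z \<omega>"
  by (simp add: simple_eval_append simple_eval_scale)

lemma simple_ok_diff: "simple_ok F L \<Longrightarrow> simple_ok F L' \<Longrightarrow> simple_ok F (L @ simple_scale (- 1) L')"
  by (intro simple_ok_append simple_ok_scale)

lemma walsh_measurable: "walsh_integral M F W f I \<Longrightarrow> I \<in> borel_measurable M"
  by (simp add: walsh_integral_def)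

lemma walsh_predictable:
  "walsh_integral M F W f I \<Longrightarrow> (\<lambda>(z, \<omega>). f z \<omega>) \<in> borel_measurable (predictable M F)"
  by (simp add: walsh_integral_def)

text \<open>Compare with an approximating simple integral, use its isometry, and compare back: each
  comparison costs a factor 2. The resulting 4 in place of 1 only enlarges
  \<open>growth_const\<close>.\<close>

lemma walsh_integral_bound:
  assumes "walsh_integral M F W f I"
  shows "(\<integral>\<^sup>+\<omega>. ennreal ((I \<omega>)\<^sup>2) \<partial>M) \<le> 4 * ito_norm f"
proof -
  note f = walsh_predictable[OF assms]
  note fm = predictable_ito_measurable[OF f]
  from assms[unfolded walsh_integral_iff[OF f]] obtain S where I: "I \<in> borel_measurable M"
    and S: "\<And>n. simple_ok F (S n)"
    and S1: "(\<lambda>n. ito_norm (\<lambda>z \<omega>. f z \<omega> - simple_eval (S n) z \<omega>)) \<longlonglongrightarrow> 0"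
    and S2: "(\<lambda>n. \<integral>\<^sup>+\<omega>. ennreal ((I \<omega> - simple_int W (S n) \<omega>)\<^sup>2) \<partial>M) \<longlonglongrightarrow> 0"
    by auto
  let ?a = "\<lambda>n. \<integral>\<^sup>+\<omega>. ennreal ((I \<omega> - simple_int W (S n) \<omega>)\<^sup>2) \<partial>M"
  let ?b = "\<lambda>n. ito_norm (\<lambda>z \<omega>. f z \<omega> - simple_eval (S n) z \<omega>)"
  have le: "(\<integral>\<^sup>+\<omega>. ennreal ((I \<omega>)\<^sup>2) \<partial>M) \<le> 2 * ?a n + 2 * (2 * ?b n + 2 * ito_norm f)" for n
  proof -
    note Sm = simple_int_measurable[OF S[of n]]
    have "(\<integral>\<^sup>+\<omega>. ennreal ((I \<omega>)\<^sup>2) \<partial>M)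
        \<le> 2 * ?a n + 2 * (\<integral>\<^sup>+\<omega>. ennreal ((simple_int W (S n) \<omega>)\<^sup>2) \<partial>M)"
      using nn_integral_add_power2_le[of "\<lambda>\<omega>. I \<omega> - simple_int W (S n) \<omega>" M "simple_int W (S n)"] I Sm
      by simp
    also have "(\<integral>\<^sup>+\<omega>. ennreal ((simple_int W (S n) \<omega>)\<^sup>2) \<partial>M) = ito_norm (simple_eval (S n))"
      by (rule simple_isometry[OF S])
    also have "\<dots> \<le> 2 * ?b n + 2 * ito_norm f"
      using ito_norm_add[OF ito_measurable_diff[OF simple_ito_measurable[OF S[of n]] fm] fm]
      by (simp add: ito_norm_diff_commute[of f])
    finally show ?thesis by (simp add: mult_left_mono add_left_mono)
  qed
  have "(\<lambda>n. 2 * ?a n + 2 * (2 * ?b n + 2 * ito_norm f)) \<longlonglongrightarrow> 2 * 0 + 2 * (2 * 0 + 2 * ito_norm f)"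
    by (intro tendsto_add ennreal_tendsto_cmult tendsto_const S1 S2) auto
  from LIMSEQ_le_const[OF this] le
  have "(\<integral>\<^sup>+\<omega>. ennreal ((I \<omega>)\<^sup>2) \<partial>M) \<le> 2 * 0 + 2 * (2 * 0 + 2 * ito_norm f)" by blast
  thus ?thesis by (simp add: mult.assoc[symmetric])
qed

lemma walsh_integral_diff:
  assumes "walsh_integral M F W f I" "walsh_integral M F W g J"
  shows "walsh_integral M F W (\<lambda>z \<omega>. f z \<omega> - g z \<omega>) (\<lambda>\<omega>. I \<omega> - J \<omega>)"
proof -
  note f = walsh_predictable[OF assms(1)] and g = walsh_predictable[OF assms(2)]
  note fm = predictable_ito_measurable[OF f] and gm = predictable_ito_measurable[OF g]
  from assms(1)[unfolded walsh_integral_iff[OF f]] obtain S where fin1: "ito_norm f < \<infinity>"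
    and I: "I \<in> borel_measurable M" and S: "\<And>n. simple_ok F (S n)"
    and S1: "(\<lambda>n. ito_norm (\<lambda>z \<omega>. f z \<omega> - simple_eval (S n) z \<omega>)) \<longlonglongrightarrow> 0"
    and S2: "(\<lambda>n. \<integral>\<^sup>+\<omega>. ennreal ((I \<omega> - simple_int W (S n) \<omega>)\<^sup>2) \<partial>M) \<longlonglongrightarrow> 0"
    by auto
  from assms(2)[unfolded walsh_integral_iff[OF g]] obtain T where fin2: "ito_norm g < \<infinity>"
    and J: "J \<in> borel_measurable M" and T: "\<And>n. simple_ok F (T n)"
    and T1: "(\<lambda>n. ito_norm (\<lambda>z \<omega>. g z \<omega> - simple_eval (T n) z \<omega>)) \<longlonglongrightarrow> 0"
    and T2: "(\<lambda>n. \<integral>\<^sup>+\<omega>. ennreal ((J \<omega> - simple_int W (T n) \<omega>)\<^sup>2) \<partial>M) \<longlonglongrightarrow> 0"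
    by auto
  have pred: "(\<lambda>(z, \<omega>). f z \<omega> - g z \<omega>) \<in> borel_measurable (predictable M F)"
    using borel_measurable_diff[OF f g] by (simp add: case_prod_unfold)
  let ?L = "\<lambda>n. S n @ simple_scale (- 1) (T n)"
  have lim1: "(\<lambda>n. ito_norm (\<lambda>z \<omega>. (f z \<omega> - g z \<omega>) - simple_eval (?L n) z \<omega>)) \<longlonglongrightarrow> 0"
  proof (rule tendsto_sandwich[OF _ _ tendsto_const])
    show "(\<lambda>n. 2 * ito_norm (\<lambda>z \<omega>. f z \<omega> - simple_eval (S n) z \<omega>)
        + 2 * ito_norm (\<lambda>z \<omega>. g z \<omega> - simple_eval (T n) z \<omega>)) \<longlonglongrightarrow> 0"
      using tendsto_add[OF ennreal_tendsto_cmult[OF _ S1, of 2] ennreal_tendsto_cmult[OF _ T1, of 2]] by simp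
    have "ito_norm (\<lambda>z \<omega>. (f z \<omega> - g z \<omega>) - simple_eval (?L n) z \<omega>)
        \<le> 2 * ito_norm (\<lambda>z \<omega>. f z \<omega> - simple_eval (S n) z \<omega>)
          + 2 * ito_norm (\<lambda>z \<omega>. g z \<omega> - simple_eval (T n) z \<omega>)" for n
      using ito_norm_add[OF ito_measurable_diff[OF fm simple_ito_measurable[OF S[of n]]]
          ito_measurable_diff[OF simple_ito_measurable[OF T[of n]] gm]]
      by (simp add: simple_eval_diff algebra_simps ito_norm_diff_commute[of g])
    thus "\<forall>\<^sub>F n in sequentially. ito_norm (\<lambda>z \<omega>. (f z \<omega> - g z \<omega>) - simple_eval (?L n) z \<omega>)
        \<le> 2 * ito_norm (\<lambda>z \<omega>. f z \<omega> - simple_eval (S n) z \<omega>)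
          + 2 * ito_norm (\<lambda>z \<omega>. g z \<omega> - simple_eval (T n) z \<omega>)" by simp
  qed simp
  have lim2: "(\<lambda>n. \<integral>\<^sup>+\<omega>. ennreal (((I \<omega> - J \<omega>) - simple_int W (?L n) \<omega>)\<^sup>2) \<partial>M) \<longlonglongrightarrow> 0"
  proof (rule tendsto_sandwich[OF _ _ tendsto_const])
    show "(\<lambda>n. 2 * (\<integral>\<^sup>+\<omega>. ennreal ((I \<omega> - simple_int W (S n) \<omega>)\<^sup>2) \<partial>M)
        + 2 * (\<integral>\<^sup>+\<omega>. ennreal ((J \<omega> - simple_int W (T n) \<omega>)\<^sup>2) \<partial>M)) \<longlonglongrightarrow> 0"
      using tendsto_add[OF ennreal_tendsto_cmult[OF _ S2, of 2] ennreal_tendsto_cmult[OF _ T2, of 2]] by simp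
    have "(\<integral>\<^sup>+\<omega>. ennreal (((I \<omega> - J \<omega>) - simple_int W (?L n) \<omega>)\<^sup>2) \<partial>M)
        \<le> 2 * (\<integral>\<^sup>+\<omega>. ennreal ((I \<omega> - simple_int W (S n) \<omega>)\<^sup>2) \<partial>M)
          + 2 * (\<integral>\<^sup>+\<omega>. ennreal ((J \<omega> - simple_int W (T n) \<omega>)\<^sup>2) \<partial>M)" for n
      using nn_integral_add_power2_le[of "\<lambda>\<omega>. I \<omega> - simple_int W (S n) \<omega>" M
          "\<lambda>\<omega>. simple_int W (T n) \<omega> - J \<omega>"] I J simple_int_measurable[OF S[of n]] simple_int_measurable[OF T[of n]]
      by (simp add: simple_int_diff algebra_simps power2_commute[of "J _"])
    thus "\<forall>\<^sub>F n in sequentially. (\<integral>\<^sup>+\<omega>. ennreal (((I \<omega> - J \<omega>) - simple_int W (?L n) \<omega>)\<^sup>2) \<partial>M)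
        \<le> 2 * (\<integral>\<^sup>+\<omega>. ennreal ((I \<omega> - simple_int W (S n) \<omega>)\<^sup>2) \<partial>M)
          + 2 * (\<integral>\<^sup>+\<omega>. ennreal ((J \<omega> - simple_int W (T n) \<omega>)\<^sup>2) \<partial>M)" by simp
  qed simp
  have "ito_norm (\<lambda>z \<omega>. f z \<omega> - g z \<omega>) \<le> 2 * ito_norm f + 2 * ito_norm g"
    using ito_norm_add[OF fm ito_measurable_cmult[OF gm, of "- 1"]] ito_norm_cmult[OF gm, of "- 1"] by simp
  also have "\<dots> < \<infinity>" using fin1 fin2 by (simp add: ennreal_mult_less_top)
  finally have "ito_norm (\<lambda>z \<omega>. f z \<omega> - g z \<omega>) < \<infinity>" .
  moreover have "(\<lambda>\<omega>. I \<omega> - J \<omega>) \<in> borel_measurable M" using I J by simp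
  moreover have "\<forall>n. simple_ok F (?L n)" using simple_ok_diff[OF S T] by blast
  ultimately show ?thesis unfolding walsh_integral_iff[OF pred] using lim1 lim2
    by (intro conjI exI[of _ ?L])
qed

text \<open>Used for adaptedness: if the integrand vanishes after t, stopping an approximant at t
  does not increase its error, and the stopped integral is \<open>F t\<close>-measurable. Terms with
  \<open>a \<ge> t\<close> are dropped so that the remaining intervals stay nonempty.\<close>

definition simple_stop :: "real \<Rightarrow> ('w, real^'d) simple_term list \<Rightarrow> ('w, real^'d) simple_term list" where
  "simple_stop t L = map (\<lambda>(X, a, b, A). (X, a, min b t, A)) (filter (\<lambda>(X, a, b, A). a < t) L)"

lemma simple_stop_ok: "simple_ok F L \<Longrightarrow> simple_ok F (simple_stop t L)"
  unfolding simple_ok_def simple_stop_def by fastforce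

lemma simple_stop_eval: "simple_eval (simple_stop t L) z \<omega> = (if fst z \<le> t then simple_eval L z \<omega> else 0)"
proof (induction L)
  case (Cons p L)
  obtain X a b A where p: "p = (X, a, b, A)" by (cases p) auto
  show ?case using Cons by (cases z) (auto simp: p simple_eval_def simple_stop_def indicator_def)
qed (simp add: simple_eval_def simple_stop_def)

lemma simple_stop_adapted:
  assumes "simple_ok F L" "0 \<le> t"
  shows "simple_int W (simple_stop t L) \<in> borel_measurable (F t)"
proof -
  let ?L = "simple_stop t L"
  note ok = simple_stop_ok[OF assms(1), of t]
  have "fst (?L ! i) \<in> borel_measurable (F t)" "W (slab (?L ! i)) \<in> borel_measurable (F t)"
    if i: "i < length ?L" for i
  proof -
    have "?L ! i \<in> set ?L" using i by simp
    hence le: "fst (snd (?L ! i)) \<le> t" "fst (snd (snd (?L ! i))) \<le> t"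
      unfolding simple_stop_def by auto
    show "fst (?L ! i) \<in> borel_measurable (F t)"
      using measurable_F_mono[OF le(1) simple_okD(4)[OF ok i]] .
    show "W (slab (?L ! i)) \<in> borel_measurable (F t)"
      using simple_slab_wn[OF ok i] assms(2) le(2) simple_okD(1)[OF ok i]
      by (intro W_adapted) auto
  qed
  thus ?thesis unfolding simple_int_sum[abs_def] by (intro borel_measurable_sum borel_measurable_times) auto
qed

text \<open>Stopped approximants with error \<open>(1 / 4) ^ n\<close> have integrals that form a
  geometric Cauchy sequence by the isometry. Their \<open>seq_limit\<close> is measurable for
  \<open>F t\<close> itself, with no completion of the filtration.\<close>

lemma walsh_integral_exists:
  assumes f: "(\<lambda>(z, \<omega>). f z \<omega>) \<in> borel_measurable (predictable M F)" and fin: "ito_norm f < \<infinity>"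
    and t: "0 \<le> t" and zero: "\<And>z \<omega>. fst z > t \<Longrightarrow> f z \<omega> = 0"
  shows "\<exists>I. walsh_integral M F W f I \<and> I \<in> borel_measurable (F t)"
proof -
  note fm = predictable_ito_measurable[OF f]
  have "\<exists>L. simple_ok F L \<and> ito_norm (\<lambda>z \<omega>. f z \<omega> - simple_eval L z \<omega>) \<le> ennreal ((1 / 4) ^ n)" for n :: nat
    using simple_approx_predictable[OF f fin] unfolding simple_approx_def by (meson zero_less_power zero_less_divide_1_iff zero_less_numeral)
  then obtain L where L: "\<And>n. simple_ok F (L n)"
    "\<And>n. ito_norm (\<lambda>z \<omega>. f z \<omega> - simple_eval (L n) z \<omega>) \<le> ennreal ((1 / 4) ^ n)" by metis
  define S where "S n = simple_stop t (L n)" for n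
  have S: "simple_ok F (S n)" for n unfolding S_def by (rule simple_stop_ok[OF L(1)])
  have Sle: "ito_norm (\<lambda>z \<omega>. f z \<omega> - simple_eval (S n) z \<omega>) \<le> ennreal ((1 / 4) ^ n)" for n
    unfolding S_def by (rule order.trans[OF ito_norm_mono L(2)]) (simp add: simple_stop_eval zero)
  have ad: "simple_int W (S n) \<in> borel_measurable (F t)" for n
    unfolding S_def by (rule simple_stop_adapted[OF L(1) t])
  note Im = simple_int_measurable[OF S]
  have cauchy: "(\<integral>\<^sup>+\<omega>. ennreal ((simple_int W (S m) \<omega> - simple_int W (S n) \<omega>)\<^sup>2) \<partial>M) \<le> ennreal (4 * (1 / 4) ^ n)"
    if "n \<le> m" for n m
  proof -
    have "(\<integral>\<^sup>+\<omega>. ennreal ((simple_int W (S m) \<omega> - simple_int W (S n) \<omega>)\<^sup>2) \<partial>M)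
        = ito_norm (\<lambda>z \<omega>. simple_eval (S m) z \<omega> - simple_eval (S n) z \<omega>)"
      using simple_isometry[OF simple_ok_diff[OF S S], of m n]
      by (simp add: simple_int_diff simple_eval_diff[abs_def])
    also have "\<dots> \<le> 2 * ito_norm (\<lambda>z \<omega>. simple_eval (S m) z \<omega> - f z \<omega>)
        + 2 * ito_norm (\<lambda>z \<omega>. f z \<omega> - simple_eval (S n) z \<omega>)"
      by (intro ito_norm_triangle simple_ito_measurable S fm)
    also have "\<dots> \<le> 2 * ennreal ((1 / 4) ^ n) + 2 * ennreal ((1 / 4) ^ n)"
    proof (intro add_mono mult_left_mono Sle)
      have "ito_norm (\<lambda>z \<omega>. simple_eval (S m) z \<omega> - f z \<omega>) \<le> ennreal ((1 / 4) ^ m)"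
        using Sle[of m] by (subst ito_norm_diff_commute)
      also have "\<dots> \<le> ennreal ((1 / 4) ^ n)"
        by (intro ennreal_leI power_decreasing that) auto
      finally show "ito_norm (\<lambda>z \<omega>. simple_eval (S m) z \<omega> - f z \<omega>) \<le> ennreal ((1 / 4) ^ n)" .
    qed auto
    also have "\<dots> = ennreal (4 * (1 / 4) ^ n)"
      using ennreal_quarters[of "4 * (1 / 4) ^ n"] by simp
    finally show ?thesis .
  qed
  define I where "I = seq_limit (\<lambda>n. simple_int W (S n))"
  have I: "I \<in> borel_measurable M" "I \<in> borel_measurable (F t)"
    unfolding I_def using Im ad by measurable
  have bd: "(\<integral>\<^sup>+\<omega>. ennreal ((I \<omega> - simple_int W (S n) \<omega>)\<^sup>2) \<partial>M) \<le> ennreal (4 * (1 / 4) ^ n)" for n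
    unfolding I_def by (rule seq_limit_power2_bound[OF Im _ _ cauchy]) auto
  have geo: "(\<lambda>n. ennreal (c * (1 / 4) ^ n)) \<longlonglongrightarrow> 0" for c :: real
  proof -
    have "(\<lambda>n. c * (1 / 4) ^ n) \<longlonglongrightarrow> c * 0"
      by (intro tendsto_intros LIMSEQ_power_zero) simp
    from tendsto_ennrealI[OF this] show ?thesis by simp
  qed
  have "(\<lambda>n. \<integral>\<^sup>+\<omega>. ennreal ((I \<omega> - simple_int W (S n) \<omega>)\<^sup>2) \<partial>M) \<longlonglongrightarrow> 0"
    by (rule tendsto_sandwich[OF always_eventually always_eventually tendsto_const geo[of 4]])
      (intro allI zero_le bd)+
  moreover have "(\<lambda>n. ito_norm (\<lambda>z \<omega>. f z \<omega> - simple_eval (S n) z \<omega>)) \<longlonglongrightarrow> 0"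
    by (rule tendsto_sandwich[OF always_eventually always_eventually tendsto_const geo[of 1, unfolded mult_1]])
      (intro allI zero_le Sle)+
  ultimately have "walsh_integral M F W f I"
    unfolding walsh_integral_iff[OF f] using fin I(1) S by blast
  thus ?thesis using I(2) by blast
qed

section \<open>Measurability with respect to the predictable sigma-algebra\<close>

lemma predictable_Borel: "fst \<in> predictable M F \<rightarrow>\<^sub>M (borel :: (real \<times> (real^'d)) measure)"
proof -
  have rects: "R \<in> pred_rects \<Longrightarrow> R \<in> sets (predictable M F)" for R
    unfolding sets_predictable by (rule sigma_sets.Basic)
  have M0: "space M \<in> sets (F 0)" using sets.top[of "F 0"] by (simp add: space_F)
  have pos: "({0<..b} \<times> A) \<times> space M \<in> sets (predictable M F)" if "A \<in> sets lborel" for A :: "(real^'d) set" and b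
  proof (cases "0 < b")
    case True
    thus ?thesis using that M0 unfolding pred_rects_def by (intro rects) (unfold pred_rects_def, blast)
  qed simp
  have zero: "({0} \<times> A) \<times> space M \<in> sets (predictable M F)" if "A \<in> sets lborel" for A :: "(real^'d) set"
    using that M0 by (intro rects) (unfold pred_rects_def, blast)
  have le: "{p \<in> space (predictable M F). fst (fst p :: real \<times> (real^'d)) \<le> c} \<in> sets (predictable M F)" for c
  proof -
    define Z where "Z = ({0::real} \<times> (UNIV :: (real^'d) set)) \<times> space M"
    define R where "R = ({0<..c} \<times> (UNIV :: (real^'d) set)) \<times> space M"
    have ZR: "Z \<in> sets (predictable M F)" "R \<in> sets (predictable M F)"
      unfolding Z_def R_def by (intro zero pos; simp)+
    have eq: "{p \<in> space (predictable M F). fst (fst p) \<le> c} = (if c < 0 then {} else Z \<union> R)"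
      by (auto simp: space_predictable Z_def R_def)
    show ?thesis unfolding eq using ZR by simp
  qed
  have time: "(\<lambda>p :: (real \<times> (real^'d)) \<times> 'w. fst (fst p)) \<in> borel_measurable (predictable M F)"
    unfolding borel_measurable_iff_le using le by blast
  have spc: "(\<lambda>p :: (real \<times> (real^'d)) \<times> 'w. snd (fst p)) \<in> borel_measurable (predictable M F)"
  proof (rule measurableI)
    fix A :: "(real^'d) set" assume A: "A \<in> sets borel"
    have "(\<lambda>p :: (real \<times> (real^'d)) \<times> 'w. snd (fst p)) -` A \<inter> space (predictable M F)
        = (({0} \<times> A) \<times> space M) \<union> (\<Union>n. ({0<..real n} \<times> A) \<times> space M)"
      by (auto simp: space_predictable less_le real_arch_simple)
    also have "\<dots> \<in> sets (predictable M F)"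
      using A by (intro sets.Un sets.countable_UN zero) (auto intro: pos)
    finally show "(\<lambda>p :: (real \<times> (real^'d)) \<times> 'w. snd (fst p)) -` A \<inter> space (predictable M F) \<in> sets (predictable M F)" .
  qed simp
  have "(\<lambda>p :: (real \<times> (real^'d)) \<times> 'w. (fst (fst p), snd (fst p))) \<in> predictable M F \<rightarrow>\<^sub>M borel \<Otimes>\<^sub>M borel"
    by (intro measurable_Pair time spc)
  thus ?thesis by (simp add: borel_prod)
qed

lemma borel_fst: "fst \<in> (borel :: (real \<times> (real^'d)) measure) \<rightarrow>\<^sub>M borel"
  unfolding borel_prod[symmetric] by measurable

lemma predictable_time: "(\<lambda>p :: (real \<times> (real^'d)) \<times> 'w. fst (fst p)) \<in> borel_measurable (predictable M F)"
  by (rule measurable_compose[OF predictable_Borel borel_fst])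

text \<open>An \<open>F a\<close>-measurable variable switched on strictly after time a is
  predictable, since the slabs \<open>{a<..a + Suc n}\<close> over an event of \<open>F a\<close>
  are generators and exhaust the later times.\<close>

lemma predictable_after:
  assumes X: "X \<in> borel_measurable (F a)" and a: "0 \<le> a"
  shows "(\<lambda>p :: (real \<times> (real^'d)) \<times> 'w. if fst (fst p) > a then X (snd p) else (0 :: real))
     \<in> borel_measurable (predictable M F)"
proof (rule measurableI)
  fix B :: "real set" assume B: "B \<in> sets borel"
  let ?f = "\<lambda>p :: (real \<times> (real^'d)) \<times> 'w. if fst (fst p) > a then X (snd p) else (0 :: real)"
  define E where "E = X -` B \<inter> space M"
  have E: "E \<in> sets (F a)" unfolding E_def using measurable_sets[OF X B] by (simp add: space_F)
  have slab: "({a<..a + real (Suc n)} \<times> (UNIV :: (real^'d) set)) \<times> E \<in> sets (predictable M F)" for n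
  proof -
    have "({a<..a + real (Suc n)} \<times> (UNIV :: (real^'d) set)) \<times> E \<in> pred_rects"
      unfolding pred_rects_def using a E by (intro UnI1 CollectI exI conjI) auto
    thus ?thesis unfolding sets_predictable by (rule sigma_sets.Basic)
  qed
  have "\<exists>n. s \<le> a + real (Suc n)" for s :: real
  proof -
    obtain n where "s - a \<le> real n" using real_arch_simple by blast
    thus ?thesis by (intro exI[of _ n]) simp
  qed
  hence un: "?f -` B \<inter> {p. fst (fst p) > a} \<inter> space (predictable M F) = (\<Union>n. ({a<..a + real (Suc n)} \<times> UNIV) \<times> E)"
    using a by (auto simp: space_predictable E_def)
  have early: "{p \<in> space (predictable M F). fst (fst p :: real \<times> (real^'d)) \<le> a} \<in> sets (predictable M F)"
    using predictable_time by (simp add: borel_measurable_iff_le)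
  have "?f -` B \<inter> space (predictable M F) = (\<Union>n. ({a<..a + real (Suc n)} \<times> UNIV) \<times> E)
      \<union> (if 0 \<in> B then {p \<in> space (predictable M F). fst (fst p) \<le> a} else {})"
    unfolding un[symmetric] by (auto split: if_splits)
  also have "\<dots> \<in> sets (predictable M F)"
    using slab early by (intro sets.Un sets.countable_UN) auto
  finally show "?f -` B \<inter> space (predictable M F) \<in> sets (predictable M F)" .
qed simp

text \<open>Reduces the joint measurability clause in \<open>mild_solution\<close> to the
  predictability clause, and makes sections at fixed \<open>(t, x)\<close> measurable.\<close>

lemma predictable_joint:
  fixes f :: "(real \<times> (real^'d)) \<times> 'w \<Rightarrow> real"
  assumes "f \<in> borel_measurable (predictable M F)"
  shows "f \<in> borel_measurable (restrict_space lborel ({0..} \<times> (UNIV :: (real^'d) set)) \<Otimes>\<^sub>M M)"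
proof -
  let ?D = "{0..} \<times> UNIV :: (real \<times> (real^'d)) set"
  let ?N = "restrict_space lborel ?D \<Otimes>\<^sub>M M"
  have D: "?D \<in> sets borel" by (rule slab_borel) auto
  have sp: "space ?N = ?D \<times> space M" by (simp add: space_pair_measure space_restrict_space)
  have slab: "R \<in> sets (restrict_space lborel ?D)" if "R \<in> sets borel" "R \<subseteq> ?D" for R
    using that D by (auto simp: sets_restrict_space)
  have gen: "R \<in> sets ?N" if "R \<in> pred_rects" for R
  proof -
    from that consider
      (pos) a b A E where "R = ({a<..b} \<times> A) \<times> E" "0 \<le> a" "A \<in> sets lborel" "E \<in> sets (F a)"
      | (zero) A E where "R = ({0} \<times> A) \<times> E" "A \<in> sets lborel" "E \<in> sets (F 0)"
      unfolding pred_rects_def by auto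
    thus ?thesis
    proof cases
      case pos
      show ?thesis unfolding pos(1) using pos
        by (intro pair_measureI slab slab_borel) (auto dest: sets_F)
    next
      case zero
      show ?thesis unfolding zero(1) using zero
        by (intro pair_measureI slab slab_borel) (auto dest: sets_F)
    qed
  qed
  have sub: "P \<in> sets ?N" if "P \<in> sets (predictable M F)" for P
  proof -
    have "P \<in> sigma_sets (?D \<times> space M) pred_rects" using that by (simp only: sets_predictable)
    thus ?thesis
    proof (induction rule: sigma_sets.induct)
      case (Basic R) thus ?case by (rule gen)
    next
      case (Compl R)
      have "?D \<times> space M \<in> sets ?N" using sets.top[of ?N] unfolding sp .
      thus ?case using Compl by (intro sets.Diff)
    next
      case (Union A) thus ?case by (intro sets.countable_UN) auto
    qed simp
  qed
  show ?thesis
  proof (rule measurableI)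
    fix B :: "real set" assume "B \<in> sets borel"
    from sub[OF measurable_sets[OF assms this]]
    show "f -` B \<inter> space ?N \<in> sets ?N" unfolding sp space_predictable .
  qed simp
qed

end

section \<open>The stochastic convolution\<close>

locale spde = frac_heat \<nu> \<alpha> \<beta> G + walsh M F W
  for \<nu> \<alpha> \<beta> :: real and G :: "real \<Rightarrow> real^'d \<Rightarrow> real" and M :: "'w measure" and F
    and W :: "(real \<times> (real^'d)) set \<Rightarrow> 'w \<Rightarrow> real"
begin

definition field_predictable :: "(real \<Rightarrow> real^'d \<Rightarrow> 'w \<Rightarrow> real) \<Rightarrow> bool" where
  "field_predictable v \<longleftrightarrow> (\<lambda>p. v (fst (fst p)) (snd (fst p)) (snd p)) \<in> borel_measurable (predictable M F)"

definition integrand :: "real \<Rightarrow> real^'d \<Rightarrow> (real \<Rightarrow> real^'d \<Rightarrow> 'w \<Rightarrow> real) \<Rightarrow> real \<times> (real^'d) \<Rightarrow> 'w \<Rightarrow> real" where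
  "integrand t x v z \<omega> = G0 ((t, x) - z) * v (fst z) (snd z) \<omega>"

lemma integrand_alt:
  "integrand t x v = (\<lambda>(s, y) \<omega>. if s < t then G (t - s) (x - y) * v s y \<omega> else 0)"
  by (auto simp: integrand_def G0_def fun_eq_iff)

lemma field_section:
  assumes "field_predictable v" "0 \<le> t"
  shows "v t x \<in> borel_measurable M"
proof -
  have "(t, x) \<in> space (restrict_space lborel ({0..} \<times> (UNIV :: (real^'d) set)))"
    using assms(2) by (simp add: space_restrict_space)
  from measurable_Pair2[OF predictable_joint[OF assms(1)[unfolded field_predictable_def]] this]
  show ?thesis by simp
qed

lemma integrand_predictable:
  assumes "field_predictable v"
  shows "(\<lambda>(z, \<omega>). integrand t x v z \<omega>) \<in> borel_measurable (predictable M F)"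
proof -
  have "(\<lambda>p :: (real \<times> (real^'d)) \<times> 'w. G0 ((t, x) - fst p)) \<in> borel_measurable (predictable M F)"
    by (rule measurable_compose[OF predictable_Borel]) measurable
  thus ?thesis
    unfolding integrand_def case_prod_unfold
    by (intro borel_measurable_times assms[unfolded field_predictable_def])
qed

lemma integrand_measurable: "field_predictable v \<Longrightarrow> ito_measurable (integrand t x v)"
  by (rule predictable_ito_measurable[OF integrand_predictable])

text \<open>Writing \<open>exp (\<theta> * s) = exp (\<theta> * t) * exp (- \<theta> * (t -
  s))\<close> moves the weight onto the kernel, where \<open>G0_weighted_L2\<close> applies after
  the reflection \<open>z \<mapsto> (t, x) - z\<close>.\<close>

lemma integrand_bound:
  assumes v: "field_predictable v" and \<theta>: "\<theta> > 0" and B: "B \<ge> 0"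
    and bound: "\<And>s y. 0 \<le> s \<Longrightarrow> s < t \<Longrightarrow> (\<integral>\<^sup>+\<omega>. ennreal ((v s y \<omega>)\<^sup>2) \<partial>M) \<le> ennreal (B * exp (\<theta> * s))"
  shows "ito_norm (integrand t x v) \<le> ennreal (B * (kernel_const * \<theta> powr (\<gamma> - 1)) * exp (\<theta> * t))"
proof -
  let ?f = "\<lambda>w. ennreal ((G0 w)\<^sup>2 * exp (- \<theta> * fst w))"
  have [measurable]: "?f \<in> borel_measurable borel" by measurable
  have "ito_norm (integrand t x v)
      \<le> (\<integral>\<^sup>+z. ennreal (B * exp (\<theta> * t)) * ?f ((t, x) + (- 1) *\<^sub>R z) \<partial>lborel)"
    unfolding ito_norm_alt'[OF integrand_measurable[OF v]]
  proof (rule nn_integral_mono)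
    fix z :: "real \<times> (real^'d)"
    obtain s y where z: "z = (s, y)" by (cases z)
    show "(\<integral>\<^sup>+\<omega>. ennreal ((integrand t x v z \<omega>)\<^sup>2) \<partial>M) * indicator times_pos z
        \<le> ennreal (B * exp (\<theta> * t)) * ?f ((t, x) + (- 1) *\<^sub>R z)"
    proof (cases "0 < s \<and> s < t")
      case True
      have [measurable]: "v s y \<in> borel_measurable M" using True by (intro field_section[OF v]) auto
      have "(\<integral>\<^sup>+\<omega>. ennreal ((integrand t x v z \<omega>)\<^sup>2) \<partial>M)
          = ennreal ((G0 ((t, x) - z))\<^sup>2) * (\<integral>\<^sup>+\<omega>. ennreal ((v s y \<omega>)\<^sup>2) \<partial>M)"
        unfolding integrand_def
        by (subst nn_integral_cmult[symmetric]) (auto simp: z power_mult_distrib ennreal_mult')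
      also have "\<dots> \<le> ennreal ((G0 ((t, x) - z))\<^sup>2) * ennreal (B * exp (\<theta> * s))"
        using True by (intro mult_left_mono bound) auto
      also have "\<dots> = ennreal ((G0 ((t, x) - z))\<^sup>2 * (B * exp (\<theta> * s)))"
        by (simp add: ennreal_mult')
      also have "(G0 ((t, x) - z))\<^sup>2 * (B * exp (\<theta> * s))
          = B * exp (\<theta> * t) * ((G0 ((t, x) + (- 1) *\<^sub>R z))\<^sup>2 * exp (- \<theta> * fst ((t, x) + (- 1) *\<^sub>R z)))"
        by (simp add: z exp_diff exp_add exp_minus algebra_simps)
      also have "ennreal \<dots> = ennreal (B * exp (\<theta> * t)) * ?f ((t, x) + (- 1) *\<^sub>R z)"
        using B by (simp add: ennreal_mult')
      finally show ?thesis using True by (simp add: z)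
    next
      case False
      hence "s \<le> 0 \<or> t \<le> s" by auto
      thus ?thesis
      proof
        assume "t \<le> s"
        hence "integrand t x v z \<omega> = 0" for \<omega> by (simp add: integrand_def G0_def z)
        thus ?thesis by simp
      qed (simp add: z)
    qed
  qed
  also have "\<dots> = ennreal (B * exp (\<theta> * t)) * (\<integral>\<^sup>+z. ?f ((t, x) + (- 1) *\<^sub>R z) \<partial>lborel)"
    by (rule nn_integral_cmult) measurable
  also have "(\<integral>\<^sup>+z. ?f ((t, x) + (- 1) *\<^sub>R z) \<partial>lborel) = (\<integral>\<^sup>+w. ?f w \<partial>lborel)"
    by (subst nn_integral_lborel_affine[of ?f "-1" "(t, x)"]) auto
  also have "ennreal (B * exp (\<theta> * t)) * \<dots> \<le> ennreal (B * exp (\<theta> * t)) * ennreal (kernel_const * \<theta> powr (\<gamma> - 1))"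
    by (intro mult_left_mono G0_weighted_L2 \<theta>) auto
  also have "\<dots> = ennreal (B * (kernel_const * \<theta> powr (\<gamma> - 1)) * exp (\<theta> * t))"
    using B kernel_const_nonneg by (simp add: ennreal_mult'[symmetric] mult_ac)
  finally show ?thesis .
qed

section \<open>Mean-square continuity of the convolution\<close>

definition trunc_kernel :: "real \<Rightarrow> real \<times> (real^'d) \<Rightarrow> real" where
  "trunc_kernel T z = G0 z * indicator {..T} (fst z)"

lemma trunc_kernel_measurable [measurable]: "trunc_kernel T \<in> borel_measurable borel"
  unfolding trunc_kernel_def by measurable

text \<open>The squared L2 modulus of continuity of the truncated kernel. It depends on the shift
  alone, which makes the continuity estimates uniform over the unbounded space variable.\<close>

definition modulus :: "real \<Rightarrow> real \<times> (real^'d) \<Rightarrow> ennreal" where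
  "modulus T h = (\<integral>\<^sup>+z. ennreal ((trunc_kernel T (h + z) - trunc_kernel T z)\<^sup>2) \<partial>lborel)"

lemma modulus_small:
  fixes e :: real
  assumes "e > 0" shows "\<exists>d>0. \<forall>h. norm h < d \<longrightarrow> modulus T h \<le> ennreal e"
proof (rule ccontr)
  assume "\<not> ?thesis"
  hence "\<exists>h. norm h < 1 / real (Suc n) \<and> modulus T h > ennreal e" for n
    by (meson not_le of_nat_0_less_iff zero_less_Suc zero_less_divide_1_iff)
  then obtain h where h: "\<And>n. norm (h n) < 1 / real (Suc n)" "\<And>n. modulus T (h n) > ennreal e" by metis
  have "h \<longlonglongrightarrow> 0"
  proof (rule Lim_null_comparison)
    show "\<forall>\<^sub>F n in sequentially. norm (h n) \<le> inverse (real (Suc n))"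
      using h(1) by (simp add: less_imp_le inverse_eq_divide)
  qed (rule LIMSEQ_inverse_real_of_nat)
  hence "(\<lambda>n. modulus T (h n)) \<longlonglongrightarrow> 0"
    unfolding modulus_def trunc_kernel_def by (rule G0_translation_continuous)
  hence "\<forall>\<^sub>F n in sequentially. modulus T (h n) < ennreal e"
    using assms by (intro order_tendstoD(2)) auto
  then obtain n where "modulus T (h n) < ennreal e"
    using eventually_happens' sequentially_bot by blast
  thus False using h(2)[of n] by simp
qed

text \<open>After the moment of the field is bounded, the reflection \<open>z = (t', x') - w\<close>
  turns the difference of the two kernels into a pure translation by
  \<open>(t, x) - (t', x')\<close>.\<close>

lemma integrand_diff_bound:
  assumes v: "field_predictable v" and T: "t \<le> T" "t' \<le> T"
    and bound: "\<And>s y. 0 \<le> s \<Longrightarrow> s \<le> T \<Longrightarrow> (\<integral>\<^sup>+\<omega>. ennreal ((v s y \<omega>)\<^sup>2) \<partial>M) \<le> ennreal B"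
  shows "ito_norm (\<lambda>z \<omega>. integrand t x v z \<omega> - integrand t' x' v z \<omega>)
    \<le> ennreal B * modulus T ((t, x) - (t', x'))"
proof -
  let ?f = "\<lambda>z. ennreal ((trunc_kernel T ((t, x) - z) - trunc_kernel T ((t', x') - z))\<^sup>2)"
  have [measurable]: "?f \<in> borel_measurable borel" by measurable
  have "ito_norm (\<lambda>z \<omega>. integrand t x v z \<omega> - integrand t' x' v z \<omega>)
      \<le> (\<integral>\<^sup>+z. ennreal B * ?f z \<partial>lborel)"
    unfolding ito_norm_alt'[OF ito_measurable_diff[OF integrand_measurable[OF v] integrand_measurable[OF v]]]
  proof (rule nn_integral_mono)
    fix z :: "real \<times> (real^'d)"
    obtain s y where z: "z = (s, y)" by (cases z)
    \<comment> \<open>Here \<open>t - s\<close> and \<open>t' - s\<close> are below T, so the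
      truncation is invisible.\<close>
    have diff: "integrand t x v z \<omega> - integrand t' x' v z \<omega>
        = (trunc_kernel T ((t, x) - z) - trunc_kernel T ((t', x') - z)) * v s y \<omega>" if "0 < s" for \<omega>
      using that T by (simp add: integrand_def trunc_kernel_def z left_diff_distrib)
    show "(\<integral>\<^sup>+\<omega>. ennreal ((integrand t x v z \<omega> - integrand t' x' v z \<omega>)\<^sup>2) \<partial>M) * indicator times_pos z
        \<le> ennreal B * ?f z"
    proof (cases "0 < s \<and> s \<le> T")
      case True
      have [measurable]: "v s y \<in> borel_measurable M" using True by (intro field_section[OF v]) auto
      have "(\<integral>\<^sup>+\<omega>. ennreal ((integrand t x v z \<omega> - integrand t' x' v z \<omega>)\<^sup>2) \<partial>M)
          = (\<integral>\<^sup>+\<omega>. ?f z * ennreal ((v s y \<omega>)\<^sup>2) \<partial>M)"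
        using True by (simp add: diff power_mult_distrib ennreal_mult')
      also have "\<dots> = ?f z * (\<integral>\<^sup>+\<omega>. ennreal ((v s y \<omega>)\<^sup>2) \<partial>M)"
        by (rule nn_integral_cmult) measurable
      also have "\<dots> \<le> ?f z * ennreal B" using True by (intro mult_left_mono bound) auto
      finally show ?thesis using True by (simp add: z mult.commute)
    next
      case False
      hence "s \<le> 0 \<or> T < s" by auto
      thus ?thesis
      proof
        assume "T < s"
        hence "integrand t x v z \<omega> = 0" "integrand t' x' v z \<omega> = 0" for \<omega>
          using T by (simp_all add: integrand_def G0_def z)
        thus ?thesis by simp
      qed (simp add: z)
    qed
  qed
  also have "\<dots> = ennreal B * (\<integral>\<^sup>+z. ?f z \<partial>lborel)" by (rule nn_integral_cmult) measurable
  also have "(\<integral>\<^sup>+z. ?f z \<partial>lborel) = (\<integral>\<^sup>+w. ?f ((t', x') + (- 1) *\<^sub>R w) \<partial>lborel)"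
    by (subst nn_integral_lborel_affine[of ?f "-1" "(t', x')"]) auto
  also have "\<dots> = modulus T ((t, x) - (t', x'))"
  proof -
    have "a - (a' + (- 1) *\<^sub>R w) = (a - a') + w" "a' - (a' + (- 1) *\<^sub>R w) = w"
      for a a' w :: "real \<times> (real^'d)" by simp_all
    thus ?thesis unfolding modulus_def by (simp only:)
  qed
  finally show ?thesis .
qed

text \<open>Left end point of the grid cell \<open>(k / m, (k + 1) / m] \<times> \<dots>\<close> containing a space-time point:
  sampling strictly in the past makes the discretised field predictable.\<close>
definition grid_index :: "nat \<Rightarrow> real \<times> (real^'d) \<Rightarrow> int \<times> ('d \<Rightarrow> int)" where
  "grid_index m z = (\<lceil>real m * fst z\<rceil> - 1, \<lambda>i. \<lfloor>real m * snd z $ i\<rfloor>)"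

definition grid_point :: "nat \<Rightarrow> int \<times> ('d \<Rightarrow> int) \<Rightarrow> real \<times> (real^'d)" where
  "grid_point m k = (real_of_int (fst k) / real m, \<chi> i. real_of_int (snd k i) / real m)"

lemma grid_index_measurable: "grid_index m \<in> borel \<rightarrow>\<^sub>M count_space UNIV"
proof (subst measurable_count_space_eq_countable, simp, intro conjI ballI)
  fix k :: "int \<times> ('d \<Rightarrow> int)"
  have [measurable]: "(\<lambda>z :: real \<times> (real^'d). snd z $ i) \<in> borel_measurable borel" for i
    by (intro borel_measurable_continuous_onI continuous_intros)
  have "grid_index m -` {k} \<inter> space borel
      = {z \<in> space borel. \<lceil>real m * fst z\<rceil> - 1 = fst k \<and> (\<forall>i. \<lfloor>real m * snd z $ i\<rfloor> = snd k i)}"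
    by (auto simp: grid_index_def)
  also have "\<dots> \<in> sets borel" by measurable
  finally show "grid_index m -` {k} \<inter> space borel \<in> sets borel" .
qed simp

lemma grid_point_close:
  assumes m: "m > 0" and t: "fst z > 0"
  defines "a \<equiv> grid_point m (grid_index m z)"
  shows "0 \<le> fst a" "fst a < fst z" "fst (grid_index m z) \<ge> 0"
    "norm (z - a) \<le> (1 + real CARD('d)) / real m"
proof -
  \<comment> \<open>The ceiling minus one lies strictly below its argument even at an integer, where
    the floor would sample the present.\<close>
  have k1: "real_of_int (\<lceil>real m * fst z\<rceil> - 1) < real m * fst z" by linarith
  have k2: "real m * fst z \<le> real_of_int (\<lceil>real m * fst z\<rceil> - 1) + 1" by linarith
  have k3: "\<lceil>real m * fst z\<rceil> - 1 \<ge> 0" using m t by simp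
  have fa: "fst a = real_of_int (\<lceil>real m * fst z\<rceil> - 1) / real m"
    by (simp add: a_def grid_point_def grid_index_def)
  show "fst (grid_index m z) \<ge> 0" using k3 by (simp add: grid_index_def)
  show "0 \<le> fst a" unfolding fa using k3 m by (intro divide_nonneg_nonneg) auto
  show lt: "fst a < fst z" unfolding fa using k1 m by (simp add: field_simps)
  have "fst z - fst a \<le> 1 / real m" unfolding fa using k2 m by (simp add: field_simps)
  hence n1: "norm (fst z - fst a) \<le> 1 / real m" using lt by simp
  have comp: "\<bar>(snd z - snd a) $ i\<bar> \<le> 1 / real m" for i
  proof -
    define r where "r = real m * snd z $ i - real_of_int \<lfloor>real m * snd z $ i\<rfloor>"
    have "0 \<le> r" "r \<le> 1" unfolding r_def by linarith+
    moreover have "(snd z - snd a) $ i = r / real m"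
      using m by (simp add: a_def grid_point_def grid_index_def diff_divide_distrib r_def)
    ultimately show ?thesis by (simp add: abs_divide divide_right_mono)
  qed
  have "norm (snd z - snd a) \<le> (\<Sum>i\<in>UNIV. \<bar>(snd z - snd a) $ i\<bar>)" by (rule norm_le_l1_cart)
  also have "\<dots> \<le> (\<Sum>i\<in>(UNIV::'d set). 1 / real m)" by (intro sum_mono comp)
  finally have n2: "norm (snd z - snd a) \<le> real CARD('d) / real m" by simp
  have "norm (z - a) \<le> norm (fst z - fst a) + norm (snd z - snd a)"
    by (metis fst_diff norm_Pair_le prod.collapse snd_diff)
  also have "\<dots> \<le> (1 + real CARD('d)) / real m"
    using n1 n2 by (simp add: add_divide_distrib)
  finally show "norm (z - a) \<le> (1 + real CARD('d)) / real m" .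
qed

text \<open>There are countably many cells, and on each the field is one random variable, known at
  the grid time and used only after it. The guard on the index keeps grid times nonnegative.\<close>

lemma sampled_field_predictable:
  assumes m: "m > 0" and I: "\<And>t x. 0 \<le> t \<Longrightarrow> I t x \<in> borel_measurable (F t)"
  shows "(\<lambda>p. if fst (fst p) > 0 then
      (case grid_point m (grid_index m (fst p)) of (t, x) \<Rightarrow> I t x (snd p)) else (0 :: real))
    \<in> borel_measurable (predictable M F)"
proof -
  let ?h = "\<lambda>k (p :: (real \<times> (real^'d)) \<times> 'w). if fst (fst p) > fst (grid_point m k) \<and> 0 \<le> fst k
      then I (fst (grid_point m k)) (snd (grid_point m k)) (snd p) else 0"
  have h: "?h k \<in> borel_measurable (predictable M F)" for k
  proof (cases "0 \<le> fst k")
    case True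
    hence "0 \<le> fst (grid_point m k)" by (simp add: grid_point_def)
    from predictable_after[OF I[OF this] this, of "snd (grid_point m k)"] show ?thesis
      using True by simp
  qed simp
  have "(\<lambda>p. ?h (grid_index m (fst p)) p) \<in> borel_measurable (predictable M F)"
    by (rule measurable_compose_countable[OF h measurable_compose[OF predictable_Borel grid_index_measurable]])
  also have "?this \<longleftrightarrow> ?thesis"
  proof (rule measurable_cong)
    fix p :: "(real \<times> (real^'d)) \<times> 'w" assume p: "p \<in> space (predictable M F)"
    show "?h (grid_index m (fst p)) p = (if fst (fst p) > 0 then
      (case grid_point m (grid_index m (fst p)) of (t, x) \<Rightarrow> I t x (snd p)) else 0)"
    proof (cases "fst (fst p) > 0")
      case True
      thus ?thesis using grid_point_close[OF m True] by (simp add: case_prod_unfold)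
    next
      case False
      hence "fst (fst p) = 0" using p by (auto simp: space_predictable)
      \<comment> \<open>At time 0 the time index is -1, so the guard selects the value 0.\<close>
      thus ?thesis by (simp add: grid_index_def)
    qed
  qed
  finally show ?thesis .
qed

text \<open>The integrals are chosen separately at each \<open>(t, x)\<close>, with no joint
  measurability. Their mean-square continuity, uniform on \<open>[0, n]\<close> times the whole
  space, gives a mesh whose samples err by at most \<open>(1 / 4) ^ n\<close> in mean square; at
  each point the samples therefore converge almost surely to the chosen integral.\<close>

lemma stochastic_convolution_version:
  assumes v: "field_predictable v"
    and bound: "\<And>T. \<exists>B. \<forall>s\<in>{0..T}. \<forall>y. (\<integral>\<^sup>+\<omega>. ennreal ((v s y \<omega>)\<^sup>2) \<partial>M) \<le> ennreal B"
  shows "\<exists>V. field_predictable V \<and>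
    (\<forall>t\<ge>0. \<forall>x. \<exists>I. walsh_integral M F W (integrand t x v) I \<and> (AE \<omega> in M. V t x \<omega> = I \<omega>))"
proof -
  have "\<exists>I. walsh_integral M F W (integrand t x v) I \<and> I \<in> borel_measurable (F t)" if t: "0 \<le> t" for t x
  proof (rule walsh_integral_exists[OF integrand_predictable[OF v] _ t])
    obtain B where B: "\<And>s y. s \<in> {0..t} \<Longrightarrow> (\<integral>\<^sup>+\<omega>. ennreal ((v s y \<omega>)\<^sup>2) \<partial>M) \<le> ennreal B"
      using bound[of t] by blast
    have "ito_norm (integrand t x v) \<le> ennreal (max B 0 * (kernel_const * 1 powr (\<gamma> - 1)) * exp (1 * t))"
    proof (rule integrand_bound[OF v])
      fix s y assume s: "0 \<le> s" "s < t"
      have "(\<integral>\<^sup>+\<omega>. ennreal ((v s y \<omega>)\<^sup>2) \<partial>M) \<le> ennreal B" using s by (intro B) auto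
      also have "\<dots> \<le> ennreal (max B 0 * exp (1 * s))"
      proof (rule ennreal_leI)
        have "max B 0 * 1 \<le> max B 0 * exp (1 * s)" using s by (intro mult_left_mono) auto
        thus "B \<le> max B 0 * exp (1 * s)" by linarith
      qed
      finally show "(\<integral>\<^sup>+\<omega>. ennreal ((v s y \<omega>)\<^sup>2) \<partial>M) \<le> ennreal (max B 0 * exp (1 * s))" .
    qed auto
    thus "ito_norm (integrand t x v) < \<infinity>" by (simp add: le_less_trans)
    show "integrand t x v z \<omega> = 0" if "fst z > t" for z \<omega>
      using that by (simp add: integrand_def G0_def)
  qed
  then obtain I where I: "\<And>t x. 0 \<le> t \<Longrightarrow> walsh_integral M F W (integrand t x v) (I t x)"
    "\<And>t x. 0 \<le> t \<Longrightarrow> I t x \<in> borel_measurable (F t)" by metis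
  have IM: "I t x \<in> borel_measurable M" if "0 \<le> t" for t x
    using I(2)[OF that] by (rule measurable_F)
  define mesh where "mesh n m \<longleftrightarrow> (\<forall>t t' x x'. 0 \<le> t \<longrightarrow> t \<le> real n \<longrightarrow> 0 \<le> t' \<longrightarrow> t' \<le> real n \<longrightarrow>
      norm ((t, x) - (t', x')) \<le> (1 + real CARD('d)) / real m \<longrightarrow>
      (\<integral>\<^sup>+\<omega>. ennreal ((I t x \<omega> - I t' x' \<omega>)\<^sup>2) \<partial>M) \<le> ennreal ((1 / 4) ^ n))" for n m :: nat
  have "\<exists>m. m > 0 \<and> mesh n m" for n
  proof -
    obtain B where B: "\<And>s y. s \<in> {0..real n} \<Longrightarrow> (\<integral>\<^sup>+\<omega>. ennreal ((v s y \<omega>)\<^sup>2) \<partial>M) \<le> ennreal B"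
      using bound[of "real n"] by blast
    define B' where "B' = max B 0 + 1"
    have B'0: "B' > 0" by (simp add: B'_def)
    have B': "(\<integral>\<^sup>+\<omega>. ennreal ((v s y \<omega>)\<^sup>2) \<partial>M) \<le> ennreal B'" if "0 \<le> s" "s \<le> real n" for s y
      using that by (intro order.trans[OF B ennreal_leI]) (auto simp: B'_def)
    \<comment> \<open>The 4 in the denominator cancels the one from
      \<open>walsh_integral_bound\<close>, and \<open>B'\<close> the moment bound, which was
      enlarged to be positive so that the division is possible.\<close>
    obtain d where d: "d > 0" "\<And>h. norm h < d \<Longrightarrow> modulus (real n) h \<le> ennreal ((1 / 4) ^ n / (4 * B'))"
      using modulus_small[of "(1 / 4) ^ n / (4 * B')" "real n"] B'0 by auto
    obtain m :: nat where m: "(1 + real CARD('d)) / d < real m" using reals_Archimedean2 by blast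
    have "(1 + real CARD('d)) / d > 0" using d by simp
    hence m0: "m > 0" using m by (cases m) auto
    have md: "(1 + real CARD('d)) / real m < d" using m m0 d by (simp add: field_simps)
    show ?thesis
      unfolding mesh_def
    proof (intro exI[of _ m] conjI allI impI m0)
      fix t t' :: real and x x' :: "real^'d"
      assume t: "0 \<le> t" "t \<le> real n" "0 \<le> t'" "t' \<le> real n"
        and n: "norm ((t, x) - (t', x')) \<le> (1 + real CARD('d)) / real m"
      have "(\<integral>\<^sup>+\<omega>. ennreal ((I t x \<omega> - I t' x' \<omega>)\<^sup>2) \<partial>M)
          \<le> 4 * ito_norm (\<lambda>z \<omega>. integrand t x v z \<omega> - integrand t' x' v z \<omega>)"
        by (rule walsh_integral_bound[OF walsh_integral_diff[OF I(1)[OF t(1)] I(1)[OF t(3)]]])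
      also have "\<dots> \<le> 4 * (ennreal B' * modulus (real n) ((t, x) - (t', x')))"
        by (intro mult_left_mono integrand_diff_bound[OF v t(2,4)] B') auto
      also have "\<dots> \<le> 4 * (ennreal B' * ennreal ((1 / 4) ^ n / (4 * B')))"
        using n md by (intro mult_left_mono d(2)) auto
      also have "\<dots> = ennreal (4 * (B' * ((1 / 4) ^ n / (4 * B'))))"
      proof -
        have "4 = ennreal 4" by simp
        thus ?thesis using B'0 by (simp only: ennreal_mult'[symmetric] less_imp_le)
      qed
      also have "4 * (B' * ((1 / 4) ^ n / (4 * B'))) = (1 / 4) ^ n" using B'0 by simp
      finally show "(\<integral>\<^sup>+\<omega>. ennreal ((I t x \<omega> - I t' x' \<omega>)\<^sup>2) \<partial>M) \<le> ennreal ((1 / 4) ^ n)" .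
    qed
  qed
  hence "\<forall>n. \<exists>m. m > 0 \<and> mesh n m" by blast
  from choice[OF this] obtain m where "\<forall>n. m n > 0 \<and> mesh n (m n)" ..
  hence m: "m n > 0" and m_mesh: "mesh n (m n)" for n by auto
  have m_close: "\<And>n t t' x x'. 0 \<le> t \<Longrightarrow> t \<le> real n \<Longrightarrow> 0 \<le> t' \<Longrightarrow>
      t' \<le> real n \<Longrightarrow> norm ((t, x) - (t', x')) \<le> (1 + real CARD('d)) / real (m n) \<Longrightarrow>
      (\<integral>\<^sup>+\<omega>. ennreal ((I t x \<omega> - I t' x' \<omega>)\<^sup>2) \<partial>M) \<le> ennreal ((1 / 4) ^ n)"
    using m_mesh unfolding mesh_def by blast
  define V where "V n p = (if fst (fst p) > 0 then
      (case grid_point (m n) (grid_index (m n) (fst p)) of (t, x) \<Rightarrow> I t x (snd p)) else (0 :: real))" for n p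
  have V: "V n \<in> borel_measurable (predictable M F)" for n
    unfolding V_def by (rule sampled_field_predictable[OF m I(2)])
  define U where "U t x \<omega> = seq_limit V ((t, x), \<omega>)" for t x \<omega>
  have U: "field_predictable U"
    unfolding field_predictable_def U_def using seq_limit_measurable[OF V] by simp
  have "AE \<omega> in M. U t x \<omega> = I t x \<omega>" if t: "0 \<le> t" for t x
  proof (cases "t = 0")
    case True
    have "integrand t x v z \<omega> = 0" if "z \<in> times_pos" for z \<omega>
      using that True by (auto simp: integrand_def G0_def)
    hence "ito_norm (integrand t x v) = ito_norm (\<lambda>z \<omega>. 0)" by (intro ito_cong) auto
    also have "\<dots> = 0" by (simp add: ito_norm_def)
    finally have "(\<integral>\<^sup>+\<omega>. ennreal ((I t x \<omega>)\<^sup>2) \<partial>M) \<le> 0"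
      using walsh_integral_bound[OF I(1)[OF t], of x] by simp
    hence "AE \<omega> in M. ennreal ((I t x \<omega>)\<^sup>2) = 0"
      using IM[OF t, of x] by (subst nn_integral_0_iff_AE[symmetric]) auto
    \<comment> \<open>At time 0 every sampled field is 0 by definition, so \<open>U\<close> vanishes
      there, in agreement with the integral, which is almost surely 0.\<close>
    moreover have "U t x \<omega> = 0" for \<omega>
      unfolding U_def by (rule seq_limit_eq) (simp add: V_def True)
    ultimately show ?thesis by auto
  next
    case False
    with t have t0: "t > 0" by simp
    obtain N :: nat where N: "t \<le> real N" using real_arch_simple by blast
    have "AE \<omega> in M. (\<lambda>n. V n ((t, x), \<omega>)) \<longlonglongrightarrow> I t x \<omega>"
    proof (rule AE_tendsto_of_power2_bound[where q = "1 / 4" and C = 1 and N = N])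
      fix n
      define a where "a = grid_point (m n) (grid_index (m n) (t, x))"
      note close = grid_point_close[OF m[of n], of "(t, x)", folded a_def, simplified fst_conv, OF t0]
      have Va: "V n ((t, x), \<omega>) = I (fst a) (snd a) \<omega>" for \<omega>
        using t0 by (simp add: V_def a_def case_prod_unfold)
      show "(\<lambda>\<omega>. V n ((t, x), \<omega>)) \<in> borel_measurable M"
        unfolding Va using IM[OF close(1)] by simp
      assume n: "n \<ge> N"
      have "(\<integral>\<^sup>+\<omega>. ennreal ((I t x \<omega> - I (fst a) (snd a) \<omega>)\<^sup>2) \<partial>M) \<le> ennreal ((1 / 4) ^ n)"
      proof (rule m_close)
        show "t \<le> real n" using N n by (meson of_nat_le_iff order_trans)
        thus "fst a \<le> real n" using close(2) by linarith
        show "norm ((t, x) - (fst a, snd a)) \<le> (1 + real CARD('d)) / real (m n)"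
          using close(4) by simp
      qed (use t close in auto)
      thus "(\<integral>\<^sup>+\<omega>. ennreal ((I t x \<omega> - V n ((t, x), \<omega>))\<^sup>2) \<partial>M) \<le> ennreal (1 * (1 / 4) ^ n)"
        unfolding Va by simp
    qed (use IM[OF t] in auto)
    thus ?thesis by eventually_elim (simp add: U_def seq_limit_eq)
  qed
  thus ?thesis using U I(1) by blast
qed

end

section \<open>Picard iteration\<close>

text \<open>\<open>K > 0\<close> and \<open>1 \<le> U\<close> cost nothing, as both bounds may be
  enlarged; they make \<open>growth_const\<close> and \<open>moment_const\<close> positive.\<close>

locale spde_problem = spde \<nu> \<alpha> \<beta> G M F W
  for \<nu> \<alpha> \<beta> :: real and G :: "real \<Rightarrow> real^'d \<Rightarrow> real" and M :: "'w measure" and F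
    and W :: "(real \<times> (real^'d)) set \<Rightarrow> 'w \<Rightarrow> real" +
  fixes u0 :: "real^'d \<Rightarrow> real" and \<sigma> :: "real \<Rightarrow> real" and K :: real and U :: real
  assumes u0_measurable [measurable]: "u0 \<in> borel_measurable borel"
    and u0_bound: "\<And>x. \<bar>u0 x\<bar> \<le> U" and U_ge_1: "1 \<le> U"
    and \<sigma>_lipschitz: "\<And>a b. \<bar>\<sigma> a - \<sigma> b\<bar> \<le> K * \<bar>a - b\<bar>" and \<sigma>_0: "\<sigma> 0 = 0" and K_pos: "K > 0"
begin

lemma \<sigma>_measurable [measurable]: "\<sigma> \<in> borel_measurable borel"
proof (rule borel_measurable_continuous_onI)
  have "K-lipschitz_on UNIV \<sigma>"
    using \<sigma>_lipschitz K_pos by (intro lipschitz_onI) (auto simp: dist_real_def)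
  thus "continuous_on UNIV \<sigma>" by (rule lipschitz_on_continuous_on)
qed

text \<open>A representative of \<open>heat_conv G u0\<close> that is Borel on all of space-time;
  \<open>G\<close> itself is controlled at positive times only.\<close>

definition initial_part :: "real \<times> (real^'d) \<Rightarrow> real" where
  "initial_part z = (if fst z = 0 then u0 (snd z) else (\<integral>y. G0 (fst z, snd z - y) * u0 y \<partial>lborel))"

lemma initial_part_eq: "0 \<le> t \<Longrightarrow> initial_part (t, x) = heat_conv G u0 t x"
  by (simp add: initial_part_def heat_conv_def G0_def)

lemma initial_part_measurable [measurable]: "initial_part \<in> borel_measurable borel"
proof -
  have [measurable]: "(\<lambda>p. G0 (fst (fst p), snd (fst p) - snd p) * u0 (snd p))
      \<in> borel_measurable ((borel :: (real \<times> (real^'d)) measure) \<Otimes>\<^sub>M lborel)"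
  proof -
    have "(\<lambda>p :: (real \<times> (real^'d)) \<times> (real^'d). (fst (fst p), snd (fst p) - snd p))
        \<in> borel \<Otimes>\<^sub>M lborel \<rightarrow>\<^sub>M borel \<Otimes>\<^sub>M borel" by measurable
    hence "(\<lambda>p :: (real \<times> (real^'d)) \<times> (real^'d). (fst (fst p), snd (fst p) - snd p))
        \<in> borel \<Otimes>\<^sub>M lborel \<rightarrow>\<^sub>M borel" unfolding borel_prod .
    from measurable_compose[OF this G0_measurable] show ?thesis by measurable
  qed
  have "(\<lambda>z. \<integral>y. G0 (fst z, snd z - y) * u0 y \<partial>lborel) \<in> borel_measurable borel"
    by (rule lborel.borel_measurable_lebesgue_integral) (simp add: case_prod_unfold)
  thus ?thesis unfolding initial_part_def by measurable
qed

definition initial_bound :: real where "initial_bound = U * (1 + kernel_L1)"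

lemma initial_bound_ge_1: "1 \<le> initial_bound"
  using mult_mono[of 1 U 1 "1 + kernel_L1"] U_ge_1 kernel_L1_nonneg by (simp add: initial_bound_def)

lemma heat_conv_bound:
  assumes "0 \<le> t" shows "\<bar>heat_conv G u0 t x\<bar> \<le> initial_bound"
proof (cases "t = 0")
  case True
  have "\<bar>u0 x\<bar> \<le> U" by (rule u0_bound)
  also have "\<dots> \<le> initial_bound"
    using U_ge_1 kernel_L1_nonneg by (simp add: initial_bound_def distrib_left)
  finally show ?thesis using True by (simp add: heat_conv_def)
next
  case False
  hence t: "t > 0" using assms by simp
  have i: "integrable lborel (\<lambda>y. \<bar>G t (x + (- 1) *\<^sub>R y)\<bar>)"
    by (intro integrable_abs integrable_lborel_affine G_integrable t) simp
  have "\<bar>\<integral>y. G t (x - y) * u0 y \<partial>lborel\<bar> \<le> (\<integral>y. \<bar>G t (x + (- 1) *\<^sub>R y)\<bar> * U \<partial>lborel)"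
  proof (rule order.trans[OF integral_abs_bound], rule integral_mono_AE')
    show "integrable lborel (\<lambda>y. \<bar>G t (x + (- 1) *\<^sub>R y)\<bar> * U)" using i by simp
    show "AE y in lborel. \<bar>G t (x - y) * u0 y\<bar> \<le> \<bar>G t (x + (- 1) *\<^sub>R y)\<bar> * U"
      using u0_bound by (intro AE_I2) (auto simp: abs_mult intro!: mult_left_mono)
    show "AE y in lborel. 0 \<le> \<bar>G t (x + (- 1) *\<^sub>R y)\<bar> * U" using U_ge_1 by simp
  qed
  also have "\<dots> = (\<integral>y. \<bar>G t (x + (- 1) *\<^sub>R y)\<bar> \<partial>lborel) * U" by simp
  also have "(\<integral>y. \<bar>G t (x + (- 1) *\<^sub>R y)\<bar> \<partial>lborel) = kernel_L1"
    using integral_lborel_affine[of "\<lambda>y. \<bar>G t y\<bar>" "-1" x] G_integrable[OF t] G_L1[OF t] by simp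
  also have "kernel_L1 * U \<le> initial_bound"
    using U_ge_1 by (simp add: initial_bound_def algebra_simps)
  finally show ?thesis using False by (simp add: heat_conv_def)
qed

text \<open>The Picard map as a relation between a field and one value of its image, since a
  stochastic integral is determined only almost surely. Being local in \<open>(t, x)\<close>, it
  also compares versions chosen differently.\<close>

definition mild_step :: "real \<Rightarrow> (real \<Rightarrow> real^'d \<Rightarrow> 'w \<Rightarrow> real) \<Rightarrow> real \<Rightarrow> real^'d \<Rightarrow> ('w \<Rightarrow> real) \<Rightarrow> bool" where
  "mild_step lam u t x w \<longleftrightarrow> (\<exists>I. walsh_integral M F W (integrand t x (\<lambda>s y \<omega>. \<sigma> (u s y \<omega>))) I
      \<and> (AE \<omega> in M. w \<omega> = heat_conv G u0 t x + lam * I \<omega>))"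

definition locally_bounded :: "(real \<Rightarrow> real^'d \<Rightarrow> 'w \<Rightarrow> real) \<Rightarrow> bool" where
  "locally_bounded u \<longleftrightarrow> (\<forall>T. \<exists>B. \<forall>t\<in>{0..T}. \<forall>x. (\<integral>\<^sup>+\<omega>. ennreal ((u t x \<omega>)\<^sup>2) \<partial>M) \<le> ennreal B)"

lemma mild_solution_iff:
  "mild_solution M F W G \<sigma> lam u0 u \<longleftrightarrow>
     field_predictable u \<and> locally_bounded u \<and> (\<forall>t\<ge>0. \<forall>x. mild_step lam u t x (u t x))"
proof -
  have eq: "(\<lambda>((t, x), \<omega>). u t x \<omega>) = (\<lambda>p. u (fst (fst p)) (snd (fst p)) (snd p))"
    by (simp add: case_prod_unfold)
  show ?thesis
    unfolding mild_solution_def field_predictable_def locally_bounded_def mild_step_def integrand_alt eq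
    using predictable_joint[of "\<lambda>p. u (fst (fst p)) (snd (fst p)) (snd p)"] by blast
qed

lemma \<sigma>_field_predictable: "field_predictable u \<Longrightarrow> field_predictable (\<lambda>s y \<omega>. \<sigma> (u s y \<omega>))"
  unfolding field_predictable_def by (rule measurable_compose[OF _ \<sigma>_measurable])

lemma diff_field_predictable:
  "field_predictable u \<Longrightarrow> field_predictable v \<Longrightarrow> field_predictable (\<lambda>s y \<omega>. u s y \<omega> - v s y \<omega>)"
  unfolding field_predictable_def by (rule borel_measurable_diff)

lemma nn_integral_\<sigma>_diff:
  assumes "u \<in> borel_measurable M" "v \<in> borel_measurable M"
    and "(\<integral>\<^sup>+\<omega>. ennreal ((u \<omega> - v \<omega>)\<^sup>2) \<partial>M) \<le> ennreal B"
  shows "(\<integral>\<^sup>+\<omega>. ennreal ((\<sigma> (u \<omega>) - \<sigma> (v \<omega>))\<^sup>2) \<partial>M) \<le> ennreal (K\<^sup>2 * B)"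
proof -
  have [measurable]: "u \<in> borel_measurable M" "v \<in> borel_measurable M" by fact+
  have "(\<integral>\<^sup>+\<omega>. ennreal ((\<sigma> (u \<omega>) - \<sigma> (v \<omega>))\<^sup>2) \<partial>M) \<le> (\<integral>\<^sup>+\<omega>. ennreal (K\<^sup>2) * ennreal ((u \<omega> - v \<omega>)\<^sup>2) \<partial>M)"
  proof (rule nn_integral_mono)
    fix \<omega>
    have "(\<sigma> (u \<omega>) - \<sigma> (v \<omega>))\<^sup>2 \<le> (K * \<bar>u \<omega> - v \<omega>\<bar>)\<^sup>2"
      using \<sigma>_lipschitz[of "u \<omega>" "v \<omega>"] K_pos by (simp add: abs_le_square_iff[symmetric] abs_mult)
    thus "ennreal ((\<sigma> (u \<omega>) - \<sigma> (v \<omega>))\<^sup>2) \<le> ennreal (K\<^sup>2) * ennreal ((u \<omega> - v \<omega>)\<^sup>2)"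
      by (simp add: power_mult_distrib ennreal_mult'[symmetric] ennreal_leI)
  qed
  also have "\<dots> = ennreal (K\<^sup>2) * (\<integral>\<^sup>+\<omega>. ennreal ((u \<omega> - v \<omega>)\<^sup>2) \<partial>M)"
    by (rule nn_integral_cmult) measurable
  also have "\<dots> \<le> ennreal (K\<^sup>2) * ennreal B" by (intro mult_left_mono assms(3)) auto
  finally show ?thesis by (simp add: ennreal_mult'[symmetric])
qed

text \<open>The 16 is the product of the 4 from \<open>walsh_integral_bound\<close> and the 4 that
  forces the ratio 1/4; the added 1 keeps the constant positive if \<open>kernel_const\<close> is
  0.\<close>

definition growth_const :: real where "growth_const = 16 * K\<^sup>2 * (kernel_const + 1)"

text \<open>The solution \<theta> of \<open>growth_const * lam\<^sup>2 * \<theta> powr (\<gamma> -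
  1) = 1\<close>.\<close>

definition rate :: "real \<Rightarrow> real" where
  "rate lam = growth_const powr (1 / (1 - \<gamma>)) * lam powr (2 / (1 - \<gamma>))"

lemma growth_const_pos: "growth_const > 0"
  using kernel_const_nonneg K_pos by (simp add: growth_const_def)

lemma rate_pos: "lam > 0 \<Longrightarrow> rate lam > 0"
  using growth_const_pos by (simp add: rate_def)

text \<open>The exponential weight makes the Picard map contract: the factor is \<open>lam\<^sup>2\<close> times a constant
  times \<open>\<theta> powr (\<gamma> - 1)\<close>, which forces \<open>\<theta>\<close> to be of order \<open>lam powr (2 / (1 - \<gamma>))\<close>.\<close>
lemma rate_contraction:
  assumes lam: "lam > 0"
  shows "4 * lam\<^sup>2 * K\<^sup>2 * (kernel_const * rate lam powr (\<gamma> - 1)) \<le> 1 / 4"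
proof -
  have g: "1 - \<gamma> > 0" using \<gamma>_bounds by simp
  have e1: "1 / (1 - \<gamma>) * (\<gamma> - 1) = - 1" and e2: "2 / (1 - \<gamma>) * (\<gamma> - 1) = - 2"
    using g by (simp_all add: field_simps)
  have "rate lam powr (\<gamma> - 1) = growth_const powr (- 1) * lam powr (- 2)"
    unfolding rate_def using growth_const_pos lam
    by (simp only: powr_mult powr_powr e1 e2 powr_ge_zero less_imp_le)
  also have "\<dots> = 1 / (growth_const * lam\<^sup>2)"
    using growth_const_pos lam by (simp add: powr_minus powr_numeral divide_inverse)
  finally have r: "rate lam powr (\<gamma> - 1) = 1 / (growth_const * lam\<^sup>2)" .
  have "4 * lam\<^sup>2 * K\<^sup>2 * (kernel_const * rate lam powr (\<gamma> - 1)) = 4 * K\<^sup>2 * kernel_const / growth_const"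
    unfolding r using lam growth_const_pos by (simp add: field_simps)
  also have "\<dots> \<le> 1 / 4"
    using K_pos kernel_const_nonneg growth_const_pos
    by (subst divide_le_eq) (auto simp: growth_const_def field_simps)
  finally show ?thesis .
qed

text \<open>The deterministic parts cancel, and the Lipschitz bound feeds
  \<open>integrand_bound\<close> with \<theta> = \<open>rate lam\<close>. The hypothesis concerns
  times before t only, because the kernel vanishes from t on; a bound on \<open>[0, t]\<close> is
  thus enough to iterate.\<close>

lemma mild_step_diff:
  assumes u: "field_predictable u" and v: "field_predictable v" and lam: "lam > 0" and t: "0 \<le> t" and B: "B \<ge> 0"
    and w: "mild_step lam u t x w" "w \<in> borel_measurable M"
    and w': "mild_step lam v t x w'" "w' \<in> borel_measurable M"
    and bound: "\<And>s y. 0 \<le> s \<Longrightarrow> s < t \<Longrightarrow>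
      (\<integral>\<^sup>+\<omega>. ennreal ((u s y \<omega> - v s y \<omega>)\<^sup>2) \<partial>M) \<le> ennreal (B * exp (rate lam * s))"
  shows "(\<integral>\<^sup>+\<omega>. ennreal ((w \<omega> - w' \<omega>)\<^sup>2) \<partial>M) \<le> ennreal (B / 4 * exp (rate lam * t))"
proof -
  let ?\<kappa> = "kernel_const * rate lam powr (\<gamma> - 1)"
  let ?d = "\<lambda>s y \<omega>. \<sigma> (u s y \<omega>) - \<sigma> (v s y \<omega>)"
  obtain I where I: "walsh_integral M F W (integrand t x (\<lambda>s y \<omega>. \<sigma> (u s y \<omega>))) I"
    "AE \<omega> in M. w \<omega> = heat_conv G u0 t x + lam * I \<omega>" using w(1) unfolding mild_step_def by blast
  obtain J where J: "walsh_integral M F W (integrand t x (\<lambda>s y \<omega>. \<sigma> (v s y \<omega>))) J"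
    "AE \<omega> in M. w' \<omega> = heat_conv G u0 t x + lam * J \<omega>" using w'(1) unfolding mild_step_def by blast
  have [measurable]: "I \<in> borel_measurable M" "J \<in> borel_measurable M"
    using I(1) J(1) by (auto intro: walsh_measurable)
  have d: "field_predictable ?d" by (intro diff_field_predictable \<sigma>_field_predictable u v)
  have "(\<integral>\<^sup>+\<omega>. ennreal ((w \<omega> - w' \<omega>)\<^sup>2) \<partial>M) = (\<integral>\<^sup>+\<omega>. ennreal (lam\<^sup>2) * ennreal ((I \<omega> - J \<omega>)\<^sup>2) \<partial>M)"
  proof (rule nn_integral_cong_AE, use I(2) J(2) in eventually_elim)
    case (elim \<omega>)
    have "w \<omega> - w' \<omega> = lam * (I \<omega> - J \<omega>)" unfolding elim by (simp add: algebra_simps)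
    thus ?case by (simp add: power_mult_distrib ennreal_mult')
  qed
  also have "\<dots> = ennreal (lam\<^sup>2) * (\<integral>\<^sup>+\<omega>. ennreal ((I \<omega> - J \<omega>)\<^sup>2) \<partial>M)"
    by (rule nn_integral_cmult) measurable
  also have "\<dots> \<le> ennreal (lam\<^sup>2) * (4 * ito_norm (integrand t x ?d))"
  proof (rule mult_left_mono)
    have "integrand t x ?d = (\<lambda>z \<omega>. integrand t x (\<lambda>s y \<omega>. \<sigma> (u s y \<omega>)) z \<omega>
        - integrand t x (\<lambda>s y \<omega>. \<sigma> (v s y \<omega>)) z \<omega>)"
      by (simp add: integrand_def right_diff_distrib fun_eq_iff)
    thus "(\<integral>\<^sup>+\<omega>. ennreal ((I \<omega> - J \<omega>)\<^sup>2) \<partial>M) \<le> 4 * ito_norm (integrand t x ?d)"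
      using walsh_integral_bound[OF walsh_integral_diff[OF I(1) J(1)]] by (simp only:)
  qed simp
  also have "\<dots> \<le> ennreal (lam\<^sup>2) * (4 * ennreal (K\<^sup>2 * B * ?\<kappa> * exp (rate lam * t)))"
  proof (intro mult_left_mono integrand_bound[OF d rate_pos[OF lam]])
    fix s y assume s: "0 \<le> s" "s < t"
    show "(\<integral>\<^sup>+\<omega>. ennreal ((?d s y \<omega>)\<^sup>2) \<partial>M) \<le> ennreal (K\<^sup>2 * B * exp (rate lam * s))"
      using nn_integral_\<sigma>_diff[OF field_section[OF u s(1)] field_section[OF v s(1)] bound[OF s]]
      by (simp add: mult.assoc)
  qed (use B in auto)
  also have "\<dots> = ennreal (4 * lam\<^sup>2 * K\<^sup>2 * ?\<kappa> * (B * exp (rate lam * t)))"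
  proof -
    have "4 = ennreal 4" by simp
    thus ?thesis by (simp only: ennreal_mult'[symmetric] zero_le_power2 zero_le_numeral) (simp add: mult_ac)
  qed
  also have "\<dots> \<le> ennreal (1 / 4 * (B * exp (rate lam * t)))"
    using B by (intro ennreal_leI mult_right_mono rate_contraction lam) auto
  finally show ?thesis by (simp add: mult.assoc)
qed

lemma zero_field: "field_predictable (\<lambda>t x \<omega>. 0)"
  by (simp add: field_predictable_def)

text \<open>Since \<open>\<sigma> 0 = 0\<close>, the image of the zero field is the deterministic
  part, so the moment estimate becomes a special case of the difference estimate.\<close>

lemma mild_step_zero:
  assumes t: "0 \<le> t"
  shows "mild_step lam (\<lambda>t x \<omega>. 0) t x (\<lambda>\<omega>. heat_conv G u0 t x)"
proof -
  have "integrand t x (\<lambda>s y \<omega>. \<sigma> 0) = (\<lambda>z \<omega>. 0)" by (simp add: integrand_def \<sigma>_0 fun_eq_iff)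
  moreover have "walsh_integral M F W (\<lambda>z \<omega>. 0) (\<lambda>\<omega>. 0)"
  proof -
    have "ito_norm (\<lambda>z \<omega>. 0) = 0" by (simp add: ito_norm_def)
    thus ?thesis
      by (subst walsh_integral_iff)
        (auto intro!: exI[of _ "\<lambda>_. []"] simp: simple_ok_def simple_eval_def simple_int_def)
  qed
  ultimately show ?thesis unfolding mild_step_def by (intro exI[of _ "\<lambda>\<omega>. 0"]) simp
qed

text \<open>The fixed point of the recursion
  \<open>B \<mapsto> B / 2 + 2 * initial_bound\<^sup>2\<close>, which is the effect of one step on a
  moment bound in \<open>mild_step_moment\<close>.\<close>

definition moment_const :: real where "moment_const = 4 * initial_bound\<^sup>2"

lemma moment_const_pos: "moment_const > 0"
  using initial_bound_ge_1 by (simp add: moment_const_def)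

lemma mild_step_moment:
  assumes u: "field_predictable u" and lam: "lam > 0" and t: "0 \<le> t" and B: "B \<ge> 0"
    and w: "mild_step lam u t x w" "w \<in> borel_measurable M"
    and bound: "\<And>s y. 0 \<le> s \<Longrightarrow> s < t \<Longrightarrow>
      (\<integral>\<^sup>+\<omega>. ennreal ((u s y \<omega>)\<^sup>2) \<partial>M) \<le> ennreal (B * exp (rate lam * s))"
  shows "(\<integral>\<^sup>+\<omega>. ennreal ((w \<omega>)\<^sup>2) \<partial>M) \<le> ennreal ((moment_const + B) / 2 * exp (rate lam * t))"
proof -
  let ?h = "heat_conv G u0 t x"
  have "(\<integral>\<^sup>+\<omega>. ennreal ((w \<omega> - ?h)\<^sup>2) \<partial>M) \<le> ennreal (B / 4 * exp (rate lam * t))"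
    by (rule mild_step_diff[OF u zero_field lam t B w mild_step_zero[OF t]]) (use bound in auto)
  moreover have "(\<integral>\<^sup>+\<omega>. ennreal (?h\<^sup>2) \<partial>M) \<le> ennreal (initial_bound\<^sup>2)"
    using heat_conv_bound[OF t, of x] initial_bound_ge_1
    by (simp add: emeasure_space_1 ennreal_leI abs_le_square_iff[symmetric])
  moreover have "(\<integral>\<^sup>+\<omega>. ennreal ((w \<omega>)\<^sup>2) \<partial>M)
      \<le> 2 * (\<integral>\<^sup>+\<omega>. ennreal ((w \<omega> - ?h)\<^sup>2) \<partial>M) + 2 * (\<integral>\<^sup>+\<omega>. ennreal (?h\<^sup>2) \<partial>M)"
    using nn_integral_add_power2_le[of "\<lambda>\<omega>. w \<omega> - ?h" M "\<lambda>\<omega>. ?h"] w(2) by simp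
  ultimately have "(\<integral>\<^sup>+\<omega>. ennreal ((w \<omega>)\<^sup>2) \<partial>M)
      \<le> 2 * ennreal (B / 4 * exp (rate lam * t)) + 2 * ennreal (initial_bound\<^sup>2)"
    by (meson add_mono mult_left_mono order.trans zero_le)
  also have "\<dots> = ennreal (2 * (B / 4 * exp (rate lam * t)) + 2 * initial_bound\<^sup>2)"
  proof -
    have "2 = ennreal 2" by simp
    thus ?thesis using B
      by (simp only: ennreal_mult'[symmetric] zero_le_numeral) (subst ennreal_plus; simp)
  qed
  also have "\<dots> \<le> ennreal ((moment_const + B) / 2 * exp (rate lam * t))"
  proof (rule ennreal_leI)
    have "1 \<le> exp (rate lam * t)" using rate_pos[OF lam] t by simp
    hence "2 * initial_bound\<^sup>2 * 1 \<le> 2 * initial_bound\<^sup>2 * exp (rate lam * t)" by (intro mult_left_mono) auto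
    thus "2 * (B / 4 * exp (rate lam * t)) + 2 * initial_bound\<^sup>2 \<le> (moment_const + B) / 2 * exp (rate lam * t)"
      by (simp add: moment_const_def field_simps)
  qed
  finally show ?thesis .
qed

text \<open>Makes the relation \<open>mild_step\<close> solvable by an actual predictable field:
  \<open>initial_part\<close> represents the deterministic term and a version of the stochastic
  convolution the random one.\<close>

lemma picard_step:
  assumes u: "field_predictable u" and bd: "locally_bounded u"
  shows "\<exists>w. field_predictable w \<and> (\<forall>t\<ge>0. \<forall>x. mild_step lam u t x (w t x))"
proof -
  have "\<exists>B. \<forall>s\<in>{0..T}. \<forall>y. (\<integral>\<^sup>+\<omega>. ennreal ((\<sigma> (u s y \<omega>))\<^sup>2) \<partial>M) \<le> ennreal B" for T
  proof -
    obtain B where B: "\<And>s y. s \<in> {0..T} \<Longrightarrow> (\<integral>\<^sup>+\<omega>. ennreal ((u s y \<omega>)\<^sup>2) \<partial>M) \<le> ennreal B"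
      using bd unfolding locally_bounded_def by blast
    have "(\<integral>\<^sup>+\<omega>. ennreal ((\<sigma> (u s y \<omega>))\<^sup>2) \<partial>M) \<le> ennreal (K\<^sup>2 * B)" if "s \<in> {0..T}" for s y
      using nn_integral_\<sigma>_diff[of "u s y" "\<lambda>\<omega>. 0" B] B[OF that, of y] field_section[OF u, of s y] that
      by (simp add: \<sigma>_0)
    thus ?thesis by blast
  qed
  from stochastic_convolution_version[OF \<sigma>_field_predictable[OF u] this]
  obtain V where V: "field_predictable V" "\<And>t x. 0 \<le> t \<Longrightarrow>
      \<exists>I. walsh_integral M F W (integrand t x (\<lambda>s y \<omega>. \<sigma> (u s y \<omega>))) I \<and> (AE \<omega> in M. V t x \<omega> = I \<omega>)"
    by blast
  define w where "w t x \<omega> = initial_part (t, x) + lam * V t x \<omega>" for t x \<omega>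
  have "field_predictable w"
    unfolding field_predictable_def w_def prod.collapse
    using V(1)[unfolded field_predictable_def] measurable_compose[OF predictable_Borel initial_part_measurable]
    by (intro borel_measurable_add borel_measurable_times borel_measurable_const) auto
  moreover have "mild_step lam u t x (w t x)" if t: "0 \<le> t" for t x
  proof -
    obtain I where I: "walsh_integral M F W (integrand t x (\<lambda>s y \<omega>. \<sigma> (u s y \<omega>))) I"
      "AE \<omega> in M. V t x \<omega> = I \<omega>" using V(2)[OF t] by blast
    have "AE \<omega> in M. w t x \<omega> = heat_conv G u0 t x + lam * I \<omega>"
      using I(2) by eventually_elim (simp add: w_def initial_part_eq[OF t])
    thus ?thesis unfolding mild_step_def using I(1) by blast
  qed
  ultimately show ?thesis by blast
qed

section \<open>Uniqueness, growth and existence\<close>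

lemma nn_integral_power2_zero_AE:
  assumes "u \<in> borel_measurable M" "v \<in> borel_measurable M"
    and "(\<lambda>n. ennreal (c * (1 / 4) ^ n)) = b" and "\<And>n. (\<integral>\<^sup>+\<omega>. ennreal ((u \<omega> - v \<omega>)\<^sup>2) \<partial>M) \<le> b n"
  shows "AE \<omega> in M. u \<omega> = v \<omega>"
proof -
  have "(\<lambda>n. c * (1 / 4) ^ n) \<longlonglongrightarrow> c * 0" by (intro tendsto_intros LIMSEQ_power_zero) simp
  from tendsto_ennrealI[OF this] have "b \<longlonglongrightarrow> 0" unfolding assms(3)[symmetric] by simp
  from LIMSEQ_le_const[OF this] assms(4) have "(\<integral>\<^sup>+\<omega>. ennreal ((u \<omega> - v \<omega>)\<^sup>2) \<partial>M) \<le> 0" by blast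
  hence "AE \<omega> in M. ennreal ((u \<omega> - v \<omega>)\<^sup>2) = 0"
    using assms(1,2) by (subst nn_integral_0_iff_AE[symmetric]) auto
  thus ?thesis by eventually_elim simp
qed

text \<open>Local boundedness supplies a finite weighted distance \<open>B\<close> on
  \<open>[0, t]\<close>. Both fields are images of themselves, so each use of the difference
  estimate divides it by 4.\<close>

lemma mild_solution_unique:
  assumes lam: "lam > 0" and u: "mild_solution M F W G \<sigma> lam u0 u" and v: "mild_solution M F W G \<sigma> lam u0 v"
    and t: "0 \<le> t"
  shows "AE \<omega> in M. u t x \<omega> = v t x \<omega>"
proof -
  note U = u[unfolded mild_solution_iff] and V = v[unfolded mild_solution_iff]
  have up: "field_predictable u" and vp: "field_predictable v" using U V by auto
  obtain C where C: "\<And>s y. s \<in> {0..t} \<Longrightarrow> (\<integral>\<^sup>+\<omega>. ennreal ((u s y \<omega>)\<^sup>2) \<partial>M) \<le> ennreal C"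
    using U unfolding locally_bounded_def by blast
  obtain C' where C': "\<And>s y. s \<in> {0..t} \<Longrightarrow> (\<integral>\<^sup>+\<omega>. ennreal ((v s y \<omega>)\<^sup>2) \<partial>M) \<le> ennreal C'"
    using V unfolding locally_bounded_def by blast
  define B where "B = 2 * max C 0 + 2 * max C' 0"
  have B: "B \<ge> 0" by (simp add: B_def)
  have bound: "(\<integral>\<^sup>+\<omega>. ennreal ((u s y \<omega> - v s y \<omega>)\<^sup>2) \<partial>M) \<le> ennreal (B * (1 / 4) ^ n * exp (rate lam * s))"
    if "0 \<le> s" "s \<le> t" for s y n
    using that
  proof (induction n arbitrary: s y)
    case 0
    have m [measurable]: "u s y \<in> borel_measurable M" "v s y \<in> borel_measurable M"
      using 0 by (auto intro: field_section up vp)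
    have "(\<integral>\<^sup>+\<omega>. ennreal ((u s y \<omega> - v s y \<omega>)\<^sup>2) \<partial>M)
        \<le> 2 * (\<integral>\<^sup>+\<omega>. ennreal ((u s y \<omega>)\<^sup>2) \<partial>M) + 2 * (\<integral>\<^sup>+\<omega>. ennreal ((v s y \<omega>)\<^sup>2) \<partial>M)"
      using nn_integral_add_power2_le[of "u s y" M "\<lambda>\<omega>. - v s y \<omega>"] by simp
    also have "\<dots> \<le> 2 * ennreal (max C 0) + 2 * ennreal (max C' 0)"
      using 0 by (intro add_mono mult_left_mono order.trans[OF C] order.trans[OF C'] ennreal_leI) auto
    also have "\<dots> = ennreal B"
    proof -
      have "2 = ennreal 2" by simp
      thus ?thesis unfolding B_def
        by (simp only: ennreal_mult'[symmetric] zero_le_numeral) (subst ennreal_plus; simp)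
    qed
    also have "\<dots> \<le> ennreal (B * (1 / 4) ^ 0 * exp (rate lam * s))"
    proof (rule ennreal_leI)
      have "1 \<le> exp (rate lam * s)" using rate_pos[OF lam] 0 by simp
      hence "B * 1 \<le> B * exp (rate lam * s)" using B by (intro mult_left_mono) auto
      thus "B \<le> B * (1 / 4) ^ 0 * exp (rate lam * s)" by simp
    qed
    finally show ?case .
  next
    case (Suc n)
    have "(\<integral>\<^sup>+\<omega>. ennreal ((u s y \<omega> - v s y \<omega>)\<^sup>2) \<partial>M) \<le> ennreal (B * (1 / 4) ^ n / 4 * exp (rate lam * s))"
      using Suc B U V
      by (intro mild_step_diff[OF up vp lam, where x = y] field_section up vp) auto
    thus ?case by simp
  qed
  show ?thesis
  proof (rule nn_integral_power2_zero_AE[OF _ _ refl])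
    show "(\<integral>\<^sup>+\<omega>. ennreal ((u t x \<omega> - v t x \<omega>)\<^sup>2) \<partial>M) \<le> ennreal (B * exp (rate lam * t) * (1 / 4) ^ n)" for n
      using bound[OF t order_refl, of x n] by (simp add: mult_ac)
  qed (use t in \<open>auto intro: field_section up vp\<close>)
qed

text \<open>The initial bound \<open>C\<close> may depend on t, on \<open>lam\<close> and on the
  solution. Each step halves its share and reproduces \<open>moment_const\<close>, so that in the
  limit only a constant independent of all three remains.\<close>

lemma mild_solution_moment:
  assumes lam: "lam > 0" and u: "mild_solution M F W G \<sigma> lam u0 u" and t: "0 \<le> t"
  shows "(\<integral>\<^sup>+\<omega>. ennreal ((u t x \<omega>)\<^sup>2) \<partial>M) \<le> ennreal (moment_const * exp (rate lam * t))"
proof -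
  note U = u[unfolded mild_solution_iff]
  have up: "field_predictable u" using U by auto
  obtain C where C: "\<And>s y. s \<in> {0..t} \<Longrightarrow> (\<integral>\<^sup>+\<omega>. ennreal ((u s y \<omega>)\<^sup>2) \<partial>M) \<le> ennreal C"
    using U unfolding locally_bounded_def by blast
  define B where "B = max C 0"
  have B: "B \<ge> 0" by (simp add: B_def)
  note A = moment_const_pos
  have bound: "(\<integral>\<^sup>+\<omega>. ennreal ((u s y \<omega>)\<^sup>2) \<partial>M) \<le> ennreal ((moment_const + B * (1 / 2) ^ n) * exp (rate lam * s))"
    if "0 \<le> s" "s \<le> t" for s y n
    using that
  proof (induction n arbitrary: s y)
    case 0
    have "(\<integral>\<^sup>+\<omega>. ennreal ((u s y \<omega>)\<^sup>2) \<partial>M) \<le> ennreal C" using 0 by (intro C) auto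
    also have "\<dots> \<le> ennreal ((moment_const + B * (1 / 2) ^ 0) * exp (rate lam * s))"
    proof (rule ennreal_leI)
      have "1 \<le> exp (rate lam * s)" using rate_pos[OF lam] 0 by simp
      hence "(moment_const + B) * 1 \<le> (moment_const + B) * exp (rate lam * s)"
        using B A by (intro mult_left_mono) auto
      thus "C \<le> (moment_const + B * (1 / 2) ^ 0) * exp (rate lam * s)" using A by (simp add: B_def)
    qed
    finally show ?case .
  next
    case (Suc n)
    have "(\<integral>\<^sup>+\<omega>. ennreal ((u s y \<omega>)\<^sup>2) \<partial>M)
        \<le> ennreal ((moment_const + (moment_const + B * (1 / 2) ^ n)) / 2 * exp (rate lam * s))"
      using Suc B U A
      by (intro mild_step_moment[OF up lam, where x = y] field_section up) auto
    also have "(moment_const + (moment_const + B * (1 / 2) ^ n)) / 2 = moment_const + B * (1 / 2) ^ Suc n"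
      by simp
    finally show ?case .
  qed
  have "(\<lambda>n. (moment_const + B * (1 / 2) ^ n) * exp (rate lam * t)) \<longlonglongrightarrow> (moment_const + B * 0) * exp (rate lam * t)"
    by (intro tendsto_intros LIMSEQ_power_zero) simp
  from LIMSEQ_le_const[OF tendsto_ennrealI[OF this]] bound[OF t order_refl, of x]
  have "(\<integral>\<^sup>+\<omega>. ennreal ((u t x \<omega>)\<^sup>2) \<partial>M) \<le> ennreal ((moment_const + B * 0) * exp (rate lam * t))" by blast
  thus ?thesis by simp
qed

lemma mild_solution_exists:
  assumes lam: "lam > 0"
  shows "\<exists>u. mild_solution M F W G \<sigma> lam u0 u"
proof -
  define A where "A = moment_const"
  have A: "A > 0" unfolding A_def by (rule moment_const_pos)
  let ?e = "\<lambda>t. exp (rate lam * t)"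
  \<comment> \<open>A ball that the Picard step maps into itself, as its radius is the fixed point
    of the moment recursion.\<close>
  define P where "P u \<longleftrightarrow> field_predictable u \<and>
      (\<forall>t\<ge>0. \<forall>x. (\<integral>\<^sup>+\<omega>. ennreal ((u t x \<omega>)\<^sup>2) \<partial>M) \<le> ennreal (A * ?e t))" for u :: "real \<Rightarrow> real^'d \<Rightarrow> 'w \<Rightarrow> real"
  have bounded: "locally_bounded u"
    if "\<And>t x. 0 \<le> t \<Longrightarrow> (\<integral>\<^sup>+\<omega>. ennreal ((u t x \<omega>)\<^sup>2) \<partial>M) \<le> ennreal (C * ?e t)" "0 \<le> C" for u C
    unfolding locally_bounded_def
  proof (intro allI exI ballI)
    fix T t :: real and x assume t: "t \<in> {0..T}"
    have "?e t \<le> ?e T" using rate_pos[OF lam] t by simp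
    thus "(\<integral>\<^sup>+\<omega>. ennreal ((u t x \<omega>)\<^sup>2) \<partial>M) \<le> ennreal (C * ?e T)"
      using t that(2) by (intro order.trans[OF that(1)] ennreal_leI mult_left_mono) auto
  qed
  have "\<exists>w. P w \<and> (\<forall>t\<ge>0. \<forall>x. mild_step lam u t x (w t x))" if u: "P u" for u
  proof -
    have up: "field_predictable u" and ub: "\<And>t x. 0 \<le> t \<Longrightarrow> (\<integral>\<^sup>+\<omega>. ennreal ((u t x \<omega>)\<^sup>2) \<partial>M) \<le> ennreal (A * ?e t)"
      using u by (auto simp: P_def)
    obtain w where w: "field_predictable w" "\<And>t x. 0 \<le> t \<Longrightarrow> mild_step lam u t x (w t x)"
      using picard_step[OF up bounded[OF ub]] A by (meson less_imp_le)
    have "(\<integral>\<^sup>+\<omega>. ennreal ((w t x \<omega>)\<^sup>2) \<partial>M) \<le> ennreal ((moment_const + A) / 2 * ?e t)" if "0 \<le> t" for t x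
      using A that by (intro mild_step_moment[OF up lam that _ w(2)[OF that]] field_section w ub) auto
    hence "P w" using w(1) by (simp add: P_def A_def)
    thus ?thesis using w(2) by blast
  qed
  hence "\<forall>u. \<exists>w. P u \<longrightarrow> P w \<and> (\<forall>t\<ge>0. \<forall>x. mild_step lam u t x (w t x))" by blast
  from choice[OF this] obtain \<Phi> where
    "\<forall>u. P u \<longrightarrow> P (\<Phi> u) \<and> (\<forall>t\<ge>0. \<forall>x. mild_step lam u t x (\<Phi> u t x))" ..
  hence \<Phi>: "\<And>u. P u \<Longrightarrow> P (\<Phi> u)"
    "\<And>u t x. P u \<Longrightarrow> 0 \<le> t \<Longrightarrow> mild_step lam u t x (\<Phi> u t x)" by blast+
  define X where "X n = (\<Phi> ^^ n) (\<lambda>t x \<omega>. 0)" for n :: nat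
  have X0: "X 0 = (\<lambda>t x \<omega>. 0)" and XS: "X (Suc n) = \<Phi> (X n)" for n by (simp_all add: X_def)
  have PX: "P (X n)" for n
  proof (induction n)
    case 0
    show ?case using A zero_field by (simp add: P_def X0)
  qed (simp add: XS \<Phi>)
  have Xp: "field_predictable (X n)" for n using PX by (simp add: P_def)
  have Xb: "(\<integral>\<^sup>+\<omega>. ennreal ((X n t x \<omega>)\<^sup>2) \<partial>M) \<le> ennreal (A * ?e t)" if "0 \<le> t" for n t x
    using PX[of n] that by (simp add: P_def)
  have XM: "X n t x \<in> borel_measurable M" if "0 \<le> t" for n t x
    by (rule field_section[OF Xp that])
  have cauchy: "(\<integral>\<^sup>+\<omega>. ennreal ((X m t x \<omega> - X n t x \<omega>)\<^sup>2) \<partial>M) \<le> ennreal (A * (1 / 4) ^ n * ?e t)"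
    if "n \<le> m" "0 \<le> t" for n m t x
    using that
  proof (induction n arbitrary: m t x)
    case 0
    show ?case using Xb[OF 0(2), of m x] by (simp add: X0)
  next
    case (Suc n)
    obtain m' where m': "m = Suc m'" "n \<le> m'" using Suc(2) by (metis Suc_le_D Suc_le_mono)
    have "(\<integral>\<^sup>+\<omega>. ennreal ((X m t x \<omega> - X (Suc n) t x \<omega>)\<^sup>2) \<partial>M) \<le> ennreal (A * (1 / 4) ^ n / 4 * ?e t)"
    proof (rule mild_step_diff[OF Xp[of m'] Xp[of n] lam Suc(3)])
      show "mild_step lam (X m') t x (X m t x)" "mild_step lam (X n) t x (X (Suc n) t x)"
        unfolding m' XS by (intro \<Phi>(2) PX Suc(3))+
    qed (use A m' Suc XM in auto)
    thus ?case by simp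
  qed
  \<comment> \<open>The limit is taken on the product space, which makes it predictable; at fixed
    \<open>(t, x)\<close> it is also the limit of the sections, to which the mean-square bounds
    apply.\<close>
  define u where "u t x \<omega> = seq_limit (\<lambda>n p. X n (fst (fst p)) (snd (fst p)) (snd p)) ((t, x), \<omega>)" for t x \<omega>
  have up: "field_predictable u"
    unfolding field_predictable_def u_def prod.collapse
    using seq_limit_measurable[OF Xp[unfolded field_predictable_def]] by simp
  have u_eq: "u t x = seq_limit (\<lambda>n. X n t x)" for t x
    by (simp add: u_def seq_limit_def fun_eq_iff)
  have u_lim: "(\<integral>\<^sup>+\<omega>. ennreal ((u t x \<omega> - X n t x \<omega>)\<^sup>2) \<partial>M) \<le> ennreal (A * ?e t * (1 / 4) ^ n)" if "0 \<le> t" for t x n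
    unfolding u_eq using cauchy[OF _ that]
    by (intro seq_limit_power2_bound XM that) (auto simp: mult_ac)
  have ub: "(\<integral>\<^sup>+\<omega>. ennreal ((u t x \<omega>)\<^sup>2) \<partial>M) \<le> ennreal (A * ?e t)" if "0 \<le> t" for t x
    using u_lim[OF that, of x 0] by (simp add: X0)
  have ubd: "locally_bounded u" using ub A by (intro bounded[of u A]) auto
  have "mild_step lam u t x (u t x)" if t: "0 \<le> t" for t x
  proof -
    \<comment> \<open>The equation is not passed to the limit directly. Instead \<open>w\<close> is
      an image of the limit \<open>u\<close>, and comparing both with the iterates shows that they
      agree almost surely at each point.\<close>
    obtain w where w: "field_predictable w" "\<And>t x. 0 \<le> t \<Longrightarrow> mild_step lam u t x (w t x)"
      using picard_step[OF up ubd] by blast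
    have m [measurable]: "u t x \<in> borel_measurable M" "w t x \<in> borel_measurable M"
      using t by (auto intro: field_section up w)
    have uw: "AE \<omega> in M. u t x \<omega> = w t x \<omega>"
    proof (rule nn_integral_power2_zero_AE[OF m refl])
      fix n
      have "(\<integral>\<^sup>+\<omega>. ennreal ((X (Suc n) t x \<omega> - w t x \<omega>)\<^sup>2) \<partial>M) \<le> ennreal (A * (1 / 4) ^ n / 4 * ?e t)"
      proof (rule mild_step_diff[OF Xp up lam t])
        show "mild_step lam (X n) t x (X (Suc n) t x)" unfolding XS by (intro \<Phi>(2) PX t)
        show "mild_step lam u t x (w t x)" by (rule w(2)[OF t])
        fix s y assume s: "0 \<le> s" "s < t"
        show "(\<integral>\<^sup>+\<omega>. ennreal ((X n s y \<omega> - u s y \<omega>)\<^sup>2) \<partial>M) \<le> ennreal (A * (1 / 4) ^ n * ?e s)"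
          using u_lim[OF s(1), of y n] by (simp add: power2_commute[of "X n _ _ _"] mult_ac)
      qed (use A t XM in auto)
      also have "A * (1 / 4) ^ n / 4 * ?e t = A * ?e t * (1 / 4) ^ Suc n" by simp
      finally have 1: "(\<integral>\<^sup>+\<omega>. ennreal ((X (Suc n) t x \<omega> - w t x \<omega>)\<^sup>2) \<partial>M) \<le> ennreal (A * ?e t * (1 / 4) ^ Suc n)" .
      \<comment> \<open>The iterate \<open>X (Suc n)\<close> is close to \<open>u\<close> as a term
        of the sequence and close to \<open>w\<close> because it is an image of \<open>X n\<close>;
        the two errors add up to \<open>(1 / 4) ^ n\<close> times the constant.\<close>
      have "(\<integral>\<^sup>+\<omega>. ennreal ((u t x \<omega> - w t x \<omega>)\<^sup>2) \<partial>M)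
          \<le> 2 * (\<integral>\<^sup>+\<omega>. ennreal ((u t x \<omega> - X (Suc n) t x \<omega>)\<^sup>2) \<partial>M)
            + 2 * (\<integral>\<^sup>+\<omega>. ennreal ((X (Suc n) t x \<omega> - w t x \<omega>)\<^sup>2) \<partial>M)"
        using nn_integral_add_power2_le[of "\<lambda>\<omega>. u t x \<omega> - X (Suc n) t x \<omega>" M "\<lambda>\<omega>. X (Suc n) t x \<omega> - w t x \<omega>"]
          XM[OF t] by simp
      also have "\<dots> \<le> 2 * ennreal (A * ?e t * (1 / 4) ^ Suc n) + 2 * ennreal (A * ?e t * (1 / 4) ^ Suc n)"
        by (intro add_mono mult_left_mono u_lim t 1) auto
      also have "\<dots> = ennreal (A * ?e t * (1 / 4) ^ n)"
        using ennreal_quarters[of "A * ?e t * (1 / 4) ^ n"] A by simp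
      finally show "(\<integral>\<^sup>+\<omega>. ennreal ((u t x \<omega> - w t x \<omega>)\<^sup>2) \<partial>M) \<le> ennreal (A * ?e t * (1 / 4) ^ n)" .
    qed
    obtain I where I: "walsh_integral M F W (integrand t x (\<lambda>s y \<omega>. \<sigma> (u s y \<omega>))) I"
      "AE \<omega> in M. w t x \<omega> = heat_conv G u0 t x + lam * I \<omega>" using w(2)[OF t, of x] unfolding mild_step_def by blast
    have "AE \<omega> in M. u t x \<omega> = heat_conv G u0 t x + lam * I \<omega>"
      using uw I(2) by eventually_elim simp
    thus ?thesis unfolding mild_step_def using I(1) by blast
  qed
  thus ?thesis unfolding mild_solution_iff using up ubd by blast
qed

end

theorem theorem1:
  fixes \<nu> \<alpha> \<beta> L\<sigma> :: real
    and M :: "'w measure" and F :: "real \<Rightarrow> 'w measure"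
    and W :: "(real \<times> (real^'d)) set \<Rightarrow> 'w \<Rightarrow> real"
    and G :: "real \<Rightarrow> real^'d \<Rightarrow> real"
    and u0 :: "real^'d \<Rightarrow> real" and \<sigma> :: "real \<Rightarrow> real"
  assumes "\<nu> > 0" and "0 < \<alpha>" and "\<alpha> \<le> 2" and "0 < \<beta>" and "\<beta> < 1"
    and "real CARD('d) < min 2 (1 / \<beta>) * \<alpha>"
    and "white_noise M F W"
    and "frac_heat_kernel \<nu> \<alpha> \<beta> G"
    and "u0 \<in> borel_measurable lborel" and "bounded (range u0)" and "\<forall>x. u0 x \<ge> 0"
    and "\<exists>K. \<forall>a b. \<bar>\<sigma> a - \<sigma> b\<bar> \<le> K * \<bar>a - b\<bar>"
    and "L\<sigma> > 0" and "\<forall>a. \<bar>\<sigma> a\<bar> \<le> L\<sigma> * \<bar>a\<bar>"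
  shows "(\<forall>lam>0. (\<exists>u. mild_solution M F W G \<sigma> lam u0 u) \<and>
            (\<forall>u v. mild_solution M F W G \<sigma> lam u0 u \<and> mild_solution M F W G \<sigma> lam u0 v \<longrightarrow>
                (\<forall>t\<ge>0. \<forall>x. AE \<omega> in M. u t x \<omega> = v t x \<omega>))) \<and>
         (\<exists>c1>0. \<exists>c2>0. \<forall>lam>0. \<forall>u. mild_solution M F W G \<sigma> lam u0 u \<longrightarrow>
            (\<forall>t>0. \<forall>x. (\<integral>\<^sup>+\<omega>. ennreal ((u t x \<omega>)\<^sup>2) \<partial>M)
               \<le> ennreal (c1 * exp (c2 * lam powr (2 * \<alpha> / (\<alpha> - real CARD('d) * \<beta>)) * t))))"
proof -
  obtain K where K: "\<And>a b. \<bar>\<sigma> a - \<sigma> b\<bar> \<le> K * \<bar>a - b\<bar>" using assms(12) by blast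
  obtain U where U: "\<And>x. \<bar>u0 x\<bar> \<le> U" using assms(10) by (auto simp: bounded_iff)
  have K1: "\<bar>\<sigma> a - \<sigma> b\<bar> \<le> max K 1 * \<bar>a - b\<bar>" for a b
    by (rule order.trans[OF K mult_right_mono]) auto
  have U1: "\<bar>u0 x\<bar> \<le> max U 1" for x using U[of x] by simp
  interpret prob_space M using assms(7) by (simp add: white_noise_def)
  interpret spde_problem \<nu> \<alpha> \<beta> G M F W u0 \<sigma> "max K 1" "max U 1"
  proof unfold_locales
    show "0 < \<nu>" "0 < \<alpha>" "0 < \<beta>" "\<beta> < 1" "real CARD('d) < min 2 (1 / \<beta>) * \<alpha>"
      "frac_heat_kernel \<nu> \<alpha> \<beta> G" "white_noise M F W" by (fact assms)+
    show "\<bar>u0 x\<bar> \<le> max U 1" for x by (rule U1)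
    show "\<bar>\<sigma> a - \<sigma> b\<bar> \<le> max K 1 * \<bar>a - b\<bar>" for a b by (rule K1)
    show "u0 \<in> borel_measurable borel" using assms(9) by simp
    show "\<sigma> 0 = 0" using assms(14)[rule_format, of 0] by simp
  qed simp_all
  \<comment> \<open>By the definition of \<open>rate\<close>, all dependence on \<open>lam\<close>
    is in the power; this factor depends only on the kernel constants, the Lipschitz constant and
    \<gamma>.\<close>
  define c2 where "c2 = growth_const powr (1 / (1 - \<gamma>))"
  have c2: "c2 > 0" using growth_const_pos by (simp add: c2_def)
  have "1 - \<gamma> = (\<alpha> - real CARD('d) * \<beta>) / \<alpha>"
    using assms(2) by (simp add: \<gamma>_def diff_divide_distrib)
  hence "2 / (1 - \<gamma>) = 2 * \<alpha> / (\<alpha> - real CARD('d) * \<beta>)" by simp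
  hence rate: "rate lam = c2 * lam powr (2 * \<alpha> / (\<alpha> - real CARD('d) * \<beta>))" for lam
    by (simp only: rate_def c2_def)
  show ?thesis
  proof (intro conjI allI impI)
    fix lam :: real assume lam: "lam > 0"
    show "\<exists>u. mild_solution M F W G \<sigma> lam u0 u" by (rule mild_solution_exists[OF lam])
    fix u v t x
    assume "mild_solution M F W G \<sigma> lam u0 u \<and> mild_solution M F W G \<sigma> lam u0 v" "t \<ge> (0::real)"
    thus "AE \<omega> in M. u t x \<omega> = v t x \<omega>" using mild_solution_unique[OF lam] by blast
  next
    show "\<exists>c1>0. \<exists>c2>0. \<forall>lam>0. \<forall>u. mild_solution M F W G \<sigma> lam u0 u \<longrightarrow>
        (\<forall>t>0. \<forall>x. (\<integral>\<^sup>+\<omega>. ennreal ((u t x \<omega>)\<^sup>2) \<partial>M)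
          \<le> ennreal (c1 * exp (c2 * lam powr (2 * \<alpha> / (\<alpha> - real CARD('d) * \<beta>)) * t)))"
      using moment_const_pos c2 mild_solution_moment[unfolded rate]
      by (intro exI[of _ moment_const] exI[of _ c2] conjI allI impI) auto
  qed
qed

end
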